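(* Let $m\ge 2$ and $k\in\{1,2,\ldots,m-1\}$ be integers. Then $$ \sum_{r=1}^{m-1}\gamma_1\!\left(\frac rm\right)\cos\frac{2\pi rk}{m}=-\gamma_1+m(\gamma+\ln 2\pi m)\ln\!\left(2\sin\frac{k\pi}{m}\right)+\frac m2\left\{\zeta''\!\left(0,\frac km\right)+\zeta''\!\left(0,1-\frac km\right)\right\} $$ and $$ \sum_{r=1}^{m-1}\gamma_1\!\left(\frac rm\right)\sin\frac{2\pi rk}{m}=\frac\pi2(\gamma+\ln 2\pi m)(2k-m)-\frac{\pi m}{2}\left\{\ln\pi-\ln\sin\frac{k\pi}{m}\right\}+m\pi\ln\Gamma\!\left(\frac km\right). $$
   Context: $\zeta(s,v)$ is the Hurwitz zeta function, $\zeta(s,v)=\sum_{n\ge0}(n+v)^{-s}$ for $\operatorname{Re}s>1$, continued meromorphically in $s$. The generalized Stieltjes constants $\gamma_n(v)$ are defined by the Laurent expansion at $s=1$: $\zeta(s,v)=\frac1{s-1}+\sum_{n\ge0}\frac{(-1)^n(s-1)^n}{n!}\gamma_n(v)$; the Stieltjes constants are $\gamma_n=\gamma_n(1)$, and $\gamma=\gamma_0$ is Euler's constant. $\zeta''(0,v)$ denotes the second derivative of $\zeta(s,v)$ with respect to $s$ at $s=0$. $\ln 2\pi m$ means $\ln(2\pi m)$. *)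

theory Defs
  imports "HOL-Complex_Analysis.Complex_Analysis"
begin

(* The meromorphic continuation of the Hurwitz series, for a real parameter v > 0.
   A function that is nicely meromorphic on the plane has no removable singularities
   and takes the value 0 at its poles, so the description determines it uniquely;
   in particular the value at s = 1 is the conventional 0. *)
definition hurwitz_zeta :: "complex \<Rightarrow> real \<Rightarrow> complex" where
  "hurwitz_zeta s v =
     (THE f. f nicely_meromorphic_on UNIV \<and>
        (\<forall>z. Re z > 1 \<longrightarrow> f z = (\<Sum>n. complex_of_real (real n + v) powr (- z)))) s"

(* The coefficient of (s - 1)^n in the Laurent expansion of zeta(s, v) at s = 1
   is (-1)^n gamma_n(v) / n!. The values are real for v > 0, but are kept in the
   type complex. *)
definition stieltjes_gamma :: "nat \<Rightarrow> real \<Rightarrow> complex" where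
  "stieltjes_gamma n v =
     (- 1) ^ n * fact n * fls_nth (laurent_expansion (\<lambda>s. hurwitz_zeta s v) 1) (int n)"

end

theory Submission
  imports Defs
begin

text \<open>
  Put \<open>x = k/m\<close> and \<open>w = exp (2 \<pi> i x)\<close>. The sum over \<open>r = 1, \<dots>, m\<close> of \<open>w\<^sup>r \<zeta>(s, r/m)\<close> extends to
  an entire function, and its derivative at \<open>s = 1\<close> is minus the sum of the \<open>w\<^sup>r \<gamma>\<^sub>1(r/m)\<close>.
  For \<open>Re s > 1\<close>, \<open>\<Gamma>(s) \<zeta>(s, v)\<close> is the Mellin transform of \<open>exp (-v u) / (1 - exp (-u))\<close>;
  subtracting the first two terms of the kernel's expansion at 0 gives the continuation to
  \<open>-1 < s < 0\<close>. In the weighted sum over \<open>r\<close> the kernels collapse to \<open>q / (1 - q)\<close> with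
  \<open>q = w exp (-u/m)\<close>, and integrating the partial fractions of this cotangent termwise expresses
  the sum through \<open>\<zeta>(1 - s, x)\<close> and \<open>\<zeta>(1 - s, 1 - x)\<close>. Splitting this functional equation into
  its cosine and sine parts, the cosine formula is its second derivative at \<open>s = 1\<close> and the sine
  formula its first derivative. The values needed at 0, \<open>\<zeta>(0, v) = 1/2 - v\<close> and Lerch's
  \<open>\<zeta>'(0, v) = ln \<Gamma>(v) - ln (2\<pi>) / 2\<close>, come from a series for \<open>\<zeta>(s, v) - \<zeta>(s, 1)\<close> that converges
  for \<open>Re s > -1\<close>, together with \<open>\<zeta>(s, 1/2) + \<zeta>(s, 1) = 2\<^sup>s \<zeta>(s, 1)\<close>.
\<close>

section \<open>Mellin transforms\<close>

text \<open>The weighted kernel tends to the nonzero constant w/(1 - w) at 0. Once this constant is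
  subtracted, the kernel is O(u) at 0 and bounded at infinity, hence integrable against u^(s-1) for
  -1 < s < 0. In the same strip the series of zeta(1 - s, x) converges absolutely, so termwise
  integration is legitimate. The identity is first proved for real s, where the termwise integral is
  a Beta integral, and then extended by the identity theorem. For that purpose all divisions are
  cleared: 1/Gamma replaces Gamma, and the pole of zeta is split off, leaving an entire regular
  part. The orders of differentiation differ because cos(pi s/2) has a simple zero at s = 1, so the
  derivative of the cosine sum first shows in the second derivative of the product, whereas sin(pi
  s/2) equals 1 there with vanishing derivative. A Mellin transform is stated as a relation,
  integrability together with value, so that linear combinations, dilations and series carry
  convergence along.\<close>

definition has_mellin :: "(real \<Rightarrow> complex) \<Rightarrow> complex \<Rightarrow> complex \<Rightarrow> bool" where
  "has_mellin K s I \<longleftrightarrow>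
     set_integrable lborel {0<..} (\<lambda>u. complex_of_real u powr (s - 1) * K u) \<and>
     (LINT u:{0<..}|lborel. complex_of_real u powr (s - 1) * K u) = I"

lemma has_mellin_cong:
  assumes "\<And>u. u > 0 \<Longrightarrow> K u = L u"
  shows "has_mellin K s I \<longleftrightarrow> has_mellin L s I"
proof -
  have "set_integrable lborel {0<..} (\<lambda>u. complex_of_real u powr (s - 1) * K u) =
        set_integrable lborel {0<..} (\<lambda>u. complex_of_real u powr (s - 1) * L u)"
    by (rule set_integrable_cong) (use assms in auto)
  moreover have "(LINT u:{0<..}|lborel. complex_of_real u powr (s - 1) * K u) =
        (LINT u:{0<..}|lborel. complex_of_real u powr (s - 1) * L u)"
    by (rule set_lebesgue_integral_cong) (use assms in auto)
  ultimately show ?thesis by (simp add: has_mellin_def)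
qed

lemma has_mellin_unique: "has_mellin K s I \<Longrightarrow> has_mellin K s J \<Longrightarrow> I = J"
  by (simp add: has_mellin_def)

lemma has_mellin_0: "has_mellin (\<lambda>u. 0) s 0"
  by (simp add: has_mellin_def set_integrable_def)

lemma has_mellin_add:
  assumes "has_mellin K s I" "has_mellin L s J"
  shows "has_mellin (\<lambda>u. K u + L u) s (I + J)"
  using assms by (auto simp: has_mellin_def algebra_simps)

lemma has_mellin_cmult:
  assumes "has_mellin K s I"
  shows "has_mellin (\<lambda>u. c * K u) s (c * I)"
proof -
  have "(\<lambda>u. complex_of_real u powr (s - 1) * (c * K u)) =
        (\<lambda>u. c * (complex_of_real u powr (s - 1) * K u))"
    by (simp add: algebra_simps)
  thus ?thesis using assms by (auto simp: has_mellin_def)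
qed

lemma has_mellin_diff:
  assumes "has_mellin K s I" "has_mellin L s J"
  shows "has_mellin (\<lambda>u. K u - L u) s (I - J)"
  using has_mellin_add[OF assms(1) has_mellin_cmult[OF assms(2), of "-1"]] by simp

lemma has_mellin_sum:
  assumes "finite A" "\<And>r. r \<in> A \<Longrightarrow> has_mellin (K r) s (I r)"
  shows "has_mellin (\<lambda>u. \<Sum>r\<in>A. K r u) s (\<Sum>r\<in>A. I r)"
  using assms by (induction A rule: finite_induct) (auto intro: has_mellin_0 has_mellin_add)

lemma has_mellin_scale:
  assumes "has_mellin K s I" "c > 0"
  shows "has_mellin (\<lambda>u. K (c * u)) s (complex_of_real c powr (-s) * I)"
proof -
  define f where "f = (\<lambda>u::real. indicator {0<..} u *\<^sub>R (complex_of_real u powr (s - 1) * K u))"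
  define g where "g = (\<lambda>u::real. indicator {0<..} u *\<^sub>R (complex_of_real u powr (s - 1) * K (c * u)))"
  \<comment> \<open>The exponent \<open>1 - s\<close> becomes \<open>- s\<close> through the
    Jacobian 1/c of the dilation.\<close>
  have fg: "g u = complex_of_real c powr (1 - s) * f (c * u)" for u
  proof (cases "u > 0")
    case True
    have "complex_of_real (c * u) powr (s - 1) = complex_of_real c powr (s - 1) * complex_of_real u powr (s - 1)"
      using True assms(2) by (simp add: powr_times_real)
    moreover have "complex_of_real c powr (1 - s) * complex_of_real c powr (s - 1) = 1"
      using assms(2) by (simp flip: powr_add)
    ultimately show ?thesis using True assms(2) by (simp add: f_def g_def indicator_def)
  next
    case False
    thus ?thesis using assms(2) by (simp add: f_def g_def indicator_def zero_less_mult_iff)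
  qed
  have intf: "integrable lborel f" and If: "integral\<^sup>L lborel f = I"
    using assms(1) by (auto simp: has_mellin_def f_def set_integrable_def set_lebesgue_integral_def)
  have "integrable lborel (\<lambda>u. f (0 + c * u))"
    using assms(2) intf by (intro lborel_integrable_real_affine) auto
  hence "integrable lborel g" by (simp add: fg[abs_def])
  moreover have "I = c *\<^sub>R integral\<^sup>L lborel (\<lambda>u. f (0 + c * u))"
    using lborel_integral_real_affine[of c f 0] assms(2) If by simp
  hence "integral\<^sup>L lborel g = complex_of_real c powr (-s) * I"
    using assms(2) by (simp add: fg[abs_def] scaleR_conv_of_real powr_diff powr_minus_divide)
  ultimately show ?thesis
    by (simp add: has_mellin_def g_def set_integrable_def set_lebesgue_integral_def)
qed

text \<open>Termwise integration under summable L1 norms. Because |u^(s-1)| = u^(Re s - 1), the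
  norms are themselves Mellin transforms at the real point \<open>Re s\<close>, so the closed form
  that evaluates a term can also bound it.\<close>

lemma has_mellin_sums:
  assumes f: "\<And>n. has_mellin (f n) s (I n)"
    and N: "\<And>n. has_mellin (\<lambda>u. complex_of_real (norm (f n u))) (complex_of_real (Re s)) (complex_of_real (N n))"
    and "summable N"
    and sumn: "\<And>u. u > 0 \<Longrightarrow> summable (\<lambda>n. norm (f n u))"
    and K: "\<And>u. u > 0 \<Longrightarrow> (\<lambda>n. f n u) sums K u"
  shows "has_mellin K s (\<Sum>n. I n)" "I sums (\<Sum>n. I n)"
proof -
  define F where "F = (\<lambda>n u. indicator {0<..} u *\<^sub>R (complex_of_real u powr (s - 1) * f n u))"
  have intF: "integrable lborel (F n)" and IF: "integral\<^sup>L lborel (F n) = I n" for n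
    using f[of n] by (auto simp: has_mellin_def F_def set_integrable_def set_lebesgue_integral_def)
  have normF: "complex_of_real (norm (F n u)) =
      indicator {0<..} u *\<^sub>R (complex_of_real u powr (complex_of_real (Re s) - 1) * complex_of_real (norm (f n u)))" for n u
  proof -
    have "complex_of_real u powr (complex_of_real (Re s) - 1) = complex_of_real (u powr (Re s - 1))" if "u > 0"
      using powr_of_real[of u "Re s - 1"] that by simp
    thus ?thesis by (auto simp: F_def indicator_def norm_mult norm_powr_real_powr)
  qed
  have "complex_of_real (integral\<^sup>L lborel (\<lambda>u. norm (F n u))) = complex_of_real (N n)" for n
    using N[of n] by (simp add: has_mellin_def set_lebesgue_integral_def normF flip: integral_complex_of_real)
  hence "integral\<^sup>L lborel (\<lambda>u. norm (F n u)) = N n" for n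
    using of_real_eq_iff by blast
  hence sumN: "summable (\<lambda>n. integral\<^sup>L lborel (\<lambda>u. norm (F n u)))"
    using assms(3) by simp
  have sumF: "AE u in lborel. summable (\<lambda>n. norm (F n u))"
    by (rule AE_I2) (auto simp: F_def indicator_def norm_mult intro!: summable_mult sumn)
  have KF: "(\<Sum>n. F n u) = indicator {0<..} u *\<^sub>R (complex_of_real u powr (s - 1) * K u)" for u
    using K[of u] by (auto simp: F_def indicator_def sums_iff suminf_mult)
  have "integrable lborel (\<lambda>u. \<Sum>n. F n u)"
    by (rule integrable_suminf[OF intF sumF sumN])
  moreover have "integral\<^sup>L lborel (\<lambda>u. \<Sum>n. F n u) = (\<Sum>n. I n)"
    using integral_suminf[OF intF sumF sumN] by (simp add: IF)
  ultimately show "has_mellin K s (\<Sum>n. I n)"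
    by (simp add: has_mellin_def set_integrable_def set_lebesgue_integral_def KF)
  show "I sums (\<Sum>n. I n)"
    using sums_integral[OF intF sumF sumN] unfolding IF by (simp add: sums_iff)
qed

text \<open>Absolute integrability of gauge integrals refers to the completed Lebesgue measure;
  continuity supplies the Borel measurability that brings it down to \<open>lborel\<close>.\<close>

lemma set_integrable_lebesgue_imp_lborel:
  fixes f :: "real \<Rightarrow> complex"
  assumes "continuous_on A f" "A \<in> sets borel" "f absolutely_integrable_on A"
  shows "set_integrable lborel A f"
proof -
  have "(\<lambda>x. indicator A x *\<^sub>R f x) \<in> borel_measurable borel"
    using set_measurable_continuous_on[OF assms(2,1)] by (simp add: set_borel_measurable_def)
  thus ?thesis
    using assms(3) by (simp add: set_integrable_def integrable_completion)
qed

text \<open>The zero extension outside \<open>A\<close> lets an integral be cut at u = 1: the part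
  near 0 is then treated by power series, the part near infinity as an entire function.\<close>

lemma has_mellinI_has_integral:
  assumes "continuous_on A K" "A \<in> sets borel" "A \<subseteq> {0<..}"
    and "(\<lambda>u. complex_of_real u powr (s - 1) * K u) absolutely_integrable_on A"
    and "((\<lambda>u. complex_of_real u powr (s - 1) * K u) has_integral I) A"
  shows "has_mellin (\<lambda>u. if u \<in> A then K u else 0) s I"
proof -
  let ?f = "\<lambda>u. complex_of_real u powr (s - 1) * K u"
  have "continuous_on A ?f"
    using assms(1,3) by (intro continuous_intros) auto
  hence int: "set_integrable lborel A ?f"
    using assms(2,4) by (intro set_integrable_lebesgue_imp_lborel)
  moreover have "(LINT u:A|lborel. ?f u) = I"
    using set_borel_integral_eq_integral(2)[OF int] assms(5) by (simp add: integral_unique)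
  moreover have "indicator {0<..} u *\<^sub>R (complex_of_real u powr (s - 1) * (if u \<in> A then K u else 0)) =
      indicator A u *\<^sub>R ?f u" for u
    using assms(3) by (auto simp: indicator_def)
  ultimately show ?thesis
    by (simp add: has_mellin_def set_integrable_def set_lebesgue_integral_def)
qed

section \<open>Mellin transforms of exponentials and powers\<close>

lemma has_mellin_exp:
  assumes "Re s > 0"
  shows "has_mellin (\<lambda>u. complex_of_real (exp (- u))) s (Gamma s)"
proof -
  have eq: "(\<lambda>u. complex_of_real u powr (s - 1) * complex_of_real (exp (- u))) =
        (\<lambda>t. complex_of_real t powr (s - 1) / complex_of_real (exp t))"
    by (simp add: exp_minus field_simps)
  have "has_mellin (\<lambda>u. if u \<in> {0<..} then complex_of_real (exp (- u)) else 0) s (Gamma s)"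
    using absolutely_integrable_Gamma_integral'[OF assms] Gamma_integral_complex'[OF assms]
    by (intro has_mellinI_has_integral) (auto intro!: continuous_intros simp: eq)
  thus ?thesis by (subst (asm) has_mellin_cong) auto
qed

lemma has_mellin_powr_from_0:
  assumes "Re (s + p) > 0"
  shows "has_mellin (\<lambda>u. if u \<in> {0<..1} then complex_of_real u powr p else 0) s (1 / (s + p))"
proof (rule has_mellinI_has_integral)
  let ?z = "s + p" and ?f = "\<lambda>t. complex_of_real t powr (s - 1) * complex_of_real t powr p"
  have f: "?f t = complex_of_real t powr (?z - 1)" for t
    by (simp add: powr_add [symmetric] algebra_simps)
  have z: "?z \<noteq> 0" using assms by (metis less_irrefl zero_complex.simps(1))
  have "((\<lambda>t. complex_of_real t powr (?z - 1)) has_integral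
          (complex_of_real 1 powr ?z / ?z - complex_of_real 0 powr ?z / ?z)) {0..1}"
    using assms z
    by (intro fundamental_theorem_of_calculus_interior)
       (auto intro!: continuous_intros derivative_eq_intros has_vector_derivative_real_field)
  hence "(?f has_integral (1 / ?z)) {0..1}"
    unfolding f by simp
  moreover have "negligible {t \<in> {0..1} - {0<..1}. ?f t \<noteq> 0}" "negligible {t \<in> {0<..1} - {0..1}. ?f t \<noteq> 0}"
    by (auto intro!: negligible_subset[OF negligible_sing[of 0]])
  ultimately show int: "(?f has_integral (1 / ?z)) {0<..1}"
    using has_integral_spike_set_eq[of "{0..1}" "{0<..1}" ?f] by blast
  have "(\<lambda>x. x powr (Re ?z - 1)) integrable_on {0<..1}"
    using integrable_on_powr_from_0'[of "Re ?z - 1" 1] assms by simp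
  thus "?f absolutely_integrable_on {0<..1}"
    by (rule absolutely_integrable_integrable_bound[rotated 2])
       (use int in \<open>auto simp: f norm_powr_real_powr has_integral_iff\<close>)
qed (auto intro!: continuous_intros)

text \<open>The value is the rational function 1/(s + p) of the transform over (0, 1], with the
  opposite sign and on the complementary half-plane. Moving a power from one side of u = 1 to the
  other therefore continues a transform across a pole.\<close>

lemma has_mellin_powr_to_inf:
  fixes s p :: real
  assumes "s + p < 0"
  shows "has_mellin (\<lambda>u. if u \<in> {1<..} then complex_of_real (u powr p) else 0) (complex_of_real s)
           (complex_of_real (- 1 / (s + p)))"
proof (rule has_mellinI_has_integral)
  let ?f = "\<lambda>t. complex_of_real t powr (complex_of_real s - 1) * complex_of_real (t powr p)"
  have f: "?f t = complex_of_real (t powr (s + p - 1))" if "t \<in> {1<..}" for t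
    using that powr_of_real[of t "s - 1"] by (simp add: powr_diff powr_add flip: of_real_mult)
  have "((\<lambda>t. t powr (s + p - 1)) has_integral (- 1 / (s + p))) {1..}"
    using has_integral_powr_to_inf[of "s + p - 1" 1] assms by simp
  moreover have "negligible {t \<in> {1..} - {1<..}. t powr (s + p - 1) \<noteq> 0}" "negligible {t \<in> {1<..} - {1..}. t powr (s + p - 1) \<noteq> 0}"
    by (auto intro!: negligible_subset[OF negligible_sing[of 1]])
  ultimately have int: "((\<lambda>t. t powr (s + p - 1)) has_integral (- 1 / (s + p))) {1<..}"
    using has_integral_spike_set_eq[of "{1..}" "{1<..}" "\<lambda>t. t powr (s + p - 1)"] by blast
  have "((\<lambda>t. complex_of_real (t powr (s + p - 1))) has_integral complex_of_real (- 1 / (s + p))) {1<..}"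
    using int by (rule has_integral_of_real)
  thus int': "(?f has_integral complex_of_real (- 1 / (s + p))) {1<..}"
    by (subst has_integral_cong[OF f]) auto
  have "(\<lambda>t. t powr (s + p - 1)) integrable_on {1<..}"
    using int by blast
  thus "?f absolutely_integrable_on {1<..}"
    by (rule absolutely_integrable_integrable_bound[rotated 2])
       (use int' in \<open>simp_all only: f has_integral_iff norm_of_real abs_of_nonneg powr_ge_zero order_refl\<close>)
qed (auto intro!: continuous_intros)

text \<open>Expanding \<open>u powr (s - 1) = exp ((s - 1) ln u)\<close> under the integral gives a power series in
  \<open>s - 1\<close> that converges everywhere.\<close>

lemma entire_mellin:
  assumes "\<And>\<sigma>. set_integrable lborel {1<..} (\<lambda>u. complex_of_real (u powr \<sigma>) * K u)"
  obtains E where "E holomorphic_on UNIV" "\<And>s. has_mellin (\<lambda>u. if u \<in> {1<..} then K u else 0) s (E s)"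
proof -
  define L where "L = (\<lambda>u. indicator {1<..} u *\<^sub>R K u)"
  have intL: "integrable lborel (\<lambda>u. complex_of_real (u powr \<sigma>) * L u)" for \<sigma>
    using assms[of \<sigma>] by (simp add: set_integrable_def L_def)
  have [measurable]: "L \<in> borel_measurable lborel"
  proof -
    have "L u = complex_of_real (u powr 0) * L u" for u by (auto simp: L_def)
    thus ?thesis using borel_measurable_integrable[OF intL[of 0]] by presburger
  qed
  define e where "e = (\<lambda>n. LINT u|lborel. complex_of_real (ln u ^ n / fact n) * L u)"
  define E where "E = (\<lambda>s. LINT u|lborel. complex_of_real u powr (s - 1) * L u)"
  \<comment> \<open>Partial sums of the exponential series are bounded by exp(|z| ln u), so one
    dominating function, integrable by assumption with exponent |s - 1|, serves all of them.\<close>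
  have aux: "norm (\<Sum>k<n. complex_of_real (ln u ^ k / fact k) * z ^ k) \<le> u powr (norm z)"
    if "u > 1" for u :: real and n and z :: complex
  proof -
    have "norm (\<Sum>k<n. complex_of_real (ln u ^ k / fact k) * z ^ k) \<le> (\<Sum>k<n. (norm z * ln u) ^ k / fact k)"
      by (rule sum_norm_le) (use that in \<open>auto simp: norm_mult norm_power norm_divide power_mult_distrib mult.commute\<close>)
    also have "\<dots> = (\<Sum>k<n. (norm z * ln u) ^ k /\<^sub>R fact k)" by (simp add: field_simps)
    also have "\<dots> \<le> (\<Sum>k. (norm z * ln u) ^ k /\<^sub>R fact k)"
      by (rule sum_le_suminf) (use that summable_exp_generic[of "norm z * ln u"] in \<open>auto intro!: mult_nonneg_nonneg\<close>)
    also have "\<dots> = u powr norm z" using that by (simp add: powr_def exp_def)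
    finally show ?thesis .
  qed
  have term_int: "integrable lborel (\<lambda>u. (complex_of_real (ln u ^ n / fact n) * z ^ n) * L u)" for n z
  proof -
    have "integrable lborel (\<lambda>u. complex_of_real (ln u ^ n / fact n) * L u)"
    \<comment> \<open>\<open>ln u ^ n / fact n\<close> is a single term of the exponential series of
      \<open>ln u\<close>, hence at most \<open>u\<close>; the exponent 1 therefore works for every
      \<open>n\<close>.\<close>
    proof (rule Bochner_Integration.integrable_bound[OF intL[of 1]])
      show "AE u in lborel. norm (complex_of_real (ln u ^ n / fact n) * L u) \<le> norm (complex_of_real (u powr 1) * L u)"
      proof (rule AE_I2)
        fix u :: real
        show "norm (complex_of_real (ln u ^ n / fact n) * L u) \<le> norm (complex_of_real (u powr 1) * L u)"
        proof (cases "u > 1")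
          case True
          have "ln u ^ n / fact n = ln u ^ n /\<^sub>R fact n" by (simp add: field_simps)
          also have "\<dots> \<le> (\<Sum>k. ln u ^ k /\<^sub>R fact k)"
          proof -
            have "0 \<le> ln u ^ k /\<^sub>R fact k" for k using True by simp
            thus ?thesis using sum_le_suminf[OF summable_exp_generic[of "ln u"], of "{n}"] by (simp del: real_scaleR_def)
          qed
          also have "\<dots> = exp (ln u)" by (simp only: exp_def)
          also have "\<dots> = u" using True by simp
          finally have "ln u ^ n / fact n \<le> u" .
          hence "(ln u ^ n / fact n) * norm (L u) \<le> u * norm (L u)" by (rule mult_right_mono) simp
          thus ?thesis using True by (simp add: norm_mult norm_divide norm_power)
        qed (simp add: L_def)
      qed
    qed measurable
    from integrable_mult_right[OF this, of "z ^ n"] show ?thesis by (simp add: mult_ac)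
  qed
  have E: "integrable lborel (\<lambda>u. complex_of_real u powr (s - 1) * L u)"
          "(\<lambda>n. e n * (s - 1) ^ n) sums E s" for s
  proof -
    let ?S = "\<lambda>n u. (\<Sum>k<n. complex_of_real (ln u ^ k / fact k) * (s - 1) ^ k) * L u"
    have lim: "(\<lambda>n. ?S n u) \<longlonglongrightarrow> complex_of_real u powr (s - 1) * L u" for u
    proof (cases "u > 1")
      case True
      have "(\<lambda>k. (complex_of_real (ln u) * (s - 1)) ^ k /\<^sub>R fact k) sums exp (complex_of_real (ln u) * (s - 1))"
        by (rule exp_converges)
      also have "(\<lambda>k. (complex_of_real (ln u) * (s - 1)) ^ k /\<^sub>R fact k) =
                 (\<lambda>k. complex_of_real (ln u ^ k / fact k) * (s - 1) ^ k)"
        by (simp add: scaleR_conv_of_real power_mult_distrib divide_inverse mult_ac)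
      also have "exp (complex_of_real (ln u) * (s - 1)) = complex_of_real u powr (s - 1)"
        using True by (simp add: powr_def Ln_of_real mult.commute)
      finally show ?thesis unfolding sums_def by (rule tendsto_mult_right)
    qed (simp add: L_def)
    have lm: "(\<lambda>u. complex_of_real u powr (s - 1) * L u) \<in> borel_measurable lborel"
      by (rule borel_measurable_LIMSEQ_metric[OF _ lim]) measurable
    note dc = integral_dominated_convergence[where w = "\<lambda>u. norm (complex_of_real (u powr norm (s - 1)) * L u)"
        and s = ?S and f = "\<lambda>u. complex_of_real u powr (s - 1) * L u" and M = lborel]
      and dci = integrable_dominated_convergence[where w = "\<lambda>u. norm (complex_of_real (u powr norm (s - 1)) * L u)"
        and s = ?S and f = "\<lambda>u. complex_of_real u powr (s - 1) * L u" and M = lborel]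
    have bound: "AE u in lborel. norm (?S n u) \<le> norm (complex_of_real (u powr norm (s - 1)) * L u)" for n
    proof (rule AE_I2)
      fix u :: real
      show "norm (?S n u) \<le> norm (complex_of_real (u powr norm (s - 1)) * L u)"
      proof (cases "u > 1")
        case True
        thus ?thesis using aux[OF True, where n = n and z = "s - 1"] by (auto simp: norm_mult intro!: mult_right_mono)
      qed (simp add: L_def)
    qed
    have Sm: "?S n \<in> borel_measurable lborel" for n by measurable
    show "integrable lborel (\<lambda>u. complex_of_real u powr (s - 1) * L u)"
      by (rule dci) (use lm Sm lim bound intL in auto)
    have "(\<lambda>n. LINT u|lborel. ?S n u) \<longlonglongrightarrow> E s"
      unfolding E_def by (rule dc) (use lm Sm lim bound intL in auto)
    moreover have "(LINT u|lborel. ?S n u) = (\<Sum>k<n. e k * (s - 1) ^ k)" for n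
    proof -
      have "(LINT u|lborel. ?S n u) = (LINT u|lborel. (\<Sum>k<n. (complex_of_real (ln u ^ k / fact k) * (s - 1) ^ k) * L u))"
        by (simp add: sum_distrib_right)
      also have "\<dots> = (\<Sum>k<n. LINT u|lborel. (complex_of_real (ln u ^ k / fact k) * (s - 1) ^ k) * L u)"
        using term_int by (rule Bochner_Integration.integral_sum)
      also have "\<dots> = (\<Sum>k<n. LINT u|lborel. (complex_of_real (ln u ^ k / fact k) * L u) * (s - 1) ^ k)"
        by (simp add: mult_ac)
      also have "\<dots> = (\<Sum>k<n. e k * (s - 1) ^ k)"
        unfolding e_def by (subst integral_mult_left_zero) simp
      finally show ?thesis .
    qed
    ultimately show "(\<lambda>n. e n * (s - 1) ^ n) sums E s" by (simp add: sums_def)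
  qed
  have "E holomorphic_on ball 1 r" for r
    by (rule power_series_holomorphic) (rule E(2))
  hence "E holomorphic_on (\<Union>r. ball 1 r)"
    by (intro holomorphic_on_UN_open) auto
  also have "(\<Union>r. ball 1 r) = (UNIV :: complex set)"
    by (metis UNIV_eq_I UN_I centre_in_ball dist_commute iso_tuple_UNIV_I less_add_one mem_ball)
  finally have hol: "E holomorphic_on UNIV" .
  have "indicator {0<..} u *\<^sub>R (complex_of_real u powr (s - 1) * (if u \<in> {1<..} then K u else 0)) =
        complex_of_real u powr (s - 1) * L u" for u s
    by (auto simp: L_def indicator_def)
  hence "has_mellin (\<lambda>u. if u \<in> {1<..} then K u else 0) s (E s)" for s
    using E(1)[of s] by (simp add: has_mellin_def set_integrable_def set_lebesgue_integral_def E_def)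
  with hol show ?thesis using that by blast
qed

section \<open>The Hurwitz zeta function\<close>

definition hurwitz_kernel :: "real \<Rightarrow> real \<Rightarrow> real" where
  "hurwitz_kernel v u = exp (- v * u) / (1 - exp (- u))"

text \<open>Classically \<open>c n\<close> is B_n(1 - v)/n! with the Bernoulli polynomials B_n: u
  times the kernel is their generating function, holomorphic for |u| < 2 pi. Any radius above 1
  gives absolute convergence up to the cut u = 1.\<close>

lemma hurwitz_kernel_expansion:
  obtains c :: "nat \<Rightarrow> complex" where "summable (\<lambda>n. norm (c n))" "c 0 = 1"
    "\<And>u. u \<in> {0<..1} \<Longrightarrow> (\<lambda>n. c n * complex_of_real u ^ n) sums complex_of_real (u * hurwitz_kernel v u)"
proof -
  define g where "g = (\<lambda>z::complex. 1 - exp (- z))"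
  \<comment> \<open>This is (1 - exp(-z))/z with the removable singularity filled in.\<close>
  define \<phi> where "\<phi> = (\<lambda>z. if z = 0 then deriv g 0 else (g z - g 0) / (z - 0))"
  have g: "(g has_field_derivative 1) (at 0)"
    unfolding g_def by (auto intro!: derivative_eq_intros)
  hence d: "deriv g 0 = 1" by (rule DERIV_imp_deriv)
  have "g holomorphic_on UNIV" unfolding g_def by (intro holomorphic_intros)
  hence hol\<phi>: "\<phi> holomorphic_on UNIV"
    unfolding \<phi>_def by (rule pole_lemma_open) auto
  have nz: "\<phi> z \<noteq> 0" if "z \<in> ball 0 2" for z
  proof (cases "z = 0")
    case True thus ?thesis by (simp add: \<phi>_def d)
  next
    case False
    \<comment> \<open>The zeros of 1 - exp(-z) other than 0 have modulus at least 2 pi > 6, outside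
      the disc.\<close>
    have "exp (- z) \<noteq> 1"
    proof
      assume "exp (- z) = 1"
      then obtain n :: int where n: "Re (- z) = 0" "Im (- z) = of_int (2 * n) * pi"
        unfolding exp_eq_1 by blast
      with False have "n \<noteq> 0" by (auto simp: complex_eq_iff)
      hence "1 \<le> \<bar>real_of_int n\<bar>" by linarith
      hence "2 * 3 \<le> (2 * \<bar>real_of_int n\<bar>) * pi"
        using pi_gt3 by (intro mult_mono) auto
      also have "\<dots> = \<bar>Im (- z)\<bar>" unfolding n(2) by (simp add: abs_mult)
      also have "\<dots> \<le> norm z" using abs_Im_le_cmod[of z] by simp
      finally show False using that by simp
    qed
    thus ?thesis using False by (simp add: \<phi>_def g_def)
  qed
  define f where "f = (\<lambda>z. exp (- complex_of_real v * z) / \<phi> z)"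
  have "f holomorphic_on ball 0 2"
    unfolding f_def by (intro holomorphic_intros nz holomorphic_on_subset[OF hol\<phi>]) auto
  hence sums: "(\<lambda>n. (deriv ^^ n) f 0 / fact n * z ^ n) sums f z" if "z \<in> ball 0 2" for z
    using holomorphic_power_series[of f 0 2 z] that by simp
  define c where "c = (\<lambda>n. (deriv ^^ n) f 0 / fact n)"
  show ?thesis
  proof (rule that[of c])
    \<comment> \<open>Convergence at a point strictly between 1 and the radius 2 yields absolute
      convergence at 1.\<close>
    have "summable (\<lambda>n. c n * (3 / 2) ^ n)"
      using sums[of "3 / 2"] by (simp add: c_def sums_iff)
    from powser_insidea[OF this, of 1] show "summable (\<lambda>n. norm (c n))" by simp
    show "c 0 = 1" by (simp add: c_def f_def \<phi>_def d)
    fix u :: real assume u: "u \<in> {0<..1}"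
    have "f (complex_of_real u) = complex_of_real (u * hurwitz_kernel v u)"
    proof -
      have "exp (- complex_of_real v * complex_of_real u) = complex_of_real (exp (- v * u))"
        "exp (- complex_of_real u) = complex_of_real (exp (- u))"
        by (metis exp_of_real of_real_mult of_real_minus)+
      thus ?thesis using u by (simp add: f_def \<phi>_def g_def hurwitz_kernel_def)
    qed
    thus "(\<lambda>n. c n * complex_of_real u ^ n) sums complex_of_real (u * hurwitz_kernel v u)"
      using sums[of "complex_of_real u"] u by (simp add: c_def)
  qed
qed

text \<open>Dividing by u lowers the exponents by one, because \<open>c\<close> expands u times the
  kernel; then u^(n+N-1) over (0, 1] contributes 1/(s + n + N - 1). Dropping the first N terms is
  what moves the half-plane of convergence to Re s > 1 - N.\<close>

lemma has_mellin_power_series: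
  assumes c: "summable (\<lambda>n. norm (c n :: complex))" and s: "Re s > 1 - real N"
  shows "has_mellin (\<lambda>u. if u \<in> {0<..1} then (\<Sum>n. c (n + N) * complex_of_real u ^ (n + N)) / complex_of_real u else 0)
           s (\<Sum>n. c (n + N) / (s + of_nat (n + N) - 1))" (is "has_mellin ?K s (suminf ?I)")
    and "summable (\<lambda>n. c (n + N) / (s + of_nat (n + N) - 1))"
proof -
  let ?P = "\<lambda>n u. if u \<in> {0<..1} then complex_of_real u powr (of_nat (n + N) - 1) else 0"
  define f where "f = (\<lambda>n u. c (n + N) * ?P n u)"
  define M where "M = (\<lambda>n. norm (c (n + N)) * (1 / (Re s + real (n + N) - 1)))"
  have c': "summable (\<lambda>n. norm (c (n + N)))" using c by (subst summable_iff_shift)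
  have pw: "complex_of_real u powr (of_nat k - 1) = complex_of_real u ^ k / complex_of_real u" if "u > 0" for u k
    using that by (simp add: powr_diff powr_nat')
  have P: "has_mellin (?P n) z (1 / (z + of_nat (n + N) - 1))" if "Re z = Re s" for n z
    using has_mellin_powr_from_0[of z "of_nat (n + N) - 1"] s that by (simp add: algebra_simps)
  have f: "has_mellin (f n) s (?I n)" for n
    using has_mellin_cmult[OF P[of s n], of "c (n + N)"] by (simp add: f_def)
  have normf: "complex_of_real (norm (f n u)) = complex_of_real (norm (c (n + N))) * ?P n u" if "u > 0" for n u
    using that by (simp add: f_def norm_mult pw norm_divide norm_power del: of_nat_add)
  have fn: "has_mellin (\<lambda>u. complex_of_real (norm (f n u))) (complex_of_real (Re s)) (complex_of_real (M n))" for n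
    using has_mellin_cmult[OF P[of "complex_of_real (Re s)" n], of "complex_of_real (norm (c (n + N)))"]
    by (subst has_mellin_cong[OF normf]) (simp_all add: M_def)
  \<comment> \<open>The denominators are smallest at n = 0 and positive there by the condition on s,
    so summability of \<open>c\<close> suffices.\<close>
  have M: "summable M"
  proof (rule summable_comparison_test')
    show "summable (\<lambda>n. norm (c (n + N)) * (1 / (Re s + real N - 1)))"
      by (intro summable_mult2 c')
    show "norm (M n) \<le> norm (c (n + N)) * (1 / (Re s + real N - 1))" if "n \<ge> 0" for n
    proof -
      have "1 / (Re s + real (n + N) - 1) \<le> 1 / (Re s + real N - 1)"
        using s by (intro divide_left_mono mult_pos_pos) auto
      hence "M n \<le> norm (c (n + N)) * (1 / (Re s + real N - 1))"
        unfolding M_def by (rule mult_left_mono) simp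
      moreover have "M n \<ge> 0" using s by (simp add: M_def)
      ultimately show ?thesis by simp
    qed
  qed
  have nf: "norm (f n u) \<le> norm (c (n + N)) * (1 / u)" if "u > 0" for n u
  proof (cases "u \<le> 1")
    case True
    have "norm (f n u) = norm (c (n + N)) * (u ^ (n + N) / u)"
      using that True by (simp add: f_def norm_mult pw norm_divide norm_power del: of_nat_add)
    also have "\<dots> \<le> norm (c (n + N)) * (1 / u)"
      using that True by (intro mult_left_mono divide_right_mono power_le_one) auto
    finally show ?thesis .
  qed (use that in \<open>simp add: f_def\<close>)
  have sumf: "summable (\<lambda>n. norm (f n u))" if "u > 0" for u
    by (rule summable_comparison_test'[OF summable_mult2[OF c', of "1 / u"]]) (use nf that in auto)
  have K: "(\<lambda>n. f n u) sums ?K u" if "u > 0" for u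
  proof (cases "u \<le> 1")
    case True
    have "summable (\<lambda>n. norm (c (n + N) * complex_of_real u ^ (n + N)))"
      by (rule summable_comparison_test'[OF c'])
         (use that True in \<open>auto simp: norm_mult norm_power intro!: mult_left_le power_le_one\<close>)
    hence "(\<lambda>n. c (n + N) * complex_of_real u ^ (n + N)) sums (\<Sum>n. c (n + N) * complex_of_real u ^ (n + N))"
      by (rule summable_sums[OF summable_norm_cancel])
    from sums_divide[OF this, of "complex_of_real u"] show ?thesis
      using that True by (simp add: f_def pw del: of_nat_add)
  qed (simp add: f_def)
  show "has_mellin ?K s (suminf ?I)" "summable ?I"
    using has_mellin_sums(1)[OF f fn M sumf K] has_mellin_sums(2)[OF f fn M sumf K]
    by (simp_all only: sums_iff)
qed

section \<open>The Dirichlet series as a Mellin transform\<close>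

lemma summable_powr_shift:
  assumes "\<sigma> < -1" "v > 0"
  shows "summable (\<lambda>n. (real n + v) powr \<sigma>)"
proof (rule summable_comparison_test_ev)
  show "summable (\<lambda>n. real n powr \<sigma>)" using assms by (simp add: summable_real_powr_iff)
  show "eventually (\<lambda>n. norm ((real n + v) powr \<sigma>) \<le> real n powr \<sigma>) sequentially"
    using eventually_gt_at_top[of 0] by eventually_elim (use assms in \<open>auto intro!: powr_mono2'\<close>)
qed

lemma has_mellin_exp_scaled:
  assumes "Re s > 0" "c > 0"
  shows "has_mellin (\<lambda>u. complex_of_real (exp (- (c * u)))) s (complex_of_real c powr (- s) * Gamma s)"
  using has_mellin_scale[OF has_mellin_exp[OF assms(1)] assms(2)] .

text \<open>A geometric series in exp(-u) with positive terms: the norms required for termwise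
  integration are the same Gamma integrals at \<open>Re s\<close>.\<close>

lemma has_mellin_hurwitz_kernel:
  assumes v: "v > 0" and s: "Re s > 1"
  shows "has_mellin (\<lambda>u. complex_of_real (hurwitz_kernel v u)) s
           (Gamma s * (\<Sum>n. complex_of_real (real n + v) powr (- s)))"
proof -
  define f where "f = (\<lambda>n u. complex_of_real (exp (- ((real n + v) * u))))"
  have M: "summable (\<lambda>n. (real n + v) powr (- Re s) * Gamma (Re s))"
    by (intro summable_mult2 summable_powr_shift) (use s v in auto)
  have f: "has_mellin (f n) s (complex_of_real (real n + v) powr (- s) * Gamma s)" for n
    unfolding f_def using s v by (intro has_mellin_exp_scaled) auto
  have normf: "complex_of_real (norm (f n u)) = f n u" for n u by (simp add: f_def)
  have fn: "has_mellin (\<lambda>u. complex_of_real (norm (f n u))) (complex_of_real (Re s))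
      (complex_of_real ((real n + v) powr (- Re s) * Gamma (Re s)))" for n
  proof -
    have "complex_of_real ((real n + v) powr (- Re s) * Gamma (Re s)) =
        complex_of_real (real n + v) powr (- complex_of_real (Re s)) * Gamma (complex_of_real (Re s))"
      using powr_of_real[of "real n + v" "- Re s"] v by (simp add: Gamma_complex_of_real del: of_real_add)
    thus ?thesis
      using has_mellin_exp_scaled[of "complex_of_real (Re s)" "real n + v"] s v unfolding normf f_def by simp
  qed
  have geo: "(\<lambda>n. exp (- ((real n + v) * u))) sums hurwitz_kernel v u" if "u > 0" for u
  proof -
    have "(\<lambda>n. exp (- v * u) * exp (- u) ^ n) sums (exp (- v * u) * (1 / (1 - exp (- u))))"
      using that by (intro sums_mult geometric_sums) auto
    also have "(\<lambda>n. exp (- v * u) * exp (- u) ^ n) = (\<lambda>n. exp (- ((real n + v) * u)))"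
    proof
      fix n :: nat
      have "- ((real n + v) * u) = - v * u + of_nat n * (- u)" by (simp add: algebra_simps)
      thus "exp (- v * u) * exp (- u) ^ n = exp (- ((real n + v) * u))"
        by (simp only: exp_add exp_of_nat_mult)
    qed
    finally show ?thesis by (simp add: hurwitz_kernel_def)
  qed
  have K: "(\<lambda>n. f n u) sums complex_of_real (hurwitz_kernel v u)" if "u > 0" for u
    using geo[OF that] unfolding f_def by (rule sums_of_real)
  have sumf: "summable (\<lambda>n. norm (f n u))" if "u > 0" for u
    using geo[OF that] by (simp add: f_def sums_iff)
  have "has_mellin (\<lambda>u. complex_of_real (hurwitz_kernel v u)) s
      (\<Sum>n. complex_of_real (real n + v) powr (- s) * Gamma s)"
    and S: "(\<lambda>n. complex_of_real (real n + v) powr (- s) * Gamma s) sums 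
             (\<Sum>n. complex_of_real (real n + v) powr (- s) * Gamma s)"
    using has_mellin_sums(1)[OF f fn M sumf K] has_mellin_sums(2)[OF f fn M sumf K] by blast+
  moreover have "(\<Sum>n. complex_of_real (real n + v) powr (- s) * Gamma s) =
      Gamma s * (\<Sum>n. complex_of_real (real n + v) powr (- s))"
  proof -
    \<comment> \<open>Dividing by the nonzero factor recovers convergence of the Dirichlet series
      itself from that of the transformed terms.\<close>
    have "Gamma s \<noteq> 0" using s by (auto simp: Gamma_eq_zero_iff elim!: nonpos_Ints_cases)
    hence "summable (\<lambda>n. complex_of_real (real n + v) powr (- s))"
      using sums_summable[OF sums_divide[OF S, of "Gamma s"]] by simp
    from suminf_mult[OF this, of "Gamma s"] show ?thesis by (simp add: mult.commute)
  qed
  ultimately show ?thesis by simp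
qed

lemma entire_mellin_hurwitz_kernel:
  assumes "v > 0"
  obtains E where "E holomorphic_on UNIV"
    "\<And>s. has_mellin (\<lambda>u. if u \<in> {1<..} then complex_of_real (hurwitz_kernel v u) else 0) s (E s)"
proof (rule entire_mellin)
  fix \<sigma> :: real
  \<comment> \<open>For u > 1, raising a negative exponent to 0 only increases the power, and it
    keeps \<open>p + 1\<close> in the range of the Gamma integral; the denominator of the kernel is
    at least 1 - exp(-1) there.\<close>
  define p where "p = max \<sigma> 0"
  have "has_mellin (\<lambda>u. complex_of_real (exp (- (v * u)))) (complex_of_real (p + 1))
          (complex_of_real v powr (- complex_of_real (p + 1)) * Gamma (complex_of_real (p + 1)))"
    using assms by (intro has_mellin_exp_scaled) (auto simp: p_def)
  hence "set_integrable lborel {0<..} (\<lambda>u. complex_of_real u powr (complex_of_real (p + 1) - 1) * complex_of_real (exp (- (v * u))))"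
    by (simp add: has_mellin_def)
  hence "set_integrable lborel {1<..} (\<lambda>u. complex_of_real u powr (complex_of_real (p + 1) - 1) * complex_of_real (exp (- (v * u))))"
    by (rule set_integrable_subset) auto
  hence int: "set_integrable lborel {1<..} (\<lambda>u. (1 / (1 - exp (-1))) *\<^sub>R (complex_of_real u powr (complex_of_real (p + 1) - 1) * complex_of_real (exp (- (v * u)))))"
    by (intro set_integrable_scaleR_right)
  show "set_integrable lborel {1<..} (\<lambda>u. complex_of_real (u powr \<sigma>) * complex_of_real (hurwitz_kernel v u))"
  proof (rule set_integrable_bound[OF int])
    show "set_borel_measurable lborel {1<..} (\<lambda>u. complex_of_real (u powr \<sigma>) * complex_of_real (hurwitz_kernel v u))"
      unfolding set_borel_measurable_def hurwitz_kernel_def by measurable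
    show "AE u in lborel. u \<in> {1<..} \<longrightarrow> norm (complex_of_real (u powr \<sigma>) * complex_of_real (hurwitz_kernel v u))
        \<le> norm ((1 / (1 - exp (-1))) *\<^sub>R (complex_of_real u powr (complex_of_real (p + 1) - 1) * complex_of_real (exp (- (v * u)))))"
    proof (rule AE_I2, rule impI)
      fix u :: real assume u: "u \<in> {1<..}"
      have "u powr \<sigma> * (exp (- (v * u)) / (1 - exp (- u))) \<le> u powr p * (exp (- (v * u)) / (1 - exp (- 1)))"
        using u by (intro mult_mono powr_mono divide_left_mono mult_pos_pos) (auto simp: p_def)
      thus "norm (complex_of_real (u powr \<sigma>) * complex_of_real (hurwitz_kernel v u))
        \<le> norm ((1 / (1 - exp (-1))) *\<^sub>R (complex_of_real u powr (complex_of_real (p + 1) - 1) * complex_of_real (exp (- (v * u)))))"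
        using u by (simp add: norm_mult norm_divide norm_powr_real_powr hurwitz_kernel_def mult_ac abs_mult del: of_real_mult of_real_divide of_real_diff)
    qed
  qed
qed (use that in blast)

text \<open>The \<open>n\<close>-th term \<open>rGamma s / (s + n)\<close> is replaced by \<open>pochhammer s n * rGamma (s + n + 1)\<close>, which
  has the same values but no division by zero at \<open>s = -n\<close>.\<close>

lemma entire_series:
  assumes c: "summable (\<lambda>n. norm (c n :: complex))"
  obtains S where "S holomorphic_on UNIV"
    "\<And>s. s \<notin> \<int>\<^sub>\<le>\<^sub>0 \<Longrightarrow> summable (\<lambda>n. c n / (s + of_nat n)) \<Longrightarrow>
       S s = rGamma s * (\<Sum>n. c n / (s + of_nat n))"
proof -
  define t where "t = (\<lambda>n s. c n * (pochhammer s n * rGamma (s + of_nat n + 1)))"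
  have t: "t n s = c n * (rGamma s / (s + of_nat n))" if "s + of_nat n \<noteq> 0" for n s
    using that pochhammer_rGamma[of s "Suc n"] by (simp add: t_def pochhammer_Suc add_ac)
  have hol: "t n holomorphic_on A" for n A
    unfolding t_def by (intro holomorphic_intros)
  define S where "S = (\<lambda>s. \<Sum>n. t n s)"
  have "S holomorphic_on UNIV"
  proof (rule holomorphic_uniform_sequence)
    show "(\<lambda>s. \<Sum>i<n. t i s) holomorphic_on UNIV" for n by (intro holomorphic_intros hol)
    fix z :: complex
    have "continuous_on (cball z 1) (rGamma :: complex \<Rightarrow> _)" by (intro continuous_intros)
    hence "bounded ((rGamma :: complex \<Rightarrow> _) ` cball z 1)"
      by (intro compact_imp_bounded compact_continuous_image compact_cball)
    then obtain B where B: "\<And>s. s \<in> cball z 1 \<Longrightarrow> norm (rGamma s) \<le> B" "B > 0"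
      unfolding bounded_pos by blast
    have "uniform_limit (cball z 1) (\<lambda>n s. \<Sum>i<n. t i s) (\<lambda>s. suminf (\<lambda>i. t i s)) sequentially"
    proof (rule Weierstrass_m_test_ev)
      show "summable (\<lambda>n. norm (c n) * B)" using c by (intro summable_mult2)
      show "\<forall>\<^sub>F n in sequentially. \<forall>s\<in>cball z 1. norm (t n s) \<le> norm (c n) * B"
        \<comment> \<open>From this index on |s + n| \<ge> 1 throughout the disc, so the quotient
          form of the term is available and bounded; the finitely many earlier terms are
          entire.\<close>
        using eventually_ge_at_top[of "nat \<lceil>norm z + 2\<rceil>"]
      proof eventually_elim
        case (elim n)
        show ?case
        proof
          fix s assume s: "s \<in> cball z 1"
          have "norm s \<le> norm z + 1" using s norm_triangle_ineq2[of s z] by (simp add: dist_norm norm_minus_commute)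
          moreover have "real n \<ge> norm z + 2" using elim by linarith
          ultimately have *: "norm (s + of_nat n) \<ge> 1"
            using norm_diff_ineq[of "of_nat n" s] by (simp add: add_ac)
          hence "s + of_nat n \<noteq> 0" by auto
          hence "norm (t n s) = norm (c n) * (norm (rGamma s) / norm (s + of_nat n))"
            by (subst t) (auto simp: norm_mult norm_divide)
          also have "\<dots> \<le> norm (c n) * (B / 1)"
            using B s * by (intro mult_left_mono frac_le) auto
          finally show "norm (t n s) \<le> norm (c n) * B" by simp
        qed
      qed
    qed
    thus "\<exists>d>0. cball z d \<subseteq> UNIV \<and> uniform_limit (cball z d) (\<lambda>n s. \<Sum>i<n. t i s) S sequentially"
      unfolding S_def by (intro exI[of _ 1]) auto
  qed auto
  moreover have "S s = rGamma s * (\<Sum>n. c n / (s + of_nat n))"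
    if "s \<notin> \<int>\<^sub>\<le>\<^sub>0" and sm: "summable (\<lambda>n. c n / (s + of_nat n))" for s
  proof -
    have nz: "s + of_nat n \<noteq> 0" for n using that plus_of_nat_eq_0_imp by blast
    have "S s = (\<Sum>n. rGamma s * (c n / (s + of_nat n)))"
      unfolding S_def by (rule suminf_cong) (subst t[OF nz], simp)
    also have "\<dots> = rGamma s * (\<Sum>n. c n / (s + of_nat n))"
      using sm by (rule suminf_mult)
    finally show ?thesis .
  qed
  ultimately show ?thesis using that by blast
qed

section \<open>Identity theorem, pole at 1 and Laurent coefficients\<close>

lemma nicely_meromorphic_unique:
  assumes f: "f nicely_meromorphic_on UNIV" and g: "g nicely_meromorphic_on UNIV"
    and "open U" "U \<noteq> {}" and eq: "\<And>z. z \<in> U \<Longrightarrow> f z = g z"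
  shows "f = g"
proof
  fix z :: complex
  define h where "h = (\<lambda>z. f z - g z)"
  have h: "h meromorphic_on UNIV"
    unfolding h_def using f g by (auto simp: nicely_meromorphic_on_def intro!: meromorphic_intros)
  have ev: "eventually (\<lambda>w. remove_sings h w = h w) (at z)" for z
    by (rule eventually_remove_sings_eq_at, rule meromorphic_on_isolated_singularity, rule meromorphic_on_subset[OF h]) auto
  obtain p where p: "p \<in> U" using assms(4) by blast
  have "eventually (\<lambda>w. w \<in> U) (at p)" using assms(3) p by (intro eventually_at_in_open') auto
  with ev[of p] have "eventually (\<lambda>w. remove_sings h w = 0) (at p)"
    by eventually_elim (simp add: h_def eq)
  hence "frequently (\<lambda>w. remove_sings h w = 0) (at p)"
    by (rule eventually_frequently[OF at_neq_bot])
  hence zero: "remove_sings h w = 0" for w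
    by (rule frequently_eq_meromorphic_imp_constant[where A = UNIV])
       (use remove_sings_nicely_meromorphic[OF h] in auto)
  have ev_eq: "eventually (\<lambda>w. f w = g w) (at z)"
    using ev[of z] unfolding zero by eventually_elim (simp add: h_def)
  \<comment> \<open>Both functions have the same poles and limits; a pole carries the value 0 by
    convention, any other point carries its limit.\<close>
  have "is_pole f z \<longleftrightarrow> is_pole g z" by (rule is_pole_cong[OF ev_eq refl])
  moreover have "f \<midarrow>z\<rightarrow> l \<longleftrightarrow> g \<midarrow>z\<rightarrow> l" for l by (rule tendsto_cong[OF ev_eq])
  moreover have "(is_pole f z \<and> f z = 0) \<or> f \<midarrow>z\<rightarrow> f z" "(is_pole g z \<and> g z = 0) \<or> g \<midarrow>z\<rightarrow> g z"
    using f g by (auto simp: nicely_meromorphic_on_def)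
  moreover have "\<not> (is_pole f z \<and> f \<midarrow>z\<rightarrow> l)" for l
    unfolding is_pole_def using not_tendsto_and_filterlim_at_infinity[OF at_neq_bot] by blast
  ultimately show "f z = g z"
    by (metis LIM_unique)
qed

lemma simple_pole_nicely_meromorphic:
  assumes R: "R holomorphic_on UNIV"
  shows "(\<lambda>s. if s = 1 then 0 else 1 / (s - 1) + R s) nicely_meromorphic_on UNIV"
proof (rule nicely_meromorphic_onI_open[where pts = "{1}"])
  let ?f = "\<lambda>s. if s = 1 then 0 else 1 / (s - 1) + R s"
  have hol: "?f holomorphic_on UNIV - {1}"
  proof (rule holomorphic_transform[of "\<lambda>s. 1 / (s - 1) + R s"])
    show "(\<lambda>s. 1 / (s - 1) + R s) holomorphic_on UNIV - {1}"
      by (intro holomorphic_intros holomorphic_on_subset[OF R]) auto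
  qed auto
  thus an: "?f analytic_on UNIV - {1}"
    by (subst analytic_on_open) (auto simp: open_delete)
  show "is_pole ?f x \<and> ?f x = 0" if "x \<in> {1}" for x
  proof -
    have "continuous_on UNIV R" using R by (rule holomorphic_on_imp_continuous_on)
    hence "isCont R 1" by (simp add: continuous_on_eq_continuous_at)
    \<comment> \<open>Over the common denominator the numerator tends to 1, which exhibits the
      pole.\<close>
    hence "is_pole (\<lambda>s. (1 + (s - 1) * R s) / (s - 1)) 1"
      by (intro is_pole_divide) (auto intro!: continuous_intros filterlim_atI tendsto_eq_intros simp: eventually_at_filter)
    moreover have "eventually (\<lambda>s. (1 + (s - 1) * R s) / (s - 1) = ?f s) (at 1)"
      by (auto simp: eventually_at_filter divide_simps)
    ultimately have "is_pole ?f 1" using is_pole_cong[OF _ refl] by fast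
    thus ?thesis using that by simp
  qed
  show "isolated_singularity_at ?f x" for x
  proof -
    define r where "r = (if x = 1 then 1 else dist x 1)"
    have "ball x r - {x} \<subseteq> UNIV - {1}" by (auto simp: r_def)
    hence "?f analytic_on ball x r - {x}" using an analytic_on_subset by blast
    moreover have "r > 0" by (simp add: r_def)
    ultimately show ?thesis unfolding isolated_singularity_at_def by blast
  qed
qed auto

text \<open>Resolves the definite description in \<open>hurwitz_zeta\<close>: the displayed function
  has both defining properties, and Re z > 1 is an open set on which any competitor agrees with
  it.\<close>

lemma hurwitz_zeta_eqI:
  assumes R: "R holomorphic_on UNIV"
    and series: "\<And>z. Re z > 1 \<Longrightarrow> 1 / (z - 1) + R z = (\<Sum>n. complex_of_real (real n + v) powr (- z))"
  shows "hurwitz_zeta s v = (if s = 1 then 0 else 1 / (s - 1) + R s)"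
proof -
  let ?P = "\<lambda>f. f nicely_meromorphic_on UNIV \<and>
        (\<forall>z. Re z > 1 \<longrightarrow> f z = (\<Sum>n. complex_of_real (real n + v) powr (- z)))"
  define F where "F = (\<lambda>s. if s = 1 then 0 else 1 / (s - 1) + R s)"
  have "?P F"
    unfolding F_def using simple_pole_nicely_meromorphic[OF R] series by auto
  moreover have "f = F" if "?P f" for f
  proof (rule nicely_meromorphic_unique[of f F "{z. Re z > 1}"])
    have "(2::complex) \<in> {z. Re z > 1}" by simp
    thus "{z::complex. Re z > 1} \<noteq> {}" by blast
  qed (use that \<open>?P F\<close> in \<open>auto simp: open_halfspace_Re_gt\<close>)
  ultimately have "(THE f. ?P f) = F" by (rule the_equality)
  thus ?thesis unfolding hurwitz_zeta_def by (simp only: F_def)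
qed

text \<open>The Laurent series is X^(-1) plus the Taylor series of \<open>R\<close>. It concerns a
  punctured neighbourhood, so the conventional value 0 of zeta at its pole does no harm.\<close>

lemma stieltjes_gamma_eq:
  assumes R: "R holomorphic_on UNIV"
    and zeta: "\<And>s. s \<noteq> 1 \<Longrightarrow> hurwitz_zeta s v = 1 / (s - 1) + R s"
  shows "stieltjes_gamma n v = (-1) ^ n * (deriv ^^ n) R 1"
proof -
  have "R analytic_on {1}"
    using R by (metis UNIV_I analytic_on_open analytic_on_subset open_UNIV subsetI)
  hence "(\<lambda>x. R (1 + x)) has_laurent_expansion fps_to_fls (fps_expansion R 1)"
    by (intro has_laurent_expansion_fps analytic_at_imp_has_fps_expansion)
  hence "(\<lambda>x. x powi (-1) + R (1 + x)) has_laurent_expansion (fls_X_intpow (-1) + fps_to_fls (fps_expansion R 1))"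
    by (intro has_laurent_expansion_add has_laurent_expansion_fps_X_power_int)
  also have "?this \<longleftrightarrow> (\<lambda>x. hurwitz_zeta (1 + x) v) has_laurent_expansion (fls_X_intpow (-1) + fps_to_fls (fps_expansion R 1))"
    by (rule has_laurent_expansion_cong)
       (auto simp: eventually_at_filter zeta power_int_minus field_simps)
  finally have "laurent_expansion (\<lambda>s. hurwitz_zeta s v) 1 = fls_X_intpow (-1) + fps_to_fls (fps_expansion R 1)"
    by (rule laurent_expansion_eqI)
  thus ?thesis by (simp add: stieltjes_gamma_def fps_expansion_def)
qed

text \<open>Cut the Mellin integral at 1. The part over (0, 1] is the sum of c_n/(s + n - 1), the
  rest is entire; the n = 0 term is the pole at 1, and 1/Gamma absorbs the poles at 0, -1, -2 and so
  on. The constant \<open>b\<close> is the second expansion coefficient; the limit at 0+ is recorded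
  so that weighted sums of such constants can be identified later.\<close>

lemma hurwitz_regular_part:
  assumes v: "v > 0"
  obtains R b where "R holomorphic_on UNIV"
    "\<And>z. Re z > 1 \<Longrightarrow> 1 / (z - 1) + R z = (\<Sum>n. complex_of_real (real n + v) powr (- z))"
    "\<And>s::real. -1 < s \<Longrightarrow> s < 0 \<Longrightarrow>
       has_mellin (\<lambda>u. complex_of_real (hurwitz_kernel v u) - 1 / complex_of_real u - b) (complex_of_real s)
         (Gamma (complex_of_real s) * (1 / (complex_of_real s - 1) + R (complex_of_real s)))"
    "((\<lambda>u. complex_of_real (hurwitz_kernel v u) - 1 / complex_of_real u - b) \<longlongrightarrow> 0) (at_right 0)"
proof -
  obtain c where c: "summable (\<lambda>n. norm (c n))" "c 0 = 1"
    "\<And>u. u \<in> {0<..1} \<Longrightarrow> (\<lambda>n. c n * complex_of_real u ^ n) sums complex_of_real (u * hurwitz_kernel v u)"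
    using hurwitz_kernel_expansion[of v] by blast
  obtain E where E: "E holomorphic_on UNIV"
    "\<And>s. has_mellin (\<lambda>u. if u \<in> {1<..} then complex_of_real (hurwitz_kernel v u) else 0) s (E s)"
    using entire_mellin_hurwitz_kernel[OF v] by blast
  have c1: "summable (\<lambda>n. norm (c (n + 1)))" using c(1) by (subst summable_iff_shift)
  obtain S where S: "S holomorphic_on UNIV"
    "\<And>s. s \<notin> \<int>\<^sub>\<le>\<^sub>0 \<Longrightarrow> summable (\<lambda>n. c (n + 1) / (s + of_nat n)) \<Longrightarrow>
       S s = rGamma s * (\<Sum>n. c (n + 1) / (s + of_nat n))"
    using entire_series[OF c1] by blast
  \<comment> \<open>Since \<open>rGamma 1 = 1\<close>, the quotient rGamma(s)/(s - 1) is 1/(s - 1) +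
    Q(s) with Q entire.\<close>
  define Q where "Q = (\<lambda>s. if s = 1 then deriv rGamma 1 else (rGamma s - rGamma 1) / (s - 1 :: complex))"
  have Q: "Q holomorphic_on UNIV"
    unfolding Q_def by (rule pole_lemma_open) (auto intro!: holomorphic_intros)
  define R where "R = (\<lambda>s. rGamma s * E s + S s + Q s)"
  have R: "R holomorphic_on UNIV"
    unfolding R_def by (intro holomorphic_intros E S Q)
  have sum1: "summable (\<lambda>n. c (n + 1) / (s + of_nat n))" if "Re s > -1" for s
  proof -
    \<comment> \<open>With two terms dropped the power series reaches Re s > -1; restoring one term
      does not affect convergence.\<close>
    have "summable (\<lambda>n. c (n + 2) / (s + of_nat (n + 2) - 1))"
      by (rule has_mellin_power_series(2)[OF c(1)]) (use that in auto)
    hence "summable (\<lambda>n. c (n + 1 + 1) / (s + of_nat (n + 1)))"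
      by (rule back_subst[where P = summable]) (auto simp: algebra_simps)
    thus ?thesis by (subst (asm) summable_iff_shift)
  qed
  \<comment> \<open>One identity for two regions: in Re s > 1 it leads to the Dirichlet series, in
    -1 < s < 0 to the regularised transform.\<close>
  have key: "Gamma s * (1 / (s - 1) + R s) = E s + (\<Sum>n. c (n + 1) / (s + of_nat n)) + 1 / (s - 1)"
    if "s \<notin> \<int>\<^sub>\<le>\<^sub>0" "s \<noteq> 1" "Re s > -1" for s
  proof -
    have G: "Gamma s * rGamma s = 1" using that by (simp add: rGamma_inverse_Gamma Gamma_eq_zero_iff)
    have "R s = rGamma s * E s + rGamma s * (\<Sum>n. c (n + 1) / (s + of_nat n)) + (rGamma s - 1) / (s - 1)"
      using that S(2)[OF that(1) sum1[OF that(3)]] by (simp add: R_def Q_def)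
    hence "1 / (s - 1) + R s = rGamma s * (E s + (\<Sum>n. c (n + 1) / (s + of_nat n)) + 1 / (s - 1))"
      by (simp add: algebra_simps diff_divide_distrib)
    thus ?thesis using G by (metis mult.assoc mult_1)
  qed
  have nonint: "complex_of_real s \<notin> \<int>\<^sub>\<le>\<^sub>0" if "-1 < s" "s < 0" for s :: real
  proof
    assume "complex_of_real s \<in> \<int>\<^sub>\<le>\<^sub>0"
    then obtain n :: nat where "complex_of_real s = - of_nat n" by (auto elim!: nonpos_Ints_cases')
    hence "s = - real n" by (metis of_real_eq_iff of_real_minus of_real_of_nat_eq)
    with that show False by (cases n) auto
  qed
  have split2: "(\<Sum>n. c (n + 2) * complex_of_real u ^ (n + 2)) =
      complex_of_real (u * hurwitz_kernel v u) - 1 - c 1 * complex_of_real u" if "u \<in> {0<..1}" for u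
  proof -
    let ?h = "\<lambda>n. c n * complex_of_real u ^ n"
    have "(\<Sum>n. ?h n) = (\<Sum>n. ?h (n + 2)) + (\<Sum>n<2. ?h n)"
      by (rule suminf_split_initial_segment) (use c(3)[OF that] in \<open>rule sums_summable\<close>)
    moreover have "(\<Sum>n. ?h n) = complex_of_real (u * hurwitz_kernel v u)"
      using c(3)[OF that] by (rule sums_unique[symmetric])
    ultimately show ?thesis using c(2) by (simp add: numeral_2_eq_2)
  qed
  show ?thesis
  proof (rule that[of R "c 1"])
    show "R holomorphic_on UNIV" by fact
    fix z :: complex assume z: "Re z > 1"
    have zn: "z \<notin> \<int>\<^sub>\<le>\<^sub>0" "z \<noteq> 1" using z by (auto elim!: nonpos_Ints_cases)
    have m: "has_mellin (\<lambda>u. (if u \<in> {0<..1} then (\<Sum>n. c (n + 0) * complex_of_real u ^ (n + 0)) / complex_of_real u else 0)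
            + (if u \<in> {1<..} then complex_of_real (hurwitz_kernel v u) else 0)) z
          ((\<Sum>n. c (n + 0) / (z + of_nat (n + 0) - 1)) + E z)"
      by (intro has_mellin_add has_mellin_power_series(1) c E) (use z in auto)
    have "has_mellin (\<lambda>u. complex_of_real (hurwitz_kernel v u)) z
        ((\<Sum>n. c (n + 0) / (z + of_nat (n + 0) - 1)) + E z)"
    proof (rule has_mellin_cong[THEN iffD1, OF _ m])
      fix u :: real assume u: "u > 0"
      show "(if u \<in> {0<..1} then (\<Sum>n. c (n + 0) * complex_of_real u ^ (n + 0)) / complex_of_real u else 0)
            + (if u \<in> {1<..} then complex_of_real (hurwitz_kernel v u) else 0) = complex_of_real (hurwitz_kernel v u)"
        using u c(3)[of u] by (auto simp: sums_iff)
    qed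
    with has_mellin_hurwitz_kernel[OF v z]
    have "Gamma z * (\<Sum>n. complex_of_real (real n + v) powr (- z)) = (\<Sum>n. c (n + 0) / (z + of_nat (n + 0) - 1)) + E z"
      by (rule has_mellin_unique)
    also have "(\<Sum>n. c (n + 0) / (z + of_nat (n + 0) - 1)) = 1 / (z - 1) + (\<Sum>n. c (n + 1) / (z + of_nat n))"
    proof -
      have "summable (\<lambda>n. c n / (z + of_nat n - 1))"
        using has_mellin_power_series(2)[OF c(1), of 0 z] z by simp
      from suminf_split_head[OF this] show ?thesis
        using c(2) by (simp add: algebra_simps)
    qed
    finally have "Gamma z * (\<Sum>n. complex_of_real (real n + v) powr (- z)) = Gamma z * (1 / (z - 1) + R z)"
      using key[OF zn] z by simp
    moreover have "Gamma z \<noteq> 0" using zn by (simp add: Gamma_eq_zero_iff)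
    ultimately show "1 / (z - 1) + R z = (\<Sum>n. complex_of_real (real n + v) powr (- z))"
      using mult_left_cancel by metis
  next
    fix s :: real assume s: "-1 < s" "s < 0"
    let ?s = "complex_of_real s"
    \<comment> \<open>For u \<le> 1 the two leading terms are simply dropped; for u > 1 they are
      subtracted explicitly. The subtraction adds 1/(s - 1) and c_1/s to the value, exactly the
      terms missing from the shifted series.\<close>
    have m: "has_mellin (\<lambda>u. (if u \<in> {0<..1} then (\<Sum>n. c (n + 2) * complex_of_real u ^ (n + 2)) / complex_of_real u else 0)
            + (if u \<in> {1<..} then complex_of_real (hurwitz_kernel v u) else 0)
            - (if u \<in> {1<..} then complex_of_real (u powr (-1)) else 0)
            - c 1 * (if u \<in> {1<..} then complex_of_real (u powr 0) else 0)) ?s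
          ((\<Sum>n. c (n + 2) / (?s + of_nat (n + 2) - 1)) + E ?s - complex_of_real (- 1 / (s + -1))
           - c 1 * complex_of_real (- 1 / (s + 0)))"
      by (intro has_mellin_add has_mellin_diff has_mellin_cmult has_mellin_power_series(1) has_mellin_powr_to_inf c E)
         (use s in auto)
    have "(\<Sum>n. c (n + 1) / (?s + of_nat n)) = c 1 / ?s + (\<Sum>n. c (n + 2) / (?s + of_nat (n + 2) - 1))"
    proof -
      have "summable (\<lambda>n. c (n + 1) / (?s + of_nat n))" by (rule sum1) (use s in simp)
      from suminf_split_head[OF this] show ?thesis by (simp add: algebra_simps)
    qed
    hence val: "(\<Sum>n. c (n + 2) / (?s + of_nat (n + 2) - 1)) + E ?s - complex_of_real (- 1 / (s + -1))
           - c 1 * complex_of_real (- 1 / (s + 0)) = Gamma ?s * (1 / (?s - 1) + R ?s)"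
      using key[of ?s] nonint[OF s] s by simp
    show "has_mellin (\<lambda>u. complex_of_real (hurwitz_kernel v u) - 1 / complex_of_real u - c 1) ?s
         (Gamma ?s * (1 / (?s - 1) + R ?s))"
    proof (rule has_mellin_cong[THEN iffD1, OF _ m[unfolded val]])
      fix u :: real assume u: "u > 0"
      show "(if u \<in> {0<..1} then (\<Sum>n. c (n + 2) * complex_of_real u ^ (n + 2)) / complex_of_real u else 0)
            + (if u \<in> {1<..} then complex_of_real (hurwitz_kernel v u) else 0)
            - (if u \<in> {1<..} then complex_of_real (u powr (-1)) else 0)
            - c 1 * (if u \<in> {1<..} then complex_of_real (u powr 0) else 0) =
            complex_of_real (hurwitz_kernel v u) - 1 / complex_of_real u - c 1"
      proof (cases "u \<le> 1")
        case True
        thus ?thesis using u split2[of u] by (simp add: field_simps)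
      qed (use u in \<open>simp add: powr_minus divide_inverse\<close>)
    qed
  next
    \<comment> \<open>Without its two leading terms the expansion is u times a bounded
      series.\<close>
    show "((\<lambda>u. complex_of_real (hurwitz_kernel v u) - 1 / complex_of_real u - c 1) \<longlongrightarrow> 0) (at_right 0)"
    proof (rule Lim_null_comparison)
      have "((\<lambda>u. u * (\<Sum>n. norm (c (n + 2)))) \<longlongrightarrow> 0 * (\<Sum>n. norm (c (n + 2)))) (at_right 0)"
        by (intro tendsto_intros)
      thus "((\<lambda>u. u * (\<Sum>n. norm (c (n + 2)))) \<longlongrightarrow> 0) (at_right 0)" by simp
      have ev: "eventually (\<lambda>u::real. u \<in> {0<..<1}) (at_right 0)"
        by (rule eventually_at_right_real) auto
      have c2: "summable (\<lambda>n. norm (c (n + 2)))" using c(1) by (subst summable_iff_shift)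
      show "eventually (\<lambda>u. norm (complex_of_real (hurwitz_kernel v u) - 1 / complex_of_real u - c 1) \<le> u * (\<Sum>n. norm (c (n + 2)))) (at_right 0)"
        using ev
      proof eventually_elim
        case (elim u)
        have bd: "norm (c (n + 2) * complex_of_real u ^ n) \<le> norm (c (n + 2))" for n
          using elim by (auto simp: norm_mult norm_power intro!: mult_left_le power_le_one)
        have sm: "summable (\<lambda>n. norm (c (n + 2) * complex_of_real u ^ n))"
          by (rule summable_comparison_test'[OF c2]) (use bd in auto)
        have "complex_of_real (u * hurwitz_kernel v u) - 1 - c 1 * complex_of_real u =
            (\<Sum>n. c (n + 2) * complex_of_real u ^ (n + 2))"
          using split2[of u] elim by simp
        also have "\<dots> = (\<Sum>n. complex_of_real u ^ 2 * (c (n + 2) * complex_of_real u ^ n))"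
          by (intro suminf_cong) (simp only: power_add mult_ac)
        also have "\<dots> = complex_of_real u ^ 2 * (\<Sum>n. c (n + 2) * complex_of_real u ^ n)"
          by (rule suminf_mult) (rule summable_norm_cancel[OF sm])
        finally have "complex_of_real u * complex_of_real (hurwitz_kernel v u) - 1 - c 1 * complex_of_real u =
            complex_of_real u ^ 2 * (\<Sum>n. c (n + 2) * complex_of_real u ^ n)"
          by simp
        hence "complex_of_real (hurwitz_kernel v u) - 1 / complex_of_real u - c 1 =
            complex_of_real u * (\<Sum>n. c (n + 2) * complex_of_real u ^ n)"
          using elim by (simp add: field_simps power2_eq_square)
        moreover have "norm (\<Sum>n. c (n + 2) * complex_of_real u ^ n) \<le> (\<Sum>n. norm (c (n + 2)))"
          using summable_norm[OF sm] suminf_le[OF bd sm c2] by linarith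
        ultimately show ?case using elim by (simp add: norm_mult)
      qed
    qed
  qed
qed

section \<open>Cauchy kernels and partial fractions\<close>

lemma has_mellin_shift:
  assumes "has_mellin K (s + of_nat n) I"
  shows "has_mellin (\<lambda>u. complex_of_real u ^ n * K u) s I"
proof -
  have eq: "complex_of_real u powr (s + of_nat n - 1) * K u =
      complex_of_real u powr (s - 1) * (complex_of_real u ^ n * K u)" if "u > 0" for u
  proof -
    have "complex_of_real u powr (s + of_nat n - 1) = complex_of_real u powr (s - 1) * complex_of_real u powr of_nat n"
      by (simp add: powr_add [symmetric] algebra_simps)
    thus ?thesis using that by (simp add: powr_nat')
  qed
  have "set_integrable lborel {0<..} (\<lambda>u. complex_of_real u powr (s + of_nat n - 1) * K u) =
        set_integrable lborel {0<..} (\<lambda>u. complex_of_real u powr (s - 1) * (complex_of_real u ^ n * K u))"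
    by (rule set_integrable_cong) (use eq in auto)
  moreover have "(LINT u:{0<..}|lborel. complex_of_real u powr (s + of_nat n - 1) * K u) =
        (LINT u:{0<..}|lborel. complex_of_real u powr (s - 1) * (complex_of_real u ^ n * K u))"
    by (rule set_lebesgue_integral_cong) (use eq in auto)
  ultimately show ?thesis using assms by (simp add: has_mellin_def)
qed

lemma has_mellin_norm:
  assumes "has_mellin K s I"
  obtains N where "has_mellin (\<lambda>u. complex_of_real (norm (K u))) (complex_of_real (Re s)) (complex_of_real N)"
proof -
  define F where "F = (\<lambda>u. indicator {0<..} u *\<^sub>R (complex_of_real u powr (s - 1) * K u))"
  have "integrable lborel F"
    using assms by (simp add: has_mellin_def set_integrable_def F_def)
  hence int: "integrable lborel (\<lambda>u. complex_of_real (norm (F u)))"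
    by (simp only: complex_of_real_integrable_eq integrable_norm)
  have normF: "indicator {0<..} u *\<^sub>R (complex_of_real u powr (complex_of_real (Re s) - 1) * complex_of_real (norm (K u))) =
      complex_of_real (norm (F u))" for u
  proof -
    have "complex_of_real u powr (complex_of_real (Re s) - 1) = complex_of_real (u powr (Re s - 1))" if "u > 0"
      using powr_of_real[of u "Re s - 1"] that by simp
    thus ?thesis by (auto simp: F_def indicator_def norm_mult norm_powr_real_powr)
  qed
  have "has_mellin (\<lambda>u. complex_of_real (norm (K u))) (complex_of_real (Re s))
          (complex_of_real (LINT u|lborel. norm (F u)))"
    unfolding has_mellin_def set_integrable_def set_lebesgue_integral_def normF
    using int by (simp only: integral_complex_of_real simp_thms)
  thus ?thesis by (rule that)
qed

text \<open>A dilation by c multiplies a Mellin transform by c^(-s), so superposing dilates of one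
  function yields its transform times a Dirichlet series. The norms scale in the same way with a
  common factor \<open>N\<close>, which reduces integrability to one numerical series.\<close>

lemma has_mellin_scaled_series:
  assumes \<phi>: "has_mellin \<phi> s J"
    and c: "\<And>n. c n > 0"
    and sumc: "summable (\<lambda>n. norm (a n) * c n powr (- Re s))"
    and sumn: "\<And>u. u > 0 \<Longrightarrow> summable (\<lambda>n. norm (a n * \<phi> (c n * u)))"
    and K: "\<And>u. u > 0 \<Longrightarrow> (\<lambda>n. a n * \<phi> (c n * u)) sums K u"
  shows "has_mellin K s (J * (\<Sum>n. a n * complex_of_real (c n) powr (- s)))"
proof -
  obtain N where N: "has_mellin (\<lambda>u. complex_of_real (norm (\<phi> u))) (complex_of_real (Re s)) (complex_of_real N)"
    using has_mellin_norm[OF \<phi>] by blast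
  define f where "f = (\<lambda>n u. a n * \<phi> (c n * u))"
  have f: "has_mellin (f n) s (a n * (complex_of_real (c n) powr (- s) * J))" for n
    unfolding f_def by (intro has_mellin_cmult has_mellin_scale \<phi> c)
  have fn: "has_mellin (\<lambda>u. complex_of_real (norm (f n u))) (complex_of_real (Re s))
      (complex_of_real (norm (a n) * c n powr (- Re s) * N))" for n
  proof -
    have "complex_of_real (norm (a n)) * (complex_of_real (c n) powr (- complex_of_real (Re s)) * complex_of_real N) =
        complex_of_real (norm (a n) * c n powr (- Re s) * N)"
      using powr_of_real[of "c n" "- Re s"] c[of n] by simp
    with has_mellin_cmult[OF has_mellin_scale[OF N c[of n]], of "complex_of_real (norm (a n))"]
    show ?thesis by (simp only: f_def norm_mult of_real_mult)
  qed
  have sm: "summable (\<lambda>n. norm (a n) * c n powr (- Re s) * N)" by (intro summable_mult2 sumc)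
  have "has_mellin K s (\<Sum>n. a n * (complex_of_real (c n) powr (- s) * J))"
    by (rule has_mellin_sums(1)[OF f fn sm]) (use sumn K in \<open>auto simp: f_def\<close>)
  also have "(\<Sum>n. a n * (complex_of_real (c n) powr (- s) * J)) = (\<Sum>n. J * (a n * complex_of_real (c n) powr (- s)))"
    by (simp add: mult_ac)
  also have "\<dots> = J * (\<Sum>n. a n * complex_of_real (c n) powr (- s))"
  proof (rule suminf_mult, rule summable_norm_cancel)
    show "summable (\<lambda>n. norm (a n * complex_of_real (c n) powr (- s)))"
      using sumc c by (simp add: norm_mult norm_powr_real_powr less_imp_le)
  qed
  finally show ?thesis .
qed

section \<open>Beta integral and Cauchy kernels\<close>

lemma Gamma_reflection_real:
  assumes "0 < a" "a < 1"
  shows "Gamma a * Gamma (1 - a) = pi / sin (pi * a)"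
proof -
  have "complex_of_real (Gamma a * Gamma (1 - a)) = complex_of_real (pi / sin (pi * a))"
    using Gamma_reflection_complex[of "complex_of_real a"] Gamma_complex_of_real[of a] Gamma_complex_of_real[of "1 - a"]
    by (simp flip: sin_of_real)
  thus ?thesis using of_real_eq_iff by blast
qed

text \<open>The substitution t = u^2/(1 + u^2) turns twice the integral into Beta(p/2, 1 - p/2),
  which the reflection formula evaluates as pi/sin(pi p/2).\<close>

lemma has_mellin_inverse_quadratic:
  fixes p :: real
  assumes p: "0 < p" "p < 2"
  shows "has_mellin (\<lambda>u. complex_of_real (1 / (1 + u\<^sup>2))) (complex_of_real p) (complex_of_real (pi / (2 * sin (pi * p / 2))))"
proof -
  define a where "a = p / 2"
  have a: "0 < a" "a < 1" using p by (auto simp: a_def)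
  define f where "f = (\<lambda>t::real. t powr (a - 1) * (1 - t) powr ((1 - a) - 1))"
  define g where "g = (\<lambda>u::real. u\<^sup>2 / (1 + u\<^sup>2))"
  define g' where "g' = (\<lambda>u::real. 2 * u / (1 + u\<^sup>2)\<^sup>2)"
  have pos: "1 + u\<^sup>2 > 0" for u :: real by (simp add: add_pos_nonneg)
  have der: "(g has_field_derivative g' u) (at u within {0<..})" for u
    unfolding g_def g'_def using pos[of u]
    by (auto intro!: derivative_eq_intros simp: power2_eq_square field_simps)
  have inj: "inj_on g {0<..}"
  proof (rule inj_onI)
    fix u v :: real assume uv: "u \<in> {0<..}" "v \<in> {0<..}" "g u = g v"
    hence "u\<^sup>2 = v\<^sup>2" using pos[of u] pos[of v] by (simp add: g_def field_simps)
    thus "u = v" using uv by (simp add: power2_eq_iff)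
  qed
  have img: "g ` {0<..} = {0<..<1}"
  proof (intro equalityI subsetI)
    fix t assume "t \<in> g ` {0<..}"
    thus "t \<in> {0<..<1}" using pos by (auto simp: g_def field_simps)
  next
    fix t :: real assume t: "t \<in> {0<..<1}"
    hence "t / (1 - t) > 0" by simp
    hence "g (sqrt (t / (1 - t))) = t" using t by (simp add: g_def field_simps)
    moreover have "sqrt (t / (1 - t)) \<in> {0<..}" using t by simp
    ultimately show "t \<in> g ` {0<..}" by (metis image_eqI)
  qed
  have "set_integrable lborel {0..1} f" unfolding f_def by (rule integrable_Beta) (use a in auto)
  hence "set_integrable lborel {0<..<1} f" by (rule set_integrable_subset) auto
  hence "f absolutely_integrable_on {0<..<1}"
    unfolding set_integrable_def using integrable_completion borel_measurable_integrable by blast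
  moreover have "integral {0<..<1} f = pi / sin (pi * a)"
  proof -
    have "(f has_integral Beta a (1 - a)) {0..1}"
      unfolding f_def by (rule has_integral_Beta_real) (use a in auto)
    hence "integral {0<..<1} f = Beta a (1 - a)"
      by (simp add: has_integral_Icc_iff_Ioo integral_unique)
    thus ?thesis using Gamma_reflection_real[OF a] by (simp add: Beta_def)
  qed
  ultimately have *: "(\<lambda>u. \<bar>g' u\<bar> * f (g u)) absolutely_integrable_on {0<..}"
      "integral {0<..} (\<lambda>u. \<bar>g' u\<bar> * f (g u)) = pi / sin (pi * a)"
    using has_absolute_integral_change_of_variables_1'[of "{0<..}" g g' f "pi / sin (pi * a)"] der inj img
    by auto
  have eq: "\<bar>g' u\<bar> * f (g u) = 2 * (u powr (p - 1) / (1 + u\<^sup>2))" if u: "u \<in> {0<..}" for u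
  proof -
    have "1 - g u = 1 / (1 + u\<^sup>2)" using pos[of u] by (simp add: g_def field_simps)
    hence "f (g u) = (u\<^sup>2 / (1 + u\<^sup>2)) powr (a - 1) * (1 / (1 + u\<^sup>2)) powr (- a)"
      by (simp add: f_def g_def)
    also have "\<dots> = (u\<^sup>2) powr (a - 1) * ((1 + u\<^sup>2) powr (1 - a) * (1 + u\<^sup>2) powr a)"
      using u pos[of u] by (simp add: powr_divide powr_minus powr_diff field_simps)
    also have "(1 + u\<^sup>2) powr (1 - a) * (1 + u\<^sup>2) powr a = 1 + u\<^sup>2"
      using pos[of u] by (simp flip: powr_add)
    also have "(u\<^sup>2) powr (a - 1) = u powr (p - 2)"
      using u powr_powr[of u 2 "a - 1"] by (simp add: a_def algebra_simps powr_numeral)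
    finally have fg: "f (g u) = u powr (p - 2) * (1 + u\<^sup>2)" .
    have "2 * u / w\<^sup>2 * (X * w) = 2 * (u * X / w)" if "w > 0" for w X :: real
      using that by (simp add: power2_eq_square)
    from this[OF pos[of u]] have "\<bar>g' u\<bar> * f (g u) = 2 * ((u * u powr (p - 2)) / (1 + u\<^sup>2))"
      using u by (simp add: g'_def fg)
    also have "u * u powr (p - 2) = u powr (p - 1)"
      using u powr_add[of u 1 "p - 2"] by simp
    finally show ?thesis .
  qed
  have int: "(\<lambda>u. 2 * (u powr (p - 1) / (1 + u\<^sup>2))) absolutely_integrable_on {0<..}"
    using *(1) by (subst (asm) set_integrable_cong[OF refl refl eq]) auto
  have I: "integral {0<..} (\<lambda>u. 2 * (u powr (p - 1) / (1 + u\<^sup>2))) = pi / sin (pi * a)"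
    using *(2) by (subst (asm) integral_cong[OF eq]) auto
  have "((\<lambda>u. 2 * (u powr (p - 1) / (1 + u\<^sup>2))) has_integral pi / sin (pi * a)) {0<..}"
    using int I by (metis absolutely_integrable_on_def has_integral_integrable_integral set_lebesgue_integral_eq_integral(1))
  from has_integral_mult_right[OF this, of "1 / 2"]
  have hi: "((\<lambda>u. u powr (p - 1) / (1 + u\<^sup>2)) has_integral pi / (2 * sin (pi * p / 2))) {0<..}"
    by (simp add: a_def)
  have pw: "complex_of_real u powr (complex_of_real p - 1) * complex_of_real (1 / (1 + u\<^sup>2)) =
      complex_of_real (u powr (p - 1) / (1 + u\<^sup>2))" if "u \<in> {0<..}" for u
    using that powr_of_real[of u "p - 1"] by simp
  have "has_mellin (\<lambda>u. if u \<in> {0<..} then complex_of_real (1 / (1 + u\<^sup>2)) else 0) (complex_of_real p)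
      (complex_of_real (pi / (2 * sin (pi * p / 2))))"
  proof (rule has_mellinI_has_integral)
    show hc: "((\<lambda>u. complex_of_real u powr (complex_of_real p - 1) * complex_of_real (1 / (1 + u\<^sup>2))) has_integral
        complex_of_real (pi / (2 * sin (pi * p / 2)))) {0<..}"
      by (rule has_integral_eq[OF _ has_integral_of_real[OF hi]]) (simp only: pw)
    show "(\<lambda>u. complex_of_real u powr (complex_of_real p - 1) * complex_of_real (1 / (1 + u\<^sup>2))) absolutely_integrable_on {0<..}"
      by (rule absolutely_integrable_integrable_bound[where g = "\<lambda>u. u powr (p - 1) / (1 + u\<^sup>2)"])
         (use pw pos hc hi in \<open>auto simp only: norm_of_real abs_of_nonneg powr_ge_zero divide_nonneg_pos order_refl has_integral_iff\<close>)
    show "continuous_on {0<..} (\<lambda>u. complex_of_real (1 / (1 + u\<^sup>2)))"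
      using pos by (intro continuous_intros) (metis less_irrefl)
  qed auto
  thus ?thesis by (subst (asm) has_mellin_cong) auto
qed

text \<open>Rationalising, u/(1 + iu) = u/(1 + u^2) - i u^2/(1 + u^2): this is the previous integral
  at p = s + 1 and p = s + 2, both in (0, 2) exactly when -1 < s < 0. The second kernel is the
  conjugate.\<close>

lemma has_mellin_cauchy_kernel:
  fixes s :: real
  assumes s: "-1 < s" "s < 0"
  shows "has_mellin (\<lambda>u. complex_of_real u / (1 + \<i> * complex_of_real u)) (complex_of_real s)
           (Complex (pi / (2 * cos (pi * s / 2))) (pi / (2 * sin (pi * s / 2))))" (is ?A)
    and "has_mellin (\<lambda>u. complex_of_real u / (1 - \<i> * complex_of_real u)) (complex_of_real s)
           (Complex (pi / (2 * cos (pi * s / 2))) (- (pi / (2 * sin (pi * s / 2)))))" (is ?B)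
proof -
  let ?q = "\<lambda>u::real. complex_of_real (1 / (1 + u\<^sup>2))"
  have sh: "sin (pi * (s + 1) / 2) = cos (pi * s / 2)" "sin (pi * (s + 2) / 2) = - sin (pi * s / 2)"
    by (simp_all add: sin_add distrib_left add_divide_distrib)
  have e: "complex_of_real (s + 1) = complex_of_real s + of_nat 1" "complex_of_real (s + 2) = complex_of_real s + of_nat 2"
    by simp_all
  have m1: "has_mellin (\<lambda>u. complex_of_real u ^ 1 * ?q u) (complex_of_real s) (complex_of_real (pi / (2 * cos (pi * s / 2))))"
    by (rule has_mellin_shift) (use has_mellin_inverse_quadratic[of "s + 1", unfolded sh e] s in simp)
  have m2: "has_mellin (\<lambda>u. complex_of_real u ^ 2 * ?q u) (complex_of_real s) (complex_of_real (pi / (2 * - sin (pi * s / 2))))"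
    by (rule has_mellin_shift) (use has_mellin_inverse_quadratic[of "s + 2", unfolded sh e] s in simp)
  have pos: "1 + u\<^sup>2 \<noteq> 0" for u :: real by (metis add_pos_nonneg less_irrefl zero_le_power2 zero_less_one)
  have k: "complex_of_real u ^ 1 * ?q u - \<i> * (complex_of_real u ^ 2 * ?q u) = complex_of_real u / (1 + \<i> * complex_of_real u)"
          "complex_of_real u ^ 1 * ?q u + \<i> * (complex_of_real u ^ 2 * ?q u) = complex_of_real u / (1 - \<i> * complex_of_real u)"
    for u :: real
  proof -
    have f: "(1 + \<i> * complex_of_real u) * (1 - \<i> * complex_of_real u) = complex_of_real (1 + u\<^sup>2)"
      by (simp add: algebra_simps power2_eq_square)
    hence nz: "1 + \<i> * complex_of_real u \<noteq> 0" "1 - \<i> * complex_of_real u \<noteq> 0" using pos[of u]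
      by (metis mult_zero_left mult_zero_right of_real_eq_0_iff)+
    have q: "?q u = 1 / ((1 + \<i> * complex_of_real u) * (1 - \<i> * complex_of_real u))" by (simp add: f)
    show "complex_of_real u ^ 1 * ?q u - \<i> * (complex_of_real u ^ 2 * ?q u) = complex_of_real u / (1 + \<i> * complex_of_real u)"
      "complex_of_real u ^ 1 * ?q u + \<i> * (complex_of_real u ^ 2 * ?q u) = complex_of_real u / (1 - \<i> * complex_of_real u)"
      unfolding q using nz by (simp_all add: divide_simps, simp_all add: algebra_simps power2_eq_square)
  qed
  show ?A using has_mellin_diff[OF m1 has_mellin_cmult[OF m2, of \<i>]] unfolding k
    by (rule back_subst[where P = "has_mellin _ _"]) (simp add: complex_eq_iff)
  show ?B using has_mellin_add[OF m1 has_mellin_cmult[OF m2, of \<i>]] unfolding k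
    by (rule back_subst[where P = "has_mellin _ _"]) (simp add: complex_eq_iff)
qed

text \<open>Logarithmic derivative of Gamma(z) Gamma(1 - z) = pi/sin(pi z). With the series of the
  Digamma function it supplies the partial fractions of the cotangent in two one-sided
  halves.\<close>

lemma Digamma_reflection_complex:
  fixes z :: complex
  assumes z: "z \<notin> \<int>"
  shows "Digamma (1 - z) - Digamma z = of_real pi * cot (of_real pi * z)"
proof -
  have z1: "1 - z \<notin> \<int>" using z by (metis Ints_1 Ints_diff diff_diff_eq2 add_diff_cancel_left')
  have np: "z \<notin> \<int>\<^sub>\<le>\<^sub>0" "1 - z \<notin> \<int>\<^sub>\<le>\<^sub>0" using z z1 nonpos_Ints_subset_Ints by blast+
  have sz: "sin (of_real pi * z) \<noteq> 0"
  proof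
    assume "sin (of_real pi * z) = 0"
    then obtain n :: int where "of_real pi * z = of_real (of_int n * pi)" unfolding sin_eq_0 by (auto simp: mult.commute)
    hence "z = of_int n" by simp
    with z show False by simp
  qed
  have "((\<lambda>w. Gamma w * Gamma (1 - w)) has_field_derivative
      Gamma z * Digamma z * Gamma (1 - z) - Gamma z * (Gamma (1 - z) * Digamma (1 - z))) (at z)"
    using np by (auto intro!: derivative_eq_intros simp: algebra_simps)
  moreover have "((\<lambda>w. of_real pi / sin (of_real pi * w)) has_field_derivative
      - (of_real pi * (of_real pi * cos (of_real pi * z))) / (sin (of_real pi * z))\<^sup>2) (at z)"
    using sz by (auto intro!: derivative_eq_intros simp: power2_eq_square)
  moreover have "(\<lambda>w. Gamma w * Gamma (1 - w)) = (\<lambda>w::complex. of_real pi / sin (of_real pi * w))"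
    by (simp add: Gamma_reflection_complex)
  ultimately have "Gamma z * Digamma z * Gamma (1 - z) - Gamma z * (Gamma (1 - z) * Digamma (1 - z)) =
      - (of_real pi * (of_real pi * cos (of_real pi * z))) / (sin (of_real pi * z))\<^sup>2"
    using DERIV_unique by metis
  hence "(Gamma z * Gamma (1 - z)) * (Digamma (1 - z) - Digamma z) =
      (of_real pi * (of_real pi * cos (of_real pi * z))) / (sin (of_real pi * z))\<^sup>2"
    by (simp add: algebra_simps)
  hence "(of_real pi / sin (of_real pi * z)) * (Digamma (1 - z) - Digamma z) =
      (of_real pi / sin (of_real pi * z)) * (of_real pi * cot (of_real pi * z))"
    unfolding Gamma_reflection_complex by (simp add: cot_def power2_eq_square)
  thus ?thesis using sz by simp
qed

lemma Digamma_diff_sums: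
  fixes z w :: complex
  assumes "z \<noteq> 0" "w \<noteq> 0"
  shows "(\<lambda>n. 1 / (z + of_nat n) - 1 / (w + of_nat n)) sums (Digamma w - Digamma z)"
proof -
  have D: "(\<lambda>n. inverse (of_nat (Suc n)) - inverse (z + of_nat n)) sums (Digamma z + euler_mascheroni)"
    if "z \<noteq> 0" for z :: complex
    using summable_Digamma[OF that] by (simp add: Digamma_def summable_sums)
  show ?thesis using sums_diff[OF D[OF assms(2)] D[OF assms(1)]] by (simp add: inverse_eq_divide)
qed

text \<open>Not simply \<open>hurwitz_zeta s v - 1 / (s - 1)\<close>, which has the junk value 0 at \<open>s = 1\<close>.\<close>

definition hurwitz_regular :: "real \<Rightarrow> complex \<Rightarrow> complex" where
  "hurwitz_regular v = (SOME R. R holomorphic_on UNIV \<and> (\<forall>s. s \<noteq> 1 \<longrightarrow> hurwitz_zeta s v = 1 / (s - 1) + R s))"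

text \<open>The constant \<open>b\<close> is left existential but uniform in s: it is the
  coefficient 1/2 - v of the kernel's expansion, and weighted sums of such constants are read off
  from the limit at 0+.\<close>

lemma
  assumes v: "v > 0"
  shows hurwitz_regular_holomorphic: "hurwitz_regular v holomorphic_on UNIV"
    and hurwitz_zeta_conv_regular: "s \<noteq> 1 \<Longrightarrow> hurwitz_zeta s v = 1 / (s - 1) + hurwitz_regular v s"
    and hurwitz_zeta_series: "Re s > 1 \<Longrightarrow> hurwitz_zeta s v = (\<Sum>n. complex_of_real (real n + v) powr (- s))"
    and has_mellin_hurwitz_zeta: "\<exists>b. (\<forall>s::real. -1 < s \<longrightarrow> s < 0 \<longrightarrow>
       has_mellin (\<lambda>u. complex_of_real (hurwitz_kernel v u) - 1 / complex_of_real u - b) (complex_of_real s)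
         (Gamma (complex_of_real s) * hurwitz_zeta (complex_of_real s) v)) \<and>
       ((\<lambda>u. complex_of_real (hurwitz_kernel v u) - 1 / complex_of_real u - b) \<longlongrightarrow> 0) (at_right 0)"
proof -
  obtain R b where R: "R holomorphic_on UNIV"
    "\<And>z. Re z > 1 \<Longrightarrow> 1 / (z - 1) + R z = (\<Sum>n. complex_of_real (real n + v) powr (- z))"
    "\<And>s::real. -1 < s \<Longrightarrow> s < 0 \<Longrightarrow>
       has_mellin (\<lambda>u. complex_of_real (hurwitz_kernel v u) - 1 / complex_of_real u - b) (complex_of_real s)
         (Gamma (complex_of_real s) * (1 / (complex_of_real s - 1) + R (complex_of_real s)))"
    "((\<lambda>u. complex_of_real (hurwitz_kernel v u) - 1 / complex_of_real u - b) \<longlongrightarrow> 0) (at_right 0)"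
    using hurwitz_regular_part[OF v] by blast
  have z: "hurwitz_zeta s v = (if s = 1 then 0 else 1 / (s - 1) + R s)" for s
    using hurwitz_zeta_eqI[OF R(1,2)] by blast
  have "\<exists>R. R holomorphic_on UNIV \<and> (\<forall>s. s \<noteq> 1 \<longrightarrow> hurwitz_zeta s v = 1 / (s - 1) + R s)"
    using R(1) z by auto
  from someI_ex[OF this] show "hurwitz_regular v holomorphic_on UNIV"
    "s \<noteq> 1 \<Longrightarrow> hurwitz_zeta s v = 1 / (s - 1) + hurwitz_regular v s"
    unfolding hurwitz_regular_def by blast+
  show "hurwitz_zeta s v = (\<Sum>n. complex_of_real (real n + v) powr (- s))" if "Re s > 1"
    using R(2)[OF that] that by (auto simp: z)
  have "Gamma (complex_of_real s) * hurwitz_zeta (complex_of_real s) v =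
      Gamma (complex_of_real s) * (1 / (complex_of_real s - 1) + R (complex_of_real s))" if "s < 0" for s :: real
  proof -
    have "complex_of_real s \<noteq> 1" using that by (metis of_real_1 of_real_eq_iff not_one_less_zero)
    thus ?thesis by (simp add: z)
  qed
  note e = this
  show "\<exists>b. (\<forall>s::real. -1 < s \<longrightarrow> s < 0 \<longrightarrow>
       has_mellin (\<lambda>u. complex_of_real (hurwitz_kernel v u) - 1 / complex_of_real u - b) (complex_of_real s)
         (Gamma (complex_of_real s) * hurwitz_zeta (complex_of_real s) v)) \<and>
       ((\<lambda>u. complex_of_real (hurwitz_kernel v u) - 1 / complex_of_real u - b) \<longlongrightarrow> 0) (at_right 0)"
  proof (intro exI conjI allI impI)
    fix s :: real assume s: "-1 < s" "s < 0"
    show "has_mellin (\<lambda>u. complex_of_real (hurwitz_kernel v u) - 1 / complex_of_real u - b) (complex_of_real s)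
         (Gamma (complex_of_real s) * hurwitz_zeta (complex_of_real s) v)"
      unfolding e[OF s(2)] by (rule R(3)[OF s])
  qed (rule R(4))
qed

text \<open>Dilating by 1/(M(n + x)) multiplies the transform by (M(n + x))^s, and the weight 1/(2
  pi (n + x)) lowers the exponent to s - 1, which produces the Dirichlet series of zeta(1 - s, x).
  The linear bound on \<open>\<phi>\<close> makes the terms of order (n + x)^(-2) pointwise, so one
  half of the partial fractions converges by itself.\<close>

lemma has_mellin_half_series:
  fixes s :: real
  assumes x: "x > 0" and M: "M > 0" and s: "s < 0"
    and \<phi>: "has_mellin \<phi> (complex_of_real s) J" "\<And>t. t > 0 \<Longrightarrow> norm (\<phi> t) \<le> t"
  shows "has_mellin (\<lambda>u. \<Sum>n. \<phi> (u / (M * (real n + x))) / complex_of_real (2 * pi * (real n + x))) (complex_of_real s)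
           (J * complex_of_real (M powr s / (2 * pi)) * (\<Sum>n. complex_of_real (real n + x) powr (complex_of_real s - 1)))"
    and "\<And>u. u > 0 \<Longrightarrow> summable (\<lambda>n. \<phi> (u / (M * (real n + x))) / complex_of_real (2 * pi * (real n + x)))"
proof -
  define a where "a = (\<lambda>n. 1 / complex_of_real (2 * pi * (real n + x)))"
  define c where "c = (\<lambda>n. 1 / (M * (real n + x)))"
  have c: "c n > 0" for n using x M by (simp add: c_def add_nonneg_pos)
  have pos: "real n + x > 0" for n using x by simp
  have cp: "c n powr (- s) = M powr s * (real n + x) powr s" for n
    using pos[of n] M by (simp add: c_def powr_minus_divide powr_divide powr_mult)
  have na: "norm (a n) = 1 / (2 * pi) * (1 / (real n + x))" for n
    using pos[of n] by (simp add: a_def norm_divide norm_mult del: of_real_add)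
  have xs: "(1 / (real n + x)) * (real n + x) powr s = (real n + x) powr (s - 1)" for n
    using pos[of n] by (simp add: powr_diff)
  have "summable (\<lambda>n. (1 / (2 * pi) * M powr s) * (real n + x) powr (s - 1))"
    by (intro summable_mult summable_powr_shift) (use s x in auto)
  also have "(\<lambda>n. (1 / (2 * pi) * M powr s) * (real n + x) powr (s - 1)) =
      (\<lambda>n. norm (a n) * c n powr (- Re (complex_of_real s)))"
    by (simp only: na cp Re_complex_of_real xs[symmetric] mult_ac)
  finally have sumc: "summable (\<lambda>n. norm (a n) * c n powr (- Re (complex_of_real s)))" .
  have sumn: "summable (\<lambda>n. norm (a n * \<phi> (c n * u)))" if u: "u > 0" for u
  proof (rule summable_comparison_test')
    show "summable (\<lambda>n. (u / (2 * pi * M)) * (real n + x) powr (-2))"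
      by (intro summable_mult summable_powr_shift) (use x in auto)
    fix n :: nat
    have "norm (\<phi> (c n * u)) \<le> c n * u" using c[of n] u by (intro \<phi>(2)) simp
    hence "norm (a n) * norm (\<phi> (c n * u)) \<le> norm (a n) * (c n * u)" by (rule mult_left_mono) simp
    also have "\<dots> = (u / (2 * pi * M)) * (real n + x) powr (-2)"
      using pos[of n] M by (simp add: na c_def powr_minus powr_numeral power2_eq_square field_simps)
    finally show "norm (norm (a n * \<phi> (c n * u))) \<le> (u / (2 * pi * M)) * (real n + x) powr (-2)"
      by (simp add: norm_mult)
  qed
  have eq: "a n * \<phi> (c n * u) = \<phi> (u / (M * (real n + x))) / complex_of_real (2 * pi * (real n + x))" for n u
    by (simp add: a_def c_def)
  show "summable (\<lambda>n. \<phi> (u / (M * (real n + x))) / complex_of_real (2 * pi * (real n + x)))" if "u > 0" for u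
    using summable_norm_cancel[OF sumn[OF that]] by (simp only: eq)
  have "has_mellin (\<lambda>u. \<Sum>n. \<phi> (u / (M * (real n + x))) / complex_of_real (2 * pi * (real n + x))) (complex_of_real s)
           (J * (\<Sum>n. a n * complex_of_real (c n) powr (- complex_of_real s)))"
  proof (rule has_mellin_scaled_series[OF \<phi>(1) c sumc sumn])
    fix u :: real assume "u > 0"
    show "(\<lambda>n. a n * \<phi> (c n * u)) sums (\<Sum>n. \<phi> (u / (M * (real n + x))) / complex_of_real (2 * pi * (real n + x)))"
      using summable_sums[OF summable_norm_cancel[OF sumn[OF \<open>u > 0\<close>]]] by (simp only: eq)
  qed
  also have "(\<Sum>n. a n * complex_of_real (c n) powr (- complex_of_real s)) =
      (\<Sum>n. complex_of_real (M powr s / (2 * pi)) * complex_of_real (real n + x) powr (complex_of_real s - 1))"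
  proof (intro suminf_cong)
    fix n :: nat
    have 1: "complex_of_real (c n) powr (- complex_of_real s) = complex_of_real (M powr s * (real n + x) powr s)"
      using powr_of_real[of "c n" "- s"] c[of n] by (simp add: cp)
    have 2: "complex_of_real (real n + x) powr (complex_of_real s - 1) = complex_of_real ((real n + x) powr (s - 1))"
      using powr_of_real[of "real n + x" "s - 1"] pos[of n] by simp
    have "a n = complex_of_real (1 / (2 * pi) * (1 / (real n + x)))" by (simp add: a_def)
    hence "a n * complex_of_real (c n) powr (- complex_of_real s) =
        complex_of_real (1 / (2 * pi) * (1 / (real n + x)) * (M powr s * (real n + x) powr s))"
      unfolding 1 by simp
    also have "1 / (2 * pi) * (1 / (real n + x)) * (M powr s * (real n + x) powr s) =
        M powr s / (2 * pi) * (real n + x) powr (s - 1)"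
      by (simp add: xs[symmetric])
    finally show "a n * complex_of_real (c n) powr (- complex_of_real s) =
        complex_of_real (M powr s / (2 * pi)) * complex_of_real (real n + x) powr (complex_of_real s - 1)"
      unfolding 2 by simp
  qed
  also have "\<dots> = complex_of_real (M powr s / (2 * pi)) * (\<Sum>n. complex_of_real (real n + x) powr (complex_of_real s - 1))"
  proof (rule suminf_mult, rule summable_norm_cancel)
    have "norm (complex_of_real (real n + x) powr (complex_of_real s - 1)) = (real n + x) powr (s - 1)" for n
      using powr_of_real[of "real n + x" "s - 1"] pos[of n] by (simp add: norm_powr_real_powr)
    thus "summable (\<lambda>n. norm (complex_of_real (real n + x) powr (complex_of_real s - 1)))"
      using summable_powr_shift[of "s - 1" x] s x by simp
  qed
  finally show "has_mellin (\<lambda>u. \<Sum>n. \<phi> (u / (M * (real n + x))) / complex_of_real (2 * pi * (real n + x))) (complex_of_real s)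
           (J * complex_of_real (M powr s / (2 * pi)) * (\<Sum>n. complex_of_real (real n + x) powr (complex_of_real s - 1)))"
    by (simp only: mult.assoc)
qed

text \<open>With e = exp(i pi z) the cotangent is i(e^2 + 1)/(e^2 - 1), an affine function of e^2/(1
  - e^2); the integers are the common poles.\<close>

lemma geometric_kernel_cot:
  fixes z :: complex
  assumes z: "z \<notin> \<int>"
  shows "exp (2 * of_real pi * \<i> * z) / (1 - exp (2 * of_real pi * \<i> * z)) = - 1 / 2 + \<i> / 2 * cot (of_real pi * z)"
proof -
  define e where "e = exp (\<i> * (of_real pi * z))"
  have e0: "e \<noteq> 0" by (simp add: e_def)
  have q: "exp (2 * of_real pi * \<i> * z) = e\<^sup>2"
  proof -
    have "2 * of_real pi * \<i> * z = \<i> * (of_real pi * z) + \<i> * (of_real pi * z)" by simp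
    thus ?thesis by (simp only: e_def power2_eq_square exp_add)
  qed
  have em: "exp (- (\<i> * (of_real pi * z))) = 1 / e" by (simp add: e_def exp_minus inverse_eq_divide)
  have sin: "sin (of_real pi * z) = (e - 1 / e) / (2 * \<i>)" and cos: "cos (of_real pi * z) = (e + 1 / e) / 2"
    by (simp_all add: sin_exp_eq cos_exp_eq em flip: e_def)
  have nz: "e\<^sup>2 \<noteq> 1"
  proof
    assume "e\<^sup>2 = 1"
    hence "sin (of_real pi * z) = 0" unfolding sin using e0 by (simp add: power2_eq_square field_simps)
    then obtain n :: int where "of_real pi * z = of_real (of_int n * pi)" unfolding sin_eq_0 by (auto simp: mult.commute)
    hence "z = of_int n" by simp
    with z show False by simp
  qed
  have e4: "e - 1 / e = (e\<^sup>2 - 1) / e" "e + 1 / e = (e\<^sup>2 + 1) / e"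
    using e0 by (simp_all add: power2_eq_square field_simps)
  have "cot (of_real pi * z) = \<i> * (e\<^sup>2 + 1) / (e\<^sup>2 - 1)"
    unfolding cot_def sin cos e4 using e0 nz by (simp add: field_simps)
  thus ?thesis unfolding q using nz by (simp add: divide_simps) (simp add: algebra_simps)
qed

text \<open>The numbers n + x and n + 1 - x are the distances from x to the poles of the cotangent
  on its left and right. Subtracting the value at x introduces the reciprocal distances and with
  them decay of order n^(-2).\<close>

lemma geometric_kernel_partial_fractions:
  assumes x: "0 < x" "x < 1" and y: "y > 0"
  defines "z \<equiv> complex_of_real x + \<i> * complex_of_real y"
  shows "(\<lambda>n. (complex_of_real (y / (real n + x)) / (1 + \<i> * complex_of_real (y / (real n + x)))) / complex_of_real (2 * pi * (real n + x))
            + (complex_of_real (y / (real n + (1 - x))) / (1 - \<i> * complex_of_real (y / (real n + (1 - x))))) / complex_of_real (2 * pi * (real n + (1 - x))))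
         sums (exp (2 * of_real pi * \<i> * z) / (1 - exp (2 * of_real pi * \<i> * z))
             - exp (2 * of_real pi * \<i> * of_real x) / (1 - exp (2 * of_real pi * \<i> * of_real x)))"
proof -
  let ?x = "complex_of_real x"
  have zi: "z \<notin> \<int>" using y by (auto simp: z_def complex_eq_iff elim!: Ints_cases)
  have xi: "?x \<notin> \<int>"
  proof
    assume "?x \<in> \<int>"
    then obtain n :: int where "?x = of_int n" by (auto elim: Ints_cases)
    hence "x = of_int n" by (metis of_real_eq_iff of_real_of_int_eq)
    with x show False by simp
  qed
  have nz: "z \<noteq> 0" "?x \<noteq> 0" "1 - z \<noteq> 0" "1 - ?x \<noteq> 0" using zi xi by auto
  have "(\<lambda>n. (1 / (z + of_nat n) - 1 / (?x + of_nat n)) - (1 / ((1 - z) + of_nat n) - 1 / ((1 - ?x) + of_nat n)))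
      sums ((Digamma ?x - Digamma z) - (Digamma (1 - ?x) - Digamma (1 - z)))"
    by (intro sums_diff Digamma_diff_sums nz)
  from sums_mult[OF this, of "\<i> / (2 * of_real pi)"]
  have s: "(\<lambda>n. \<i> / (2 * of_real pi) * ((1 / (z + of_nat n) - 1 / (?x + of_nat n)) - (1 / ((1 - z) + of_nat n) - 1 / ((1 - ?x) + of_nat n))))
      sums (\<i> / (2 * of_real pi) * ((Digamma (1 - z) - Digamma z) - (Digamma (1 - ?x) - Digamma ?x)))"
    by (simp add: algebra_simps)
  have v: "\<i> / (2 * of_real pi) * ((Digamma (1 - z) - Digamma z) - (Digamma (1 - ?x) - Digamma ?x)) =
      exp (2 * of_real pi * \<i> * z) / (1 - exp (2 * of_real pi * \<i> * z))
             - exp (2 * of_real pi * \<i> * ?x) / (1 - exp (2 * of_real pi * \<i> * ?x))"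
    unfolding Digamma_reflection_complex[OF zi] Digamma_reflection_complex[OF xi]
      geometric_kernel_cot[OF zi] geometric_kernel_cot[OF xi] by (simp add: field_simps)
  \<comment> \<open>One computation for both sides: \<open>\<sigma> = 1\<close> for the poles to the
    left of x, \<open>\<sigma> = -1\<close> for those to the right, where z enters as 1 - z.\<close>
  have t: "\<i> / (2 * of_real pi) * (1 / (of_real a + \<sigma> * \<i> * of_real y) - 1 / of_real a) =
      \<sigma> * ((complex_of_real (y / a) / (1 + \<sigma> * \<i> * complex_of_real (y / a))) / complex_of_real (2 * pi * a))"
    if a: "a > 0" and \<sigma>: "\<sigma> = 1 \<or> \<sigma> = -1" for a :: real and \<sigma> :: complex
  proof -
    have n: "of_real a + \<sigma> * \<i> * complex_of_real y \<noteq> 0" using a \<sigma> by (auto simp: complex_eq_iff)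
    have "1 + \<sigma> * \<i> * complex_of_real (y / a) = (of_real a + \<sigma> * \<i> * complex_of_real y) / of_real a"
      using a by (simp add: field_simps)
    hence "complex_of_real (y / a) / (1 + \<sigma> * \<i> * complex_of_real (y / a)) = of_real y / (of_real a + \<sigma> * \<i> * complex_of_real y)"
      using a by simp
    moreover have "\<i> / (2 * of_real pi) * (1 / (of_real a + \<sigma> * \<i> * of_real y) - 1 / of_real a) =
       \<sigma> * (of_real y / (of_real a + \<sigma> * \<i> * complex_of_real y) / complex_of_real (2 * pi * a))"
      using n a by (simp add: divide_simps) (simp add: algebra_simps)
    ultimately show ?thesis by (simp only:)
  qed
  have "\<i> / (2 * of_real pi) * ((1 / (z + of_nat n) - 1 / (?x + of_nat n)) - (1 / ((1 - z) + of_nat n) - 1 / ((1 - ?x) + of_nat n))) =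
     (complex_of_real (y / (real n + x)) / (1 + \<i> * complex_of_real (y / (real n + x)))) / complex_of_real (2 * pi * (real n + x))
            + (complex_of_real (y / (real n + (1 - x))) / (1 - \<i> * complex_of_real (y / (real n + (1 - x))))) / complex_of_real (2 * pi * (real n + (1 - x)))" for n
  proof -
    have p: "real n + x > 0" "real n + (1 - x) > 0" using x by auto
    have "z + of_nat n = of_real (real n + x) + 1 * \<i> * of_real y" "?x + of_nat n = of_real (real n + x)"
      "(1 - z) + of_nat n = of_real (real n + (1 - x)) + (-1) * \<i> * of_real y" "(1 - ?x) + of_nat n = of_real (real n + (1 - x))"
      by (simp_all add: z_def)
    thus ?thesis using t[OF p(1), of 1] t[OF p(2), of "-1"] by (simp only: right_diff_distrib) simp
  qed
  with s v show ?thesis by (simp only:)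
qed

text \<open>Since \<open>\<omega> ^ m = 1\<close>, the common denominator 1 - exp(-u) equals 1 - q^m
  with q = \<open>\<omega>\<close> exp(-u/m), and it cancels against the finite geometric
  sum.\<close>

lemma geometric_hurwitz_kernel:
  assumes m: "m > 0" and w: "\<omega> ^ m = 1" and u: "u > 0"
  shows "(\<Sum>r=1..m. \<omega> ^ r * complex_of_real (hurwitz_kernel (real r / real m) u)) =
         \<omega> * complex_of_real (exp (- u / real m)) / (1 - \<omega> * complex_of_real (exp (- u / real m)))"
proof -
  define q where "q = \<omega> * complex_of_real (exp (- u / real m))"
  have qm: "q ^ m = complex_of_real (exp (- u))"
    using m by (simp add: q_def power_mult_distrib w exp_of_nat_mult[symmetric] flip: of_real_power)
  have q1: "q \<noteq> 1"
  proof
    assume "q = 1"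
    hence "complex_of_real (exp (- u)) = 1" using qm by simp
    hence "exp (- u) = 1" by (metis of_real_1 of_real_eq_iff)
    with u show False by simp
  qed
  have t: "\<omega> ^ r * complex_of_real (hurwitz_kernel (real r / real m) u) = q ^ r / (1 - q ^ m)" for r
  proof -
    have "exp (- (real r / real m) * u) = exp (- u / real m) ^ r"
      by (simp add: exp_of_nat_mult[symmetric])
    thus ?thesis unfolding qm by (simp add: hurwitz_kernel_def q_def power_mult_distrib)
  qed
  have "(\<Sum>r=1..m. \<omega> ^ r * complex_of_real (hurwitz_kernel (real r / real m) u)) = (\<Sum>r=1..m. q ^ r) / (1 - q ^ m)"
    unfolding t by (simp add: sum_divide_distrib)
  also have "(\<Sum>r=1..m. q ^ r) = (q - q ^ Suc m) / (1 - q)"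
    using q1 m by (subst sum_gp) auto
  also have "q - q ^ Suc m = q * (1 - q ^ m)" by (simp add: algebra_simps)
  also have "q * (1 - q ^ m) / (1 - q) / (1 - q ^ m) = q / (1 - q)"
  proof -
    have "1 - q ^ m \<noteq> 0"
    proof
      assume "1 - q ^ m = 0"
      hence "complex_of_real (exp (- u)) = 1" using qm by simp
      hence "exp (- u) = 1" by (metis of_real_1 of_real_eq_iff)
      with u show False by simp
    qed
    thus ?thesis by simp
  qed
  finally show ?thesis by (simp only: q_def)
qed

text \<open>The vanishing sum removes the polar parts common to all r: 1/u in the kernels and 1/(s -
  1) in the zeta values.\<close>

lemma root_of_unity_facts:
  assumes "0 < k" "k < m"
  defines "\<omega> \<equiv> exp (2 * of_real pi * \<i> * of_real (real k / real m))"
  shows "\<omega> ^ m = 1" "\<omega> \<noteq> 1" "(\<Sum>r=1..m. \<omega> ^ r) = 0"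
proof -
  have "\<omega> ^ m = exp (of_nat m * (2 * of_real pi * \<i> * of_real (real k / real m)))"
    by (simp only: \<omega>_def exp_of_nat_mult)
  also have "of_nat m * (2 * of_real pi * \<i> * of_real (real k / real m)) = of_real (2 * pi * real k) * \<i>"
    using assms by (simp add: field_simps)
  also have "exp \<dots> = 1"
    unfolding exp_eq_1 by (auto intro!: exI[of _ "int k"])
  finally show 1: "\<omega> ^ m = 1" .
  show 2: "\<omega> \<noteq> 1"
  proof
    assume "\<omega> = 1"
    then obtain n :: int where "2 * pi * (real k / real m) = of_int (2 * n) * pi"
      unfolding \<omega>_def exp_eq_1 by auto
    hence "(2 * pi) * (real k / real m) = (2 * pi) * of_int n" by simp
    hence "real k / real m = of_int n"
      by (rule mult_left_cancel[THEN iffD1, rotated]) simp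
    moreover have "0 < real k / real m" "real k / real m < 1" using assms by auto
    ultimately have "0 < n" "n < 1" by simp_all
    thus False by simp
  qed
  show "(\<Sum>r=1..m. \<omega> ^ r) = 0"
    using 1 2 assms by (subst sum_gp) auto
qed

text \<open>One kernel, q/(1 - q) minus its limit at 0, is transformed in two ways: as a finite
  combination of Hurwitz kernels and by partial fractions. The two complex coefficients are the
  transforms of u/(1 + iu) and u/(1 - iu).\<close>

lemma finite_functional_equation_real:
  fixes s :: real
  assumes k: "0 < k" "k < m" and s: "-1 < s" "s < 0"
  defines "x \<equiv> real k / real m"
  defines "\<omega> \<equiv> exp (2 * of_real pi * \<i> * of_real x)"
  shows "Gamma (complex_of_real s) * (\<Sum>r=1..m. \<omega> ^ r * hurwitz_zeta (complex_of_real s) (real r / real m)) =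
    complex_of_real ((2 * pi * real m) powr s / (2 * pi)) *
      (Complex (pi / (2 * cos (pi * s / 2))) (pi / (2 * sin (pi * s / 2))) * hurwitz_zeta (1 - complex_of_real s) x +
       Complex (pi / (2 * cos (pi * s / 2))) (- (pi / (2 * sin (pi * s / 2)))) * hurwitz_zeta (1 - complex_of_real s) (1 - x))"
proof -
  define M where "M = 2 * pi * real m"
  have M: "M > 0" using k by (simp add: M_def)
  have x: "0 < x" "x < 1" using k by (auto simp: x_def)
  note root = root_of_unity_facts[OF k, folded x_def, folded \<omega>_def]
  define q where "q = (\<lambda>u. \<omega> * complex_of_real (exp (- u / real m)))"
  define K where "K = (\<lambda>u. q u / (1 - q u) - \<omega> / (1 - \<omega>))"
  let ?J = "Complex (pi / (2 * cos (pi * s / 2))) (pi / (2 * sin (pi * s / 2)))"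
  let ?J' = "Complex (pi / (2 * cos (pi * s / 2))) (- (pi / (2 * sin (pi * s / 2))))"
  have "\<forall>r\<in>{1..m}. \<exists>b. (\<forall>s::real. -1 < s \<longrightarrow> s < 0 \<longrightarrow>
       has_mellin (\<lambda>u. complex_of_real (hurwitz_kernel (real r / real m) u) - 1 / complex_of_real u - b) (complex_of_real s)
         (Gamma (complex_of_real s) * hurwitz_zeta (complex_of_real s) (real r / real m))) \<and>
       ((\<lambda>u. complex_of_real (hurwitz_kernel (real r / real m) u) - 1 / complex_of_real u - b) \<longlongrightarrow> 0) (at_right 0)"
    using k by (intro ballI has_mellin_hurwitz_zeta) auto
  then obtain b where b: "\<And>r. r \<in> {1..m} \<Longrightarrow>
       has_mellin (\<lambda>u. complex_of_real (hurwitz_kernel (real r / real m) u) - 1 / complex_of_real u - b r) (complex_of_real s)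
         (Gamma (complex_of_real s) * hurwitz_zeta (complex_of_real s) (real r / real m))"
     "\<And>r. r \<in> {1..m} \<Longrightarrow> ((\<lambda>u. complex_of_real (hurwitz_kernel (real r / real m) u) - 1 / complex_of_real u - b r) \<longlongrightarrow> 0) (at_right 0)"
    unfolding bchoice_iff using s by blast
  define B where "B = (\<Sum>r=1..m. \<omega> ^ r * b r)"
  let ?L = "\<lambda>u. \<Sum>r=1..m. \<omega> ^ r * (complex_of_real (hurwitz_kernel (real r / real m) u) - 1 / complex_of_real u - b r)"
  have comb: "?L u = q u / (1 - q u) - B" if u: "u > 0" for u
  proof -
    have "?L u = (\<Sum>r=1..m. \<omega> ^ r * complex_of_real (hurwitz_kernel (real r / real m) u))
        - (\<Sum>r=1..m. \<omega> ^ r) * (1 / complex_of_real u) - B"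
      by (simp only: right_diff_distrib sum_subtractf B_def sum_distrib_right)
    also have "\<dots> = q u / (1 - q u) - B"
      using geometric_hurwitz_kernel[of m \<omega> u] root u k unfolding q_def by simp
    finally show ?thesis .
  qed
  \<comment> \<open>Each summand tends to 0 while q/(1 - q) tends to
    \<open>\<omega> / (1 - \<omega>)\<close>; this determines \<open>B\<close> without the
    individual \<open>b r\<close>.\<close>
  have "(?L \<longlongrightarrow> (\<Sum>r=1..m. \<omega> ^ r * 0)) (at_right 0)"
    by (intro tendsto_sum tendsto_mult tendsto_const b(2))
  hence "(?L \<longlongrightarrow> 0) (at_right 0)" by simp
  hence "((\<lambda>u. q u / (1 - q u) - B) \<longlongrightarrow> 0) (at_right 0)"
    by (rule Lim_transform_eventually) (use comb in \<open>auto simp: eventually_at_right_less eventually_at_filter\<close>)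
  moreover have "((\<lambda>u. q u / (1 - q u) - B) \<longlongrightarrow> \<omega> * complex_of_real (exp (- 0 / real m)) / (1 - \<omega> * complex_of_real (exp (- 0 / real m))) - B) (at_right 0)"
    unfolding q_def using root(2) k by (intro tendsto_intros) auto
  ultimately have "0 = \<omega> * complex_of_real (exp (- 0 / real m)) / (1 - \<omega> * complex_of_real (exp (- 0 / real m))) - B"
    by (rule tendsto_unique[rotated]) simp
  hence B: "B = \<omega> / (1 - \<omega>)" by simp
  have "has_mellin ?L (complex_of_real s) (\<Sum>r=1..m. \<omega> ^ r * (Gamma (complex_of_real s) * hurwitz_zeta (complex_of_real s) (real r / real m)))"
    by (intro has_mellin_sum has_mellin_cmult b(1)) auto
  hence left: "has_mellin K (complex_of_real s) (\<Sum>r=1..m. \<omega> ^ r * (Gamma (complex_of_real s) * hurwitz_zeta (complex_of_real s) (real r / real m)))"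
    by (rule has_mellin_cong[THEN iffD1, rotated]) (use comb in \<open>simp add: K_def B\<close>)

  let ?\<phi> = "\<lambda>u. complex_of_real u / (1 + \<i> * complex_of_real u)"
  let ?\<psi> = "\<lambda>u. complex_of_real u / (1 - \<i> * complex_of_real u)"
  have bd: "norm (?\<phi> t) \<le> t" "norm (?\<psi> t) \<le> t" if "t > 0" for t :: real
  proof -
    have "1 \<le> norm (1 + \<i> * complex_of_real t)" "1 \<le> norm (1 - \<i> * complex_of_real t)"
      using complex_Re_le_cmod[of "1 + \<i> * complex_of_real t"] complex_Re_le_cmod[of "1 - \<i> * complex_of_real t"] by auto
    thus "norm (?\<phi> t) \<le> t" "norm (?\<psi> t) \<le> t"
      using that by (auto simp: norm_divide divide_le_eq intro!: order.trans[OF _ mult_left_mono[of 1]])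
  qed
  have x': "1 - x > 0" using x by simp
  note h1 = has_mellin_half_series[OF x(1) M s(2) has_mellin_cauchy_kernel(1)[OF s] bd(1)]
  note h2 = has_mellin_half_series[OF x' M s(2) has_mellin_cauchy_kernel(2)[OF s] bd(2)]
  have right: "has_mellin K (complex_of_real s)
     (?J * complex_of_real (M powr s / (2 * pi)) * (\<Sum>n. complex_of_real (real n + x) powr (complex_of_real s - 1)) +
      ?J' * complex_of_real (M powr s / (2 * pi)) * (\<Sum>n. complex_of_real (real n + (1 - x)) powr (complex_of_real s - 1)))"
  proof (rule has_mellin_cong[THEN iffD1, OF _ has_mellin_add[OF h1(1) h2(1)]])
    fix u :: real assume u: "u > 0"
    have yu: "u / M > 0" using u M by simp
    \<comment> \<open>With M = 2 pi m, damping by exp(-u/m) amounts to moving x up to x + i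
      u/M.\<close>
    have qz: "q u = exp (2 * of_real pi * \<i> * (complex_of_real x + \<i> * complex_of_real (u / M)))"
    proof -
      have "2 * of_real pi * \<i> * (complex_of_real x + \<i> * complex_of_real (u / M)) =
          2 * of_real pi * \<i> * complex_of_real x + complex_of_real (- u / real m)"
        using k by (simp add: M_def field_simps)
      thus ?thesis by (simp only: q_def \<omega>_def exp_add exp_of_real)
    qed
    have dd: "u / (M * a) = u / M / a" for a by simp
    have "(\<lambda>n. ?\<phi> (u / (M * (real n + x))) / complex_of_real (2 * pi * (real n + x))
             + ?\<psi> (u / (M * (real n + (1 - x)))) / complex_of_real (2 * pi * (real n + (1 - x)))) sums K u"
      using geometric_kernel_partial_fractions[OF x yu] unfolding dd K_def qz \<omega>_def .
    hence "K u = (\<Sum>n. ?\<phi> (u / (M * (real n + x))) / complex_of_real (2 * pi * (real n + x))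
             + ?\<psi> (u / (M * (real n + (1 - x)))) / complex_of_real (2 * pi * (real n + (1 - x))))"
      by (rule sums_unique)
    also have "\<dots> = (\<Sum>n. ?\<phi> (u / (M * (real n + x))) / complex_of_real (2 * pi * (real n + x)))
             + (\<Sum>n. ?\<psi> (u / (M * (real n + (1 - x)))) / complex_of_real (2 * pi * (real n + (1 - x))))"
      by (rule suminf_add[symmetric, OF h1(2)[OF _ u] h2(2)[OF _ u]])
    finally show "(\<Sum>n. ?\<phi> (u / (M * (real n + x))) / complex_of_real (2 * pi * (real n + x)))
             + (\<Sum>n. ?\<psi> (u / (M * (real n + (1 - x)))) / complex_of_real (2 * pi * (real n + (1 - x)))) = K u"
      by (rule sym)
  qed
  have z: "hurwitz_zeta (1 - complex_of_real s) v = (\<Sum>n. complex_of_real (real n + v) powr (complex_of_real s - 1))"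
    if "v > 0" for v
    using hurwitz_zeta_series[OF that, of "1 - complex_of_real s"] s by simp
  have "Gamma (complex_of_real s) * (\<Sum>r=1..m. \<omega> ^ r * hurwitz_zeta (complex_of_real s) (real r / real m)) =
      (\<Sum>r=1..m. \<omega> ^ r * (Gamma (complex_of_real s) * hurwitz_zeta (complex_of_real s) (real r / real m)))"
    by (simp add: sum_distrib_left mult_ac)
  also have "\<dots> = ?J * complex_of_real (M powr s / (2 * pi)) * hurwitz_zeta (1 - complex_of_real s) x +
      ?J' * complex_of_real (M powr s / (2 * pi)) * hurwitz_zeta (1 - complex_of_real s) (1 - x)"
    using has_mellin_unique[OF left right] z[OF x(1)] z[OF x'] by (simp only:)
  also have "\<dots> = complex_of_real (M powr s / (2 * pi)) * (?J * hurwitz_zeta (1 - complex_of_real s) x +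
      ?J' * hurwitz_zeta (1 - complex_of_real s) (1 - x))"
    by (simp only: distrib_left mult_ac)
  finally show ?thesis by (simp only: M_def)
qed

section \<open>Values at zero\<close>

lemma summable_complex_powr_shift:
  assumes "Re s > 1" "v > 0"
  shows "summable (\<lambda>n. complex_of_real (real n + v) powr (- s))"
proof (rule summable_norm_cancel)
  have "norm (complex_of_real (real n + v) powr (- s)) = (real n + v) powr (- Re s)" for n
    using assms by (subst norm_powr_real_powr) auto
  thus "summable (\<lambda>n. norm (complex_of_real (real n + v) powr (- s)))"
    using summable_powr_shift[of "- Re s" v] assms by simp
qed

text \<open>With F the remainder of the first-order Taylor expansion at N, the linear terms cancel
  and F(x) - x F(1) is left, hence the factor 2. Interpolation gains two orders of decay, and N^(-Re
  s - 2) is summable over the integers for Re s > -1.\<close>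

lemma powr_interpolation_error:
  fixes s :: complex
  assumes N: "N \<ge> 1" and x: "0 \<le> x" "x \<le> 1" and s: "Re s > -1"
  shows "norm (complex_of_real (N + x) powr (- s) - complex_of_real N powr (- s)
            - complex_of_real x * (complex_of_real (N + 1) powr (- s) - complex_of_real N powr (- s)))
         \<le> 2 * (norm s * (norm s + 1) * N powr (- Re s - 2))"
proof -
  define f where "f = (\<lambda>(i::nat) z. if i = 0 then (of_real N + z) powr (- s) else
      if i = 1 then - s * (of_real N + z) powr (- s - 1) else s * (s + 1) * (of_real N + z) powr (- s - 2))"
  define B where "B = norm s * (norm s + 1) * N powr (- Re s - 2)"
  have B: "B \<ge> 0" by (simp add: B_def)
  have S: "\<exists>t. z = of_real t \<and> 0 \<le> t \<and> t \<le> 1" if z: "z \<in> closed_segment 0 (1::complex)" for z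
  proof -
    obtain u where "0 \<le> u" "u \<le> 1" "z = (1 - u) *\<^sub>R 0 + u *\<^sub>R 1"
      using z unfolding closed_segment_def by blast
    thus ?thesis by (intro exI[of _ u]) (simp add: scaleR_conv_of_real)
  qed
  have d: "(f i has_field_derivative f (Suc i) z) (at z within closed_segment 0 1)"
    if z: "z \<in> closed_segment 0 1" and i: "i \<le> 1" for i z
  proof -
    obtain t where t: "z = of_real t" "0 \<le> t" "t \<le> 1" using S[OF z] by blast
    have np: "of_real N + z \<notin> \<real>\<^sub>\<le>\<^sub>0"
      using t N by (auto simp: complex_nonpos_Reals_iff)
    from i consider "i = 0" | "i = 1" by (cases i) auto
    thus ?thesis
    proof cases
      case 1
      have "((\<lambda>z. (of_real N + z) powr (- s)) has_field_derivative (- s * (of_real N + z) powr (- s - 1))) (at z)"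
        using np by (auto intro!: derivative_eq_intros)
      hence "(f 0 has_field_derivative f 1 z) (at z)" by (simp add: f_def)
      thus ?thesis using 1 by (simp add: has_field_derivative_at_within)
    next
      case 2
      have "((\<lambda>z. - s * (of_real N + z) powr (- s - 1)) has_field_derivative
              (- s * ((- s - 1) * (of_real N + z) powr (- s - 1 - 1)))) (at z)"
        using np by (auto intro!: derivative_eq_intros)
      also have "- s * ((- s - 1) * (of_real N + z) powr (- s - 1 - 1)) = s * (s + 1) * (of_real N + z) powr (- s - 2)"
        by (simp add: algebra_simps)
      finally have "(f 1 has_field_derivative f 2 z) (at z)" by (simp add: f_def)
      thus ?thesis using 2 by (simp add: has_field_derivative_at_within numeral_2_eq_2)
    qed
  qed
  have bd: "norm (f (Suc 1) z) \<le> B" if z: "z \<in> closed_segment 0 1" for z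
  proof -
    obtain t where t: "z = of_real t" "0 \<le> t" "t \<le> 1" using S[OF z] by blast
    have "norm (f (Suc 1) z) = norm s * norm (s + 1) * norm (complex_of_real (N + t) powr (- s - 2))"
      by (simp add: f_def t norm_mult)
    also have "norm (complex_of_real (N + t) powr (- s - 2)) = (N + t) powr (- Re s - 2)"
      using N t by (subst norm_powr_real_powr) auto
    also have "norm s * norm (s + 1) * (N + t) powr (- Re s - 2) \<le> B"
      unfolding B_def using N t s norm_triangle_ineq[of s 1]
      by (intro mult_mono mult_nonneg_nonneg powr_mono2') auto
    finally show ?thesis .
  qed
  have T: "norm (f 0 z - (f 0 0 + f 1 0 * z)) \<le> B" if z: "z \<in> closed_segment 0 1" for z
  proof -
    obtain t where t: "z = of_real t" "0 \<le> t" "t \<le> 1" using S[OF z] by blast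
    have "norm (f 0 z - (\<Sum>i\<le>1. f i 0 * (z - 0) ^ i / fact i)) \<le> B * norm (z - 0) ^ Suc 1 / fact 1"
      by (rule complex_Taylor[OF convex_closed_segment d bd]) (use z in auto)
    also have "\<dots> \<le> B" using B t mult_left_le[of "t * t" B] mult_le_one[of t t] by (simp add: power2_eq_square)
    finally show ?thesis by simp
  qed
  have "of_real x \<in> closed_segment 0 (1::complex)"
    unfolding closed_segment_def using x by (auto intro!: exI[of _ x] simp: scaleR_conv_of_real)
  hence Tx: "norm (f 0 (of_real x) - (f 0 0 + f 1 0 * of_real x)) \<le> B" by (rule T)
  have T1: "norm (f 0 1 - (f 0 0 + f 1 0 * 1)) \<le> B" by (rule T) simp
  have "complex_of_real (N + x) powr (- s) - complex_of_real N powr (- s)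
            - complex_of_real x * (complex_of_real (N + 1) powr (- s) - complex_of_real N powr (- s)) =
        (f 0 (of_real x) - (f 0 0 + f 1 0 * of_real x)) - of_real x * (f 0 1 - (f 0 0 + f 1 0 * 1))"
    by (simp add: f_def algebra_simps)
  also have "norm \<dots> \<le> norm (f 0 (of_real x) - (f 0 0 + f 1 0 * of_real x)) + norm (of_real x * (f 0 1 - (f 0 0 + f 1 0 * 1)))"
    by (rule norm_triangle_ineq4)
  also have "\<dots> \<le> B + x * B"
    using Tx mult_left_mono[OF T1 x(1)] x unfolding norm_mult norm_of_real by (intro add_mono) simp_all
  also have "\<dots> \<le> 2 * B" using B x by (simp add: mult_left_le_one_le)
  finally show ?thesis by (simp only: B_def)
qed

text \<open>Euler's limit for ln Gamma as a series, in the shape taken at s = 0 by the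
  differentiated interpolation errors below.\<close>

lemma ln_Gamma_sums:
  fixes x :: real
  assumes x: "x > 0"
  shows "(\<lambda>n. - ln (real n + 1 + x) + ln (real n + 1) + x * (ln (real n + 2) - ln (real n + 1))) sums (ln (Gamma x) + ln x)"
proof -
  have "ln_Gamma_series x \<longlonglongrightarrow> ln_Gamma x" using x by (rule ln_Gamma_real_LIMSEQ)
  moreover have "ln_Gamma x = ln (Gamma x)" using x by (simp add: Gamma_real_pos_exp)
  \<comment> \<open>Telescoping produces ln(n + 1), whereas \<open>ln_Gamma_series\<close> contains
    ln n; the correction x ln((n + 1)/n) tends to 0.\<close>
  moreover have "(\<lambda>n. ln (real (Suc n) / real n)) \<longlonglongrightarrow> ln 1"
    by (rule tendsto_ln[OF LIMSEQ_Suc_n_over_n]) simp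
  ultimately have "(\<lambda>n. ln_Gamma_series x n + ln x + x * ln (real (Suc n) / real n)) \<longlonglongrightarrow> ln (Gamma x) + ln x + x * ln 1"
    by (intro tendsto_add tendsto_mult tendsto_const) (simp_all only:)
  moreover have "eventually (\<lambda>n. ln_Gamma_series x n + ln x + x * ln (real (Suc n) / real n) =
      (\<Sum>j<n. - ln (real j + 1 + x) + ln (real j + 1) + x * (ln (real j + 2) - ln (real j + 1)))) sequentially"
    using eventually_gt_at_top[of 0]
  proof eventually_elim
    case (elim n)
    have 1: "(\<Sum>k=1..n. ln (x / real k + 1)) = (\<Sum>j<n. ln (real j + 1 + x) - ln (real j + 1))"
    proof (rule sum.reindex_bij_witness[of _ Suc "\<lambda>k. k - 1"])
      fix k assume k: "k \<in> {1..n}"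
      hence "x / real k + 1 = (real k + x) / real k" by (simp add: field_simps)
      thus "ln (real (k - 1) + 1 + x) - ln (real (k - 1) + 1) = ln (x / real k + 1)"
        using k x by (simp add: ln_div of_nat_diff)
    qed auto
    have 2: "(\<Sum>j<n. ln (real j + 2) - ln (real j + 1)) = ln (real n + 1)"
      using sum_lessThan_telescope[of "\<lambda>j. ln (real j + 1)" n] by (simp add: add_ac)
    have "(\<Sum>j<n. - ln (real j + 1 + x) + ln (real j + 1) + x * (ln (real j + 2) - ln (real j + 1))) =
        - (\<Sum>j<n. ln (real j + 1 + x) - ln (real j + 1)) + x * (\<Sum>j<n. ln (real j + 2) - ln (real j + 1))"
      by (simp add: sum.distrib sum_subtractf sum_negf flip: sum_distrib_left)
    also have "\<dots> = - (\<Sum>k=1..n. ln (x / real k + 1)) + x * ln (real n + 1)" by (simp only: 1 2)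
    finally show ?case using elim by (simp add: ln_Gamma_series_def ln_div algebra_simps)
  qed
  ultimately show ?thesis unfolding sums_def by (simp add: tendsto_cong)
qed

text \<open>Subtract from (n + 1 + x)^(-s) - (n + 1)^(-s) its interpolant x((n + 2)^(-s) - (n +
  1)^(-s)). For Re s > 1 the interpolants telescope to -x, and the errors remain summable for Re s >
  -1, so value and derivative at 0 can be taken termwise.\<close>

lemma hurwitz_regular_diff:
  assumes x: "0 < x" "x \<le> 1"
  shows "hurwitz_regular x 0 - hurwitz_regular 1 0 = of_real (1 - x)"
    and "deriv (hurwitz_regular x) 0 - deriv (hurwitz_regular 1) 0 = of_real (ln (Gamma x))"
proof -
  define D where "D = {s::complex. Re s > -1}"
  have D: "open D" "connected D" "0 \<in> D"
    by (auto simp: D_def open_halfspace_Re_gt convex_halfspace_Re_gt convex_connected)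
  define p where "p = (\<lambda>a s. complex_of_real a powr (- s))"
  have dp: "(p a has_field_derivative - complex_of_real (ln a) * p a s) (at s)" if "a > 0" for a s
  proof -
    have pe: "p a = (\<lambda>s. exp (- s * complex_of_real (ln a)))"
      using that by (auto simp: p_def powr_def Ln_of_real)
    show ?thesis unfolding pe by (auto intro!: derivative_eq_intros)
  qed
  define f where "f = (\<lambda>n s. p (real n + 1 + x) s - p (real n + 1) s - of_real x * (p (real n + 1 + 1) s - p (real n + 1) s))"
  define f' where "f' = (\<lambda>n s. - complex_of_real (ln (real n + 1 + x)) * p (real n + 1 + x) s
      - - complex_of_real (ln (real n + 1)) * p (real n + 1) s
      - of_real x * (- complex_of_real (ln (real n + 1 + 1)) * p (real n + 1 + 1) s
         - - complex_of_real (ln (real n + 1)) * p (real n + 1) s))"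
  have df: "(f n has_field_derivative f' n s) (at s)" for n s
    unfolding f_def f'_def using x by (intro DERIV_diff DERIV_cmult dp) auto
  have bound: "\<exists>d h. 0 < d \<and> summable h \<and> (\<forall>\<^sub>F n in sequentially. \<forall>s\<in>ball s0 d \<inter> D. norm (f n s) \<le> h n)"
    if s0: "s0 \<in> D" for s0
  proof -
    \<comment> \<open>Half the distance to the line Re s = -1 keeps a whole neighbourhood uniformly
      to its right.\<close>
    define d where "d = (Re s0 + 1) / 2"
    define R where "R = norm s0 + d"
    define \<sigma> where "\<sigma> = Re s0 - d"
    have d: "d > 0" "\<sigma> > -1" using s0 by (auto simp: D_def d_def \<sigma>_def field_simps)
    have h: "summable (\<lambda>n. 2 * (R * (R + 1)) * (real n + 1) powr (- \<sigma> - 2))"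
      by (intro summable_mult summable_powr_shift) (use d in auto)
    have "norm (f n s) \<le> 2 * (R * (R + 1)) * (real n + 1) powr (- \<sigma> - 2)" if s: "s \<in> ball s0 d \<inter> D" for n s
    proof -
      have "norm (s0 - s) < d" using s by (simp add: dist_norm)
      hence "norm s \<le> R" "Re s \<ge> \<sigma>"
        using norm_triangle_ineq3[of s s0] complex_Re_le_cmod[of "s0 - s"]
        by (auto simp: R_def \<sigma>_def norm_minus_commute)
      have "norm (f n s) \<le> 2 * (norm s * (norm s + 1) * (real n + 1) powr (- Re s - 2))"
        unfolding f_def p_def using powr_interpolation_error[of "real n + 1" x s] x s by (simp add: D_def)
      also have "\<dots> \<le> 2 * (R * (R + 1) * (real n + 1) powr (- \<sigma> - 2))"
        using \<open>norm s \<le> R\<close> \<open>Re s \<ge> \<sigma>\<close> order.trans[OF norm_ge_zero \<open>norm s \<le> R\<close>]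
        by (intro mult_left_mono mult_mono powr_mono mult_nonneg_nonneg) (auto intro: order.trans)
      finally show ?thesis by (simp add: mult.assoc)
    qed
    thus ?thesis using d h by (intro exI[of _ d] exI[of _ "\<lambda>n. 2 * (R * (R + 1)) * (real n + 1) powr (- \<sigma> - 2)"]) auto
  qed
  obtain g g' where g: "\<And>s. s \<in> D \<Longrightarrow> (\<lambda>n. f n s) sums g s" "\<And>s. s \<in> D \<Longrightarrow> (\<lambda>n. f' n s) sums g' s"
      "\<And>s. s \<in> D \<Longrightarrow> (g has_field_derivative g' s) (at s)"
    using series_and_derivative_comparison_local[OF D(1) df bound] by blast
  \<comment> \<open>Puts back the initial term x^(-s), omitted by the index shift, and the
    telescoped -x.\<close>
  define G where "G = (\<lambda>s. p x s - of_real x + g s)"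
  have dG: "(G has_field_derivative (- complex_of_real (ln x) * p x s + g' s)) (at s)" if "s \<in> D" for s
    unfolding G_def using dp[OF x(1), of s] g(3)[OF that] by (auto intro!: derivative_eq_intros)
  hence holG: "G holomorphic_on D"
    using D(1) by (auto simp: holomorphic_on_open)
  have holR: "hurwitz_regular v holomorphic_on A" if "v > 0" for v A
    using hurwitz_regular_holomorphic[OF that] holomorphic_on_subset by blast
  have eq: "hurwitz_regular x s - hurwitz_regular 1 s = G s" if "s \<in> D" for s
  proof (rule analytic_continuation_open[where s = "{s. Re s > 1}" and s' = D
        and f = "\<lambda>s. hurwitz_regular x s - hurwitz_regular 1 s" and g = G])
    have "(2::complex) \<in> {s. Re s > 1}" by simp
    thus "{s::complex. Re s > 1} \<noteq> {}" by blast
    show "(\<lambda>s. hurwitz_regular x s - hurwitz_regular 1 s) holomorphic_on D"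
      using x by (intro holomorphic_intros holR) auto
    fix s :: complex assume "s \<in> {s. Re s > 1}"
    hence s: "Re s > 1" by simp
    hence s1: "s \<noteq> 1" by auto
    have sm: "summable (\<lambda>n. p (real n + v) s)" if "v > 0" for v
      unfolding p_def using summable_complex_powr_shift[OF s that] .
    have z: "hurwitz_zeta s v = (\<Sum>n. p (real n + v) s)" if "v > 0" for v
      unfolding p_def by (rule hurwitz_zeta_series[OF that s])
    have sh: "(\<lambda>n. p (real n + 1 + v) s) sums (hurwitz_zeta s v - p v s)" if "v > 0" for v
    proof -
      have "(\<lambda>n. p (real n + v) s) sums hurwitz_zeta s v" unfolding z[OF that] by (rule summable_sums[OF sm[OF that]])
      hence "(\<lambda>n. p (real (Suc n) + v) s) sums (hurwitz_zeta s v - p (real 0 + v) s)"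
        by (subst sums_Suc_iff) simp
      thus ?thesis by (simp add: add_ac)
    qed
    have s0: "(\<lambda>n. p (real n + 1) s) sums hurwitz_zeta s 1"
      unfolding z[OF zero_less_one] by (rule summable_sums[OF sm]) simp
    have "(\<lambda>n. f n s) sums ((hurwitz_zeta s x - p x s) - hurwitz_zeta s 1 - of_real x * ((hurwitz_zeta s 1 - p 1 s) - hurwitz_zeta s 1))"
      unfolding f_def by (intro sums_diff sums_mult sh s0 x) auto
    moreover have "(\<lambda>n. f n s) sums g s" using s by (intro g) (simp add: D_def)
    ultimately have "g s = (hurwitz_zeta s x - p x s) - hurwitz_zeta s 1 - of_real x * ((hurwitz_zeta s 1 - p 1 s) - hurwitz_zeta s 1)"
      by (rule sums_unique2[symmetric])
    also have "p 1 s = 1" by (simp add: p_def)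
    finally show "hurwitz_regular x s - hurwitz_regular 1 s = G s"
      using hurwitz_zeta_conv_regular[OF x(1) s1] hurwitz_zeta_conv_regular[OF zero_less_one s1]
      by (simp add: G_def algebra_simps)
  qed (use D that holG in \<open>auto simp: open_halfspace_Re_gt D_def\<close>)
  have p0: "p a 0 = 1" if "a > 0" for a using that by (simp add: p_def)
  have "(\<lambda>n. f n 0) sums g 0" by (rule g(1)[OF D(3)])
  \<comment> \<open>All powers are 1 at s = 0.\<close>
  moreover have "f n 0 = 0" for n using x by (simp add: f_def p0)
  ultimately have "g 0 = 0" by (simp add: sums_iff)
  thus "hurwitz_regular x 0 - hurwitz_regular 1 0 = of_real (1 - x)"
    unfolding eq[OF D(3)] by (simp add: G_def p0 x)
  have f'0: "f' n 0 = complex_of_real (- ln (real n + 1 + x) + ln (real n + 1) + x * (ln (real n + 2) - ln (real n + 1)))" for n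
    using x by (simp add: f'_def p0 add_ac algebra_simps)
  have "(\<lambda>n. f' n 0) sums complex_of_real (ln (Gamma x) + ln x)"
    unfolding f'0 by (rule sums_of_real[OF ln_Gamma_sums[OF x(1)]])
  hence "g' 0 = complex_of_real (ln (Gamma x) + ln x)"
    using g(2)[OF D(3)] sums_unique2 by blast
  hence "(G has_field_derivative complex_of_real (ln (Gamma x))) (at 0)"
    using dG[OF D(3)] x by (simp add: p0)
  moreover have "eventually (\<lambda>s. s \<in> D) (nhds 0)" using D by (intro eventually_nhds_in_open)
  hence "eventually (\<lambda>s. G s = hurwitz_regular x s - hurwitz_regular 1 s) (nhds 0)"
    by eventually_elim (simp add: eq)
  ultimately have "((\<lambda>s. hurwitz_regular x s - hurwitz_regular 1 s) has_field_derivative complex_of_real (ln (Gamma x))) (at 0)"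
    by (subst (asm) DERIV_cong_ev[OF refl _ refl]) auto
  moreover have "((\<lambda>s. hurwitz_regular x s - hurwitz_regular 1 s) has_field_derivative
      (deriv (hurwitz_regular x) 0 - deriv (hurwitz_regular 1) 0)) (at 0)"
    by (intro DERIV_diff holomorphic_derivI[OF holR[of _ UNIV]]) (use x in auto)
  ultimately show "deriv (hurwitz_regular x) 0 - deriv (hurwitz_regular 1) 0 = of_real (ln (Gamma x))"
    using DERIV_unique by blast
qed

text \<open>Differences in the parameter are known; the relation between parameters 1/2 and 1 fixes
  the absolute constants. They differ from those of zeta itself by the value -1 and the derivative
  -1 of 1/(s - 1) at 0.\<close>

lemma hurwitz_regular_at_0:
  assumes x: "0 < x" "x \<le> 1"
  shows "hurwitz_regular x 0 = of_real (3 / 2 - x)"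
    and "deriv (hurwitz_regular x) 0 = of_real (ln (Gamma x) + 1 - ln (2 * pi) / 2)"
proof -
  define A where "A = hurwitz_regular (1 / 2)"
  define B where "B = hurwitz_regular 1"
  have hol: "A holomorphic_on UNIV" "B holomorphic_on UNIV"
    unfolding A_def B_def by (auto intro!: hurwitz_regular_holomorphic)
  \<comment> \<open>Multiplication by s - 1 makes the relation an identity of entire functions,
    which can be evaluated at 0.\<close>
  have eq: "2 + (s - 1) * (A s + B s) = 2 powr s * (1 + (s - 1) * B s)" for s
  proof (rule analytic_continuation_open[where s = "{s. Re s > 1}" and s' = UNIV
        and f = "\<lambda>s. 2 + (s - 1) * (A s + B s)" and g = "\<lambda>s. 2 powr s * (1 + (s - 1) * B s)"])
    have "(2::complex) \<in> {s. Re s > 1}" by simp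
    thus "{s::complex. Re s > 1} \<noteq> {}" by blast
    fix s :: complex assume "s \<in> {s. Re s > 1}"
    hence s: "Re s > 1" by simp
    hence s1: "s \<noteq> 1" by auto
    let ?a = "\<lambda>n. complex_of_real (real n + 1) powr (- s)"
    have "?a sums hurwitz_zeta s 1"
      unfolding hurwitz_zeta_series[OF zero_less_one s] by (intro summable_sums summable_complex_powr_shift s) auto
    \<comment> \<open>Odd and even integers are paired; multiplied by 2^s, their powers become those
      of n + 1/2 and n + 1.\<close>
    from sums_group[OF this, of 2] have "(\<lambda>n. sum ?a {n * 2..<n * 2 + 2}) sums hurwitz_zeta s 1" by simp
    also have "(\<lambda>n. sum ?a {n * 2..<n * 2 + 2}) = (\<lambda>n. ?a (2 * n) + ?a (2 * n + 1))"
      by (simp add: numeral_2_eq_2 sum.atLeastLessThan_Suc mult.commute)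
    finally have 1: "(\<lambda>n. 2 powr s * (?a (2 * n) + ?a (2 * n + 1))) sums (2 powr s * hurwitz_zeta s 1)"
      by (rule sums_mult)
    have t: "2 powr s * ?a k = complex_of_real ((real k + 1) / 2) powr (- s)" for k
    proof -
      have "?a k = complex_of_real (2 * ((real k + 1) / 2)) powr (- s)"
        by (rule arg_cong[where f = "\<lambda>y. complex_of_real y powr (- s)"]) simp
      also have "\<dots> = complex_of_real 2 powr (- s) * complex_of_real ((real k + 1) / 2) powr (- s)"
        unfolding of_real_mult by (rule powr_times_real) auto
      finally show ?thesis by (simp flip: mult.assoc powr_add)
    qed
    have "2 powr s * (?a (2 * n) + ?a (2 * n + 1)) =
        complex_of_real (real n + 1 / 2) powr (- s) + complex_of_real (real n + 1) powr (- s)" for n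
    proof -
      have "(real (2 * n) + 1) / 2 = real n + 1 / 2" "(real (2 * n + 1) + 1) / 2 = real n + 1" by simp_all
      thus ?thesis unfolding distrib_left t by (simp only:)
    qed
    moreover have "(\<lambda>n. complex_of_real (real n + 1 / 2) powr (- s) + complex_of_real (real n + 1) powr (- s)) sums
        (hurwitz_zeta s (1 / 2) + hurwitz_zeta s 1)"
    proof (rule sums_add)
      show "(\<lambda>n. complex_of_real (real n + 1 / 2) powr (- s)) sums hurwitz_zeta s (1 / 2)"
        by (subst hurwitz_zeta_series) (auto intro!: summable_sums summable_complex_powr_shift s simp del: of_real_add)
      show "?a sums hurwitz_zeta s 1" by fact
    qed
    ultimately have "hurwitz_zeta s (1 / 2) + hurwitz_zeta s 1 = 2 powr s * hurwitz_zeta s 1"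
      using 1 sums_unique2 by simp
    hence "(s - 1) * (hurwitz_zeta s (1 / 2) + hurwitz_zeta s 1) = 2 powr s * ((s - 1) * hurwitz_zeta s 1)"
      by (simp add: mult_ac)
    moreover have "(s - 1) * hurwitz_zeta s (1 / 2) = 1 + (s - 1) * A s" "(s - 1) * hurwitz_zeta s 1 = 1 + (s - 1) * B s"
      using hurwitz_zeta_conv_regular[of "1 / 2" s] hurwitz_zeta_conv_regular[of 1 s] s1
      by (simp_all add: A_def B_def distrib_left)
    ultimately show "2 + (s - 1) * (A s + B s) = 2 powr s * (1 + (s - 1) * B s)"
      by (simp add: distrib_left)
  qed (auto intro!: holomorphic_intros hol simp: open_halfspace_Re_gt connected_UNIV)
  \<comment> \<open>At s = 0 the value \<open>B 0\<close> cancels, and so does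
    \<open>deriv B 0\<close> in the differentiated relation. The relation thus yields
    \<open>A\<close>, and the difference formula at 1/2 then yields \<open>B\<close>.\<close>
  have A0: "A 0 = 1" using eq[of 0] by simp
  have AB: "A 0 - B 0 = 1 / 2" "deriv A 0 - deriv B 0 = of_real (ln (Gamma (1 / 2)))"
    using hurwitz_regular_diff[of "1 / 2"] by (simp_all add: A_def B_def)
  have B0: "B 0 = 1 / 2" using A0 AB(1) by (simp add: field_simps)
  have dA: "(A has_field_derivative deriv A 0) (at 0)" and dB: "(B has_field_derivative deriv B 0) (at 0)"
    by (rule holomorphic_derivI[OF hol(1)] holomorphic_derivI[OF hol(2)]; simp)+
  have L2: "Ln 2 = complex_of_real (ln 2)" using Ln_of_real[of 2] by simp
  have "((\<lambda>s. 2 + (s - 1) * (A s + B s)) has_field_derivative (A 0 + B 0) - (deriv A 0 + deriv B 0)) (at 0)"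
    by (auto intro!: derivative_eq_intros dA dB)
  moreover have "((\<lambda>s. 2 powr s * (1 + (s - 1) * B s)) has_field_derivative
      of_real (ln 2) * (1 - B 0) + (B 0 - deriv B 0)) (at 0)"
    using L2 by (auto intro!: derivative_eq_intros dB)
  ultimately have "(A 0 + B 0) - (deriv A 0 + deriv B 0) = of_real (ln 2) * (1 - B 0) + (B 0 - deriv B 0)"
    unfolding eq using DERIV_unique by blast
  hence "2 * deriv A 0 = 2 * (1 - of_real (ln 2) / 2)" using A0 B0 by (simp add: algebra_simps)
  hence A': "deriv A 0 = 1 - of_real (ln 2) / 2" by (rule mult_left_cancel[THEN iffD1, rotated]) simp
  \<comment> \<open>Gamma(1/2) = sqrt(pi) contributes ln(pi)/2, which joins the ln(2)/2 above to
    ln(2 pi)/2.\<close>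
  have lG: "ln (Gamma (1 / 2 :: real)) = ln pi / 2"
    by (simp add: Gamma_one_half_real ln_sqrt)
  have "deriv B 0 = deriv A 0 - of_real (ln (Gamma (1 / 2)))" using AB(2) by (simp add: algebra_simps)
  also have "\<dots> = of_real (1 - ln 2 / 2 - ln pi / 2)" unfolding A' lG by simp
  also have "1 - ln 2 / 2 - ln pi / 2 = 1 - ln (2 * pi) / 2" by (simp add: ln_mult add_divide_distrib)
  finally have B': "deriv B 0 = of_real (1 - ln (2 * pi) / 2)" .
  show "hurwitz_regular x 0 = of_real (3 / 2 - x)"
    using hurwitz_regular_diff(1)[OF x] B0 by (simp add: B_def algebra_simps)
  show "deriv (hurwitz_regular x) 0 = of_real (ln (Gamma x) + 1 - ln (2 * pi) / 2)"
    using hurwitz_regular_diff(2)[OF x] B' by (simp add: B_def algebra_simps)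
qed

section \<open>The functional equation and its derivatives at one\<close>

lemma exp_root_power:
  "exp (2 * of_real pi * \<i> * complex_of_real (real k / real m)) ^ r =
     of_real (cos (2 * pi * real r * real k / real m)) + \<i> * of_real (sin (2 * pi * real r * real k / real m))"
proof -
  have "exp (2 * of_real pi * \<i> * complex_of_real (real k / real m)) ^ r =
      exp (of_nat r * (2 * of_real pi * \<i> * complex_of_real (real k / real m)))"
    by (simp only: exp_of_nat_mult)
  also have "of_nat r * (2 * of_real pi * \<i> * complex_of_real (real k / real m)) =
      \<i> * complex_of_real (2 * pi * real r * real k / real m)" by simp
  also have "exp \<dots> = cis (2 * pi * real r * real k / real m)" by (rule cis_conv_exp[symmetric])
  finally show ?thesis by (simp add: complex_eq_iff)
qed

text \<open>Passing from k to m - k conjugates the root of unity and exchanges x with 1 - x; sum and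
  difference of the two functional equations then isolate the cosine and sine parts.\<close>

lemma trig_complement:
  assumes "k < m"
  shows "cos (2 * pi * real r * real (m - k) / real m) = cos (2 * pi * real r * real k / real m)"
    and "sin (2 * pi * real r * real (m - k) / real m) = - sin (2 * pi * real r * real k / real m)"
proof -
  have "2 * pi * real r * real (m - k) / real m = of_int (int r) * (2 * pi) - 2 * pi * real r * real k / real m"
    using assms by (simp add: of_nat_diff field_simps)
  thus "cos (2 * pi * real r * real (m - k) / real m) = cos (2 * pi * real r * real k / real m)"
    "sin (2 * pi * real r * real (m - k) / real m) = - sin (2 * pi * real r * real k / real m)"
    using cos_int_2pin[of "int r"] sin_int_2pin[of "int r"] by (simp_all add: cos_diff sin_diff mult_ac)
qed

text \<open>Denominators are cleared so that both sides are entire. In the cosine part the poles of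
  the two zeta factors at s = 0 add up, hence the factor s and the -2; in the sine part they
  cancel.\<close>

lemma finite_functional_equation:
  assumes k: "0 < k" "k < m"
  defines "x \<equiv> real k / real m" and "\<theta> \<equiv> (\<lambda>r. 2 * pi * real r * real k / real m)"
  shows "4 * cos (of_real (pi / 2) * s) * (s * (\<Sum>r=1..m. of_real (cos (\<theta> r)) * hurwitz_regular (real r / real m) s)) =
           rGamma s * of_real (2 * pi * real m) powr s *
           (s * (hurwitz_regular x (1 - s) + hurwitz_regular (1 - x) (1 - s)) - 2)"
    and "4 * sin (of_real (pi / 2) * s) * (\<Sum>r=1..m. of_real (sin (\<theta> r)) * hurwitz_regular (real r / real m) s) =
           rGamma s * of_real (2 * pi * real m) powr s *
           (hurwitz_regular x (1 - s) - hurwitz_regular (1 - x) (1 - s))"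
proof -
  define C where "C = (\<lambda>s. \<Sum>r=1..m. of_real (cos (\<theta> r)) * hurwitz_regular (real r / real m) s)"
  define S where "S = (\<lambda>s. \<Sum>r=1..m. of_real (sin (\<theta> r)) * hurwitz_regular (real r / real m) s)"
  have x: "0 < x" "x < 1" using k by (auto simp: x_def)
  have M: "2 * pi * real m > 0" using k by simp
  have holR: "hurwitz_regular v holomorphic_on A" if "v > 0" for v A
    using hurwitz_regular_holomorphic[OF that] holomorphic_on_subset by blast
  have holC: "C holomorphic_on A" and holS: "S holomorphic_on A" for A
    unfolding C_def S_def using k by (auto intro!: holomorphic_intros holR)
  have holR': "(\<lambda>s. hurwitz_regular v (1 - s)) holomorphic_on A" if "v > 0" for v A
  proof -
    have "(\<lambda>s::complex. 1 - s) holomorphic_on A" by (intro holomorphic_intros)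
    from holomorphic_on_compose_gen[OF this holR[OF that, of UNIV]] show ?thesis by (simp add: o_def)
  qed
  \<comment> \<open>The polar parts have total weight 0, so zeta may be replaced by its regular
    part.\<close>
  have zsum: "(\<Sum>r=1..m. exp (2 * of_real pi * \<i> * of_real (real j / real m)) ^ r * hurwitz_zeta s (real r / real m)) =
      (\<Sum>r=1..m. exp (2 * of_real pi * \<i> * of_real (real j / real m)) ^ r * hurwitz_regular (real r / real m) s)"
    (is "?lhs = ?rhs") if j: "0 < j" "j < m" and s: "s \<noteq> 1" for j s
  proof -
    have "?lhs = (\<Sum>r=1..m. exp (2 * of_real pi * \<i> * of_real (real j / real m)) ^ r * (1 / (s - 1) + hurwitz_regular (real r / real m) s))"
      using k by (intro sum.cong refl) (simp add: hurwitz_zeta_conv_regular[OF _ s])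
    also have "\<dots> = (\<Sum>r=1..m. exp (2 * of_real pi * \<i> * of_real (real j / real m)) ^ r) * (1 / (s - 1)) + ?rhs"
      by (simp only: distrib_left sum.distrib sum_distrib_right)
    also have "\<dots> = ?rhs" using root_of_unity_facts(3)[OF j] by simp
    finally show ?thesis .
  qed
  have zk: "(\<Sum>r=1..m. exp (2 * of_real pi * \<i> * of_real (real k / real m)) ^ r * hurwitz_regular (real r / real m) s) = C s + \<i> * S s" for s
    unfolding exp_root_power C_def S_def \<theta>_def by (simp add: distrib_right sum.distrib sum_distrib_left mult.assoc)
  have zk': "(\<Sum>r=1..m. exp (2 * of_real pi * \<i> * of_real (real (m - k) / real m)) ^ r * hurwitz_regular (real r / real m) s) = C s - \<i> * S s" for s
    unfolding exp_root_power trig_complement[OF k(2)] C_def S_def \<theta>_def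
    by (simp add: left_diff_distrib sum_subtractf sum_distrib_left mult.assoc)
  \<comment> \<open>The real identity holds on this segment; its limit point -1/2 feeds the identity
    theorem.\<close>
  define X where "X = complex_of_real ` {-1<..<0}"
  have X: "complex_of_real (-1/2) islimpt X"
    unfolding islimpt_approachable
  proof (intro allI impI)
    fix e :: real assume e: "e > 0"
    define t where "t = - 1 / 2 + min (e / 2) (1 / 4)"
    have t: "- 1 < t" "t < 0" "t \<noteq> - 1 / 2" "\<bar>t - (- 1 / 2)\<bar> < e" using e by (auto simp: t_def min_def)
    have "dist (complex_of_real t) (complex_of_real (- 1 / 2)) = \<bar>t - (- 1 / 2)\<bar>"
      unfolding dist_norm of_real_diff[symmetric] norm_of_real ..
    moreover have "complex_of_real t \<noteq> complex_of_real (- 1 / 2)" using t(3) by (simp only: of_real_eq_iff simp_thms)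
    moreover have "complex_of_real t \<in> X" unfolding X_def using t(1,2) by (intro imageI) simp
    ultimately show "\<exists>x'\<in>X. x' \<noteq> complex_of_real (- 1 / 2) \<and> dist x' (complex_of_real (- 1 / 2)) < e"
      using t(4) by (intro bexI[of _ "complex_of_real t"]) (simp_all only: simp_thms)
  qed
  have real_eq: "4 * cos (of_real (pi / 2) * s) * C s = rGamma s * of_real (2 * pi * real m) powr s *
          (hurwitz_zeta (1 - s) x + hurwitz_zeta (1 - s) (1 - x))"
      "4 * sin (of_real (pi / 2) * s) * S s = rGamma s * of_real (2 * pi * real m) powr s *
          (hurwitz_zeta (1 - s) x - hurwitz_zeta (1 - s) (1 - x))" if sX: "s \<in> X" for s
  proof -
    obtain t where t: "s = of_real t" "-1 < t" "t < 0" using sX by (auto simp: X_def)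
    have s1: "complex_of_real t \<noteq> 1"
      using t by (metis of_real_1 of_real_eq_iff not_one_less_zero)
    define c where "c = cos (pi * t / 2)"
    define d where "d = sin (pi * t / 2)"
    \<comment> \<open>Here pi t/2 lies strictly between -pi/2 and 0, so neither trigonometric
      denominator vanishes.\<close>
    have "pi * (- 1) < pi * t" "pi * t < pi * 0" using t by (intro mult_strict_left_mono; simp)+
    hence "0 < - (pi * t / 2)" "- (pi * t / 2) < pi / 2" by simp_all
    hence "cos (- (pi * t / 2)) > 0" "sin (- (pi * t / 2)) > 0"
      by (intro cos_gt_zero_pi sin_gt_zero; linarith)+
    hence cd: "c > 0" "d < 0" by (simp_all add: c_def d_def)
    have cs: "cos (of_real (pi / 2) * s) = complex_of_real c" "sin (of_real (pi / 2) * s) = complex_of_real d"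
      unfolding t c_def d_def by (simp_all flip: cos_of_real sin_of_real)
    have G: "rGamma s * Gamma s = 1"
    proof -
      have "s \<notin> \<int>\<^sub>\<le>\<^sub>0"
      proof
        assume "s \<in> \<int>\<^sub>\<le>\<^sub>0"
        then obtain n :: nat where "complex_of_real t = - of_nat n" unfolding t by (auto elim!: nonpos_Ints_cases')
        hence "t = - real n" by (metis of_real_eq_iff of_real_minus of_real_of_nat_eq)
        with t show False by (cases n) auto
      qed
      thus ?thesis by (simp add: rGamma_inverse_Gamma Gamma_eq_zero_iff)
    qed
    define h where "h = hurwitz_zeta (1 - s) x"
    define h' where "h' = hurwitz_zeta (1 - s) (1 - x)"
    define P where "P = (2 * pi * real m) powr t"
    have P: "complex_of_real (2 * pi * real m) powr s = of_real P"
      unfolding t P_def using powr_of_real[of "2 * pi * real m" t] M by simp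
    have x': "real (m - k) / real m = 1 - x" using k by (simp add: x_def of_nat_diff field_simps)
    have J: "Complex (pi / (2 * c)) (pi / (2 * d)) = of_real (pi / (2 * c)) + \<i> * of_real (pi / (2 * d))"
      "Complex (pi / (2 * c)) (- (pi / (2 * d))) = of_real (pi / (2 * c)) - \<i> * of_real (pi / (2 * d))"
      by (simp_all add: complex_eq_iff)
    have e1: "Gamma s * (C s + \<i> * S s) = of_real (P / (2 * pi)) *
        ((of_real (pi / (2 * c)) + \<i> * of_real (pi / (2 * d))) * h + (of_real (pi / (2 * c)) - \<i> * of_real (pi / (2 * d))) * h')"
      using finite_functional_equation_real[OF k t(2,3)]
      unfolding zsum[OF k s1] unfolding t(1)[symmetric] zk unfolding x_def[symmetric] c_def[symmetric] d_def[symmetric] J P_def[symmetric] t(1)[symmetric]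
        h_def[symmetric] h'_def[symmetric] .
    have mk: "0 < m - k" "m - k < m" using k by auto
    have e2: "Gamma s * (C s - \<i> * S s) = of_real (P / (2 * pi)) *
        ((of_real (pi / (2 * c)) + \<i> * of_real (pi / (2 * d))) * h' + (of_real (pi / (2 * c)) - \<i> * of_real (pi / (2 * d))) * h)"
      using finite_functional_equation_real[OF mk t(2,3)]
      unfolding zsum[OF mk s1] unfolding t(1)[symmetric] zk' unfolding x' c_def[symmetric] d_def[symmetric] J P_def[symmetric] t(1)[symmetric]
        diff_diff_eq2 add_diff_cancel_left'
        h_def[symmetric] h'_def[symmetric] .
    \<comment> \<open>\<open>h\<close> and \<open>h'\<close> trade places under k -> m - k: adding
      keeps the coefficient with the cosine, subtracting the one with the sine.\<close>
    have alg: "a * ((b + \<i> * d) * h + (b - \<i> * d) * h') + a * ((b + \<i> * d) * h' + (b - \<i> * d) * h) = 2 * (a * b * (h + h'))"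
      "a * ((b + \<i> * d) * h + (b - \<i> * d) * h') - a * ((b + \<i> * d) * h' + (b - \<i> * d) * h) = 2 * \<i> * (a * d * (h - h'))"
      for a b d h h' :: complex by (simp_all add: algebra_simps)
    have "2 * (Gamma s * C s) = Gamma s * (C s + \<i> * S s) + Gamma s * (C s - \<i> * S s)"
      by (simp add: algebra_simps)
    also have "\<dots> = 2 * (of_real (P / (2 * pi)) * of_real (pi / (2 * c)) * (h + h'))"
      unfolding e1 e2 by (rule alg(1))
    also have "of_real (P / (2 * pi)) * of_real (pi / (2 * c)) = complex_of_real P / (4 * of_real c)"
      by simp
    finally have "Gamma s * C s = complex_of_real P / (4 * of_real c) * (h + h')"
      by (rule mult_left_cancel[THEN iffD1, rotated]) simp
    hence "4 * of_real c * (Gamma s * C s) = of_real P * (h + h')" using cd by simp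
    hence "rGamma s * (4 * of_real c * (Gamma s * C s)) = rGamma s * (of_real P * (h + h'))" by simp
    thus "4 * cos (of_real (pi / 2) * s) * C s = rGamma s * of_real (2 * pi * real m) powr s * (h + h')"
      unfolding cs P using G by (metis (no_types, opaque_lifting) mult.assoc mult.commute mult.left_neutral)
    have "2 * \<i> * (Gamma s * S s) = Gamma s * (C s + \<i> * S s) - Gamma s * (C s - \<i> * S s)"
      by (simp add: algebra_simps)
    also have "\<dots> = 2 * \<i> * (of_real (P / (2 * pi)) * of_real (pi / (2 * d)) * (h - h'))"
      unfolding e1 e2 by (rule alg(2))
    also have "of_real (P / (2 * pi)) * of_real (pi / (2 * d)) = complex_of_real P / (4 * of_real d)"
      by simp
    finally have "Gamma s * S s = complex_of_real P / (4 * of_real d) * (h - h')"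
      by (rule mult_left_cancel[THEN iffD1, rotated]) simp
    hence "4 * of_real d * (Gamma s * S s) = of_real P * (h - h')" using cd by simp
    hence "rGamma s * (4 * of_real d * (Gamma s * S s)) = rGamma s * (of_real P * (h - h'))" by simp
    thus "4 * sin (of_real (pi / 2) * s) * S s = rGamma s * of_real (2 * pi * real m) powr s * (h - h')"
      unfolding cs P using G by (metis (no_types, opaque_lifting) mult.assoc mult.commute mult.left_neutral)
  qed
  have X0: "s \<noteq> 0" if "s \<in> X" for s using that by (auto simp: X_def)
  have hz: "hurwitz_zeta (1 - s) v = - 1 / s + hurwitz_regular v (1 - s)" if "v > 0" "s \<noteq> 0" for v s
    using hurwitz_zeta_conv_regular[OF that(1), of "1 - s"] that(2) by simp
  have "4 * cos (of_real (pi / 2) * s) * (s * C s) -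
           rGamma s * of_real (2 * pi * real m) powr s *
           (s * (hurwitz_regular x (1 - s) + hurwitz_regular (1 - x) (1 - s)) - 2) = 0" for s
  proof (rule analytic_continuation[where S = UNIV and U = X and \<xi> = "of_real (-1/2)" and f = "\<lambda>s. 4 * cos (of_real (pi / 2) * s) * (s * C s) -
           rGamma s * of_real (2 * pi * real m) powr s *
           (s * (hurwitz_regular x (1 - s) + hurwitz_regular (1 - x) (1 - s)) - 2)"])
    show "(\<lambda>s. 4 * cos (of_real (pi / 2) * s) * (s * C s) -
           rGamma s * of_real (2 * pi * real m) powr s *
           (s * (hurwitz_regular x (1 - s) + hurwitz_regular (1 - x) (1 - s)) - 2)) holomorphic_on UNIV"
      using x M by (intro holomorphic_intros holC holR') auto
    fix s assume s: "s \<in> X"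
    have "4 * cos (of_real (pi / 2) * s) * (s * C s) = s * (4 * cos (of_real (pi / 2) * s) * C s)" by (simp only: mult_ac)
    also have "\<dots> = rGamma s * of_real (2 * pi * real m) powr s * (s * (hurwitz_zeta (1 - s) x + hurwitz_zeta (1 - s) (1 - x)))"
      unfolding real_eq(1)[OF s] by (simp only: mult_ac)
    also have "s * (hurwitz_zeta (1 - s) x + hurwitz_zeta (1 - s) (1 - x)) =
        s * (hurwitz_regular x (1 - s) + hurwitz_regular (1 - x) (1 - s)) - 2"
    proof -
      have "s * hurwitz_zeta (1 - s) v = s * hurwitz_regular v (1 - s) - 1" if "v > 0" for v
        using hz[OF that X0[OF s]] X0[OF s] by (simp add: field_simps)
      from this[of x] this[of "1 - x"] show ?thesis using x by (simp add: distrib_left)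
    qed
    finally show "4 * cos (of_real (pi / 2) * s) * (s * C s) -
           rGamma s * of_real (2 * pi * real m) powr s *
           (s * (hurwitz_regular x (1 - s) + hurwitz_regular (1 - x) (1 - s)) - 2) = 0" by simp
  qed (use X in \<open>auto simp: connected_UNIV\<close>)
  thus "4 * cos (of_real (pi / 2) * s) * (s * (\<Sum>r=1..m. of_real (cos (\<theta> r)) * hurwitz_regular (real r / real m) s)) =
           rGamma s * of_real (2 * pi * real m) powr s *
           (s * (hurwitz_regular x (1 - s) + hurwitz_regular (1 - x) (1 - s)) - 2)"
    unfolding C_def right_minus_eq .
  have "4 * sin (of_real (pi / 2) * s) * S s - rGamma s * of_real (2 * pi * real m) powr s *
           (hurwitz_regular x (1 - s) - hurwitz_regular (1 - x) (1 - s)) = 0" for s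
  proof (rule analytic_continuation[where S = UNIV and U = X and \<xi> = "of_real (-1/2)" and f = "\<lambda>s. 4 * sin (of_real (pi / 2) * s) * S s - rGamma s * of_real (2 * pi * real m) powr s *
           (hurwitz_regular x (1 - s) - hurwitz_regular (1 - x) (1 - s))"])
    show "(\<lambda>s. 4 * sin (of_real (pi / 2) * s) * S s - rGamma s * of_real (2 * pi * real m) powr s *
           (hurwitz_regular x (1 - s) - hurwitz_regular (1 - x) (1 - s))) holomorphic_on UNIV"
      using x M by (intro holomorphic_intros holS holR') auto
    fix s assume s: "s \<in> X"
    show "4 * sin (of_real (pi / 2) * s) * S s - rGamma s * of_real (2 * pi * real m) powr s *
           (hurwitz_regular x (1 - s) - hurwitz_regular (1 - x) (1 - s)) = 0"
      unfolding real_eq(2)[OF s] using hz[of x s] hz[of "1 - x" s] x X0[OF s] by simp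
  qed (use X in \<open>auto simp: connected_UNIV\<close>)
  thus "4 * sin (of_real (pi / 2) * s) * (\<Sum>r=1..m. of_real (sin (\<theta> r)) * hurwitz_regular (real r / real m) s) =
           rGamma s * of_real (2 * pi * real m) powr s *
           (hurwitz_regular x (1 - s) - hurwitz_regular (1 - x) (1 - s))"
    unfolding S_def right_minus_eq .
qed

section \<open>Stieltjes constants and derivatives at 1\<close>

lemma stieltjes_gamma_1:
  assumes "v > 0"
  shows "stieltjes_gamma 1 v = - deriv (hurwitz_regular v) 1"
  using stieltjes_gamma_eq[OF hurwitz_regular_holomorphic[OF assms] hurwitz_zeta_conv_regular[OF assms], of 1] by simp

lemma sum_stieltjes_gamma_1:
  assumes "m > 0"
  shows "(\<Sum>r=1..m. stieltjes_gamma 1 (real r / real m) * complex_of_real (c r)) =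
         - deriv (\<lambda>s. \<Sum>r=1..m. of_real (c r) * hurwitz_regular (real r / real m) s) 1"
proof -
  have "((\<lambda>s. \<Sum>r=1..m. of_real (c r) * hurwitz_regular (real r / real m) s) has_field_derivative
      (\<Sum>r=1..m. of_real (c r) * deriv (hurwitz_regular (real r / real m)) 1)) (at 1)"
  proof (intro DERIV_sum DERIV_cmult)
    fix r assume "r \<in> {1..m}"
    hence "real r / real m > 0" using assms by auto
    thus "(hurwitz_regular (real r / real m) has_field_derivative deriv (hurwitz_regular (real r / real m)) 1) (at 1)"
      by (rule holomorphic_derivI[OF hurwitz_regular_holomorphic]) auto
  qed
  hence d: "deriv (\<lambda>s. \<Sum>r=1..m. of_real (c r) * hurwitz_regular (real r / real m) s) 1 =
      (\<Sum>r=1..m. of_real (c r) * deriv (hurwitz_regular (real r / real m)) 1)"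
    by (rule DERIV_imp_deriv)
  have "(\<Sum>r=1..m. stieltjes_gamma 1 (real r / real m) * complex_of_real (c r)) =
      (\<Sum>r=1..m. - (of_real (c r) * deriv (hurwitz_regular (real r / real m)) 1))"
  proof (rule sum.cong)
    fix r assume "r \<in> {1..m}"
    hence "real r / real m > 0" using assms by auto
    thus "stieltjes_gamma 1 (real r / real m) * complex_of_real (c r) =
        - (of_real (c r) * deriv (hurwitz_regular (real r / real m)) 1)"
      using stieltjes_gamma_1[of "real r / real m"] by (simp only: mult_minus_left mult_minus_right mult.commute simp_thms)
  qed auto
  thus ?thesis unfolding d by (simp only: sum_negf)
qed

text \<open>Source of the factor gamma + ln(2 pi m): at s = 1 the function M^s/Gamma(s) has value M
  and logarithmic derivative ln M - psi(1), with psi(1) = -gamma.\<close>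

lemma rGamma_powr_deriv_1:
  assumes "M > 0"
  shows "((\<lambda>s. rGamma s * complex_of_real M powr s) has_field_derivative
           complex_of_real (M * (euler_mascheroni + ln M))) (at 1)"
proof -
  have "(1::complex) \<notin> \<int>\<^sub>\<le>\<^sub>0" by (auto elim!: nonpos_Ints_cases)
  hence "((\<lambda>s. rGamma s * complex_of_real M powr s) has_field_derivative
      (- rGamma 1 * Digamma 1) * complex_of_real M powr 1 + (Ln (complex_of_real M) * complex_of_real M powr 1) * rGamma 1) (at 1)"
    using assms by (intro DERIV_mult has_field_derivative_rGamma_no_nonpos_int has_field_derivative_powr_right) auto
  thus ?thesis using assms by (simp add: Ln_of_real algebra_simps)
qed

lemma ln_Gamma_complement:
  assumes "0 < x" "x < 1"
  shows "ln (Gamma x) + ln (Gamma (1 - x)) = ln pi - ln (sin (pi * x))"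
proof -
  have s: "sin (pi * x) > 0" using assms by (intro sin_gt_zero) auto
  have "ln (Gamma x * Gamma (1 - x)) = ln (pi / sin (pi * x))"
    by (simp only: Gamma_reflection_real[OF assms])
  moreover have "Gamma x > 0" "Gamma (1 - x) > 0" using assms by (auto intro!: Gamma_real_pos)
  ultimately show ?thesis using s by (simp add: ln_mult ln_div)
qed

text \<open>The reflection s -> 1 - s contributes (-1)^2 = 1 to a second derivative, and -2/s
  collects both polar parts, which turns regular parts into full zeta functions.\<close>

lemma second_deriv_hurwitz_sum:
  assumes x: "0 < x" "x < 1"
  shows "(deriv ^^ 2) (\<lambda>s. hurwitz_regular x (1 - s) + hurwitz_regular (1 - x) (1 - s) - 2 / s) 1 =
         (deriv ^^ 2) (\<lambda>s. hurwitz_zeta s x) 0 + (deriv ^^ 2) (\<lambda>s. hurwitz_zeta s (1 - x)) 0"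
proof -
  define U where "U = UNIV - {1 :: complex}"
  define V where "V = UNIV - {0 :: complex}"
  have U: "open U" "0 \<in> U" and V: "open V" "1 \<in> V" by (auto simp: U_def V_def open_delete)
  have hol: "(\<lambda>s. hurwitz_zeta s v) holomorphic_on U" if "v > 0" for v
  proof (rule holomorphic_transform[of "\<lambda>s. 1 / (s - 1) + hurwitz_regular v s"])
    show "(\<lambda>s. 1 / (s - 1) + hurwitz_regular v s) holomorphic_on U"
      by (intro holomorphic_intros holomorphic_on_subset[OF hurwitz_regular_holomorphic[OF that]]) (auto simp: U_def)
  qed (use that in \<open>auto simp: U_def hurwitz_zeta_conv_regular\<close>)
  have x': "1 - x > 0" using x by simp
  define P where "P = (\<lambda>s. hurwitz_zeta s x + hurwitz_zeta s (1 - x))"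
  have holP: "P holomorphic_on U" unfolding P_def using x x' by (intro holomorphic_intros hol) auto
  have UV: "- 1 * s + 1 \<in> U" if "s \<in> V" for s using that by (auto simp: U_def V_def)
  have holPV: "(\<lambda>s. P (- 1 * s + 1)) holomorphic_on V"
  proof -
    have "(\<lambda>s::complex. - 1 * s + 1) holomorphic_on V" by (intro holomorphic_intros)
    from holomorphic_on_compose_gen[OF this holP] show ?thesis using UV by (auto simp: o_def image_subset_iff)
  qed
  have eq: "P (- 1 * s + 1) = hurwitz_regular x (1 - s) + hurwitz_regular (1 - x) (1 - s) - 2 / s" if "s \<in> V" for s
  proof -
    have s: "s \<noteq> 0" using that by (simp add: V_def)
    hence "1 - s \<noteq> 1" by simp
    from hurwitz_zeta_conv_regular[OF x(1) this] hurwitz_zeta_conv_regular[OF x' this]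
    have "P (1 - s) = hurwitz_regular x (1 - s) + hurwitz_regular (1 - x) (1 - s) + 2 * (1 / (- s))"
      unfolding P_def by simp
    thus ?thesis by (simp add: algebra_simps)
  qed
  have "(deriv ^^ 2) (\<lambda>s. hurwitz_regular x (1 - s) + hurwitz_regular (1 - x) (1 - s) - 2 / s) 1 =
        (deriv ^^ 2) (\<lambda>s. P (- 1 * s + 1)) 1"
  proof (rule sym, rule higher_deriv_transform_within_open[OF holPV _ V])
    show "(\<lambda>s. hurwitz_regular x (1 - s) + hurwitz_regular (1 - x) (1 - s) - 2 / s) holomorphic_on V"
      by (rule holomorphic_transform[OF holPV]) (rule eq)
  qed (rule eq)
  also have "\<dots> = (- 1) ^ 2 * (deriv ^^ 2) P (- 1 * 1 + 1)"
    by (rule higher_deriv_compose_linear'[OF holP V(1) U(1) V(2) UV])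
  also have "\<dots> = (deriv ^^ 2) P 0" by simp
  also have "\<dots> = (deriv ^^ 2) (\<lambda>s. hurwitz_zeta s x) 0 + (deriv ^^ 2) (\<lambda>s. hurwitz_zeta s (1 - x)) 0"
    unfolding P_def by (rule higher_deriv_add[OF hol[OF x(1)] hol[OF x'] U])
  finally show ?thesis .
qed

lemma hurwitz_regular_reflected_deriv:
  assumes "v > 0"
  shows "((\<lambda>s. hurwitz_regular v (1 - s)) has_field_derivative - deriv (hurwitz_regular v) (1 - s)) (at s)"
proof -
  have "(hurwitz_regular v has_field_derivative deriv (hurwitz_regular v) (1 - s)) (at (1 - s))"
    by (rule holomorphic_derivI[OF hurwitz_regular_holomorphic[OF assms]]) auto
  moreover have "((\<lambda>s. 1 - s) has_field_derivative - 1) (at s)"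
    by (auto intro!: derivative_eq_intros)
  ultimately show ?thesis using DERIV_chain2[of "hurwitz_regular v" _ "\<lambda>s. 1 - s"] by fastforce
qed

lemma sum_last_stieltjes:
  assumes "m > 0"
  shows "(\<Sum>r=1..m. stieltjes_gamma 1 (real r / real m) * c r) =
         (\<Sum>r=1..m - 1. stieltjes_gamma 1 (real r / real m) * c r) + stieltjes_gamma 1 1 * c m"
proof -
  have "{1..m} = insert m {1..m - 1}" "m \<notin> {1..m - 1}" using assms by auto
  thus ?thesis using assms by (simp add: add.commute)
qed

theorem theorem2:
  fixes m k :: nat
  assumes "m \<ge> 2" and "k \<in> {1..m - 1}"
  shows "(\<Sum>r = 1..m - 1. stieltjes_gamma 1 (real r / real m) *
             complex_of_real (cos (2 * pi * real r * real k / real m))) =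
           - stieltjes_gamma 1 1
           + complex_of_real (real m * (euler_mascheroni + ln (2 * pi * real m)) *
               ln (2 * sin (real k * pi / real m)))
           + of_nat m / 2 *
               ((deriv ^^ 2) (\<lambda>s. hurwitz_zeta s (real k / real m)) 0 +
                (deriv ^^ 2) (\<lambda>s. hurwitz_zeta s (1 - real k / real m)) 0)
       \<and> (\<Sum>r = 1..m - 1. stieltjes_gamma 1 (real r / real m) *
             complex_of_real (sin (2 * pi * real r * real k / real m))) =
           complex_of_real
             (pi / 2 * (euler_mascheroni + ln (2 * pi * real m)) * (2 * real k - real m)
              - pi * real m / 2 * (ln pi - ln (sin (real k * pi / real m)))
              + real m * pi * ln (Gamma (real k / real m)))"
proof -
  define x where "x = real k / real m"
  define M where "M = 2 * pi * real m"
  define L where "L = euler_mascheroni + ln M"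
  have k: "0 < k" "k < m" using assms by auto
  have m0: "m > 0" using k by simp
  have x: "0 < x" "x < 1" using k by (auto simp: x_def)
  have x': "0 < 1 - x" "1 - x < 1" using x by auto
  have M: "M > 0" using k by (simp add: M_def)
  define C where "C = (\<lambda>s. \<Sum>r=1..m. of_real (cos (2 * pi * real r * real k / real m)) * hurwitz_regular (real r / real m) s)"
  define S where "S = (\<lambda>s. \<Sum>r=1..m. of_real (sin (2 * pi * real r * real k / real m)) * hurwitz_regular (real r / real m) s)"
  define b where "b = (\<lambda>s. rGamma s * complex_of_real M powr s)"
  define V where "V = UNIV - {0 :: complex}"
  have V: "open V" "1 \<in> V" by (auto simp: V_def open_delete)
  have fe: "4 * cos (of_real (pi / 2) * s) * (s * C s) =
        b s * (s * (hurwitz_regular x (1 - s) + hurwitz_regular (1 - x) (1 - s)) - 2)"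
      "4 * sin (of_real (pi / 2) * s) * S s =
        b s * (hurwitz_regular x (1 - s) - hurwitz_regular (1 - x) (1 - s))" for s
    using finite_functional_equation[OF k, of s] by (simp_all only: C_def S_def b_def x_def M_def)
  have holR: "hurwitz_regular v holomorphic_on A" if "v > 0" for v A
    using hurwitz_regular_holomorphic[OF that] holomorphic_on_subset by blast
  have holC: "C holomorphic_on A" and holS: "S holomorphic_on A" for A
    unfolding C_def S_def using k by (auto intro!: holomorphic_intros holR)
  have holb: "b holomorphic_on A" for A
    unfolding b_def using M by (intro holomorphic_intros) auto
  have b': "(b has_field_derivative complex_of_real (M * L)) (at 1)"
    unfolding b_def L_def by (rule rGamma_powr_deriv_1[OF M])
  have b1: "b 1 = of_real M" using M by (simp add: b_def)
  note hx = hurwitz_regular_at_0[OF x(1) less_imp_le[OF x(2)]]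
    and hx' = hurwitz_regular_at_0[OF x'(1) less_imp_le[OF x'(2)]]
  note R0 = hx(1) hx'(1) hx(2) hx'(2)
  have sinpos: "sin (pi * x) > 0" using x by (intro sin_gt_zero) auto
  have arg: "real k * pi / real m = pi * x" by (simp add: x_def)

  \<comment> \<open>Cosine part: \<open>f s * C s = b s * T s\<close> away from 0. At 1 the values
    \<open>f 1\<close>, \<open>T 1\<close> and the second derivative of \<open>f\<close> vanish, so
    the second-order product rule isolates \<open>deriv C 1\<close> and eliminates the second
    derivative of \<open>b\<close>.\<close>
  define f where "f = (\<lambda>s. 4 * cos (complex_of_real (pi / 2) * s))"
  define T where "T = (\<lambda>s. hurwitz_regular x (1 - s) + hurwitz_regular (1 - x) (1 - s) - 2 / s)"
  have f1: "f 1 = 0" by (simp add: f_def flip: cos_of_real)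
  have df: "deriv f = (\<lambda>s. - (2 * of_real pi * sin (complex_of_real (pi / 2) * s)))"
  proof
    fix s
    show "deriv f s = - (2 * of_real pi * sin (complex_of_real (pi / 2) * s))"
      unfolding f_def by (rule DERIV_imp_deriv) (auto intro!: derivative_eq_intros)
  qed
  have f'1: "deriv f 1 = - (2 * of_real pi)" unfolding df by (simp flip: sin_of_real)
  have f''1: "deriv (deriv f) 1 = 0"
    unfolding df by (rule DERIV_imp_deriv) (auto intro!: derivative_eq_intros simp flip: cos_of_real)
  have holf: "f holomorphic_on V" unfolding f_def by (intro holomorphic_intros)
  \<comment> \<open>(3/2 - x) + (1/2 + x) - 2 = 0.\<close>
  have T1: "T 1 = 0" by (simp add: T_def R0)
  have "(T has_field_derivative - deriv (hurwitz_regular x) (1 - 1) + - deriv (hurwitz_regular (1 - x)) (1 - 1) + 2) (at 1)"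
    unfolding T_def
    by (auto intro!: derivative_eq_intros hurwitz_regular_reflected_deriv x(1) x'(1))
  hence "deriv T 1 = - deriv (hurwitz_regular x) (1 - 1) + - deriv (hurwitz_regular (1 - x)) (1 - 1) + 2"
    by (rule DERIV_imp_deriv)
  also have "\<dots> = of_real (ln (2 * pi) - (ln (Gamma x) + ln (Gamma (1 - x))))"
    by (simp add: R0)
  \<comment> \<open>By the reflection formula the subtracted sum is ln(pi) - ln(sin(pi x)).\<close>
  also have "ln (2 * pi) - (ln (Gamma x) + ln (Gamma (1 - x))) = ln (2 * sin (pi * x))"
    unfolding ln_Gamma_complement[OF x] using sinpos by (simp add: ln_mult)
  finally have T'1: "deriv T 1 = of_real (ln (2 * sin (pi * x)))" .
  have T''1: "deriv (deriv T) 1 = (deriv ^^ 2) (\<lambda>s. hurwitz_zeta s x) 0 + (deriv ^^ 2) (\<lambda>s. hurwitz_zeta s (1 - x)) 0"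
    using second_deriv_hurwitz_sum[OF x] by (simp add: T_def numeral_2_eq_2)
  have holT: "T holomorphic_on V"
    unfolding T_def
  proof (intro holomorphic_intros)
    show "(\<lambda>s. hurwitz_regular x (1 - s)) holomorphic_on V" "(\<lambda>s. hurwitz_regular (1 - x) (1 - s)) holomorphic_on V"
      using hurwitz_regular_reflected_deriv[OF x(1)] hurwitz_regular_reflected_deriv[OF x'(1)] V(1)
      unfolding holomorphic_on_open[OF V(1)] by blast+
  qed (auto simp: V_def)
  have feC: "f s * C s = b s * T s" if "s \<in> V" for s
  proof -
    have s: "s \<noteq> 0" using that by (simp add: V_def)
    have "s * (f s * C s) = b s * (s * (hurwitz_regular x (1 - s) + hurwitz_regular (1 - x) (1 - s)) - 2)"
      using fe(1)[of s] by (simp add: f_def mult_ac)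
    also have "\<dots> = s * (b s * T s)" using s by (simp add: T_def field_simps)
    finally show ?thesis using s by simp
  qed
  have "(deriv ^^ 2) (\<lambda>s. f s * C s) 1 = (deriv ^^ 2) (\<lambda>s. b s * T s) 1"
    by (rule higher_deriv_transform_within_open[OF _ _ V feC]) (intro holomorphic_intros holf holC holb holT)+
  hence "f 1 * deriv (deriv C) 1 + 2 * deriv f 1 * deriv C 1 + deriv (deriv f) 1 * C 1 =
         b 1 * deriv (deriv T) 1 + 2 * deriv b 1 * deriv T 1 + deriv (deriv b) 1 * T 1"
    unfolding higher_deriv_mult[OF holf holC V] higher_deriv_mult[OF holb holT V]
    by (simp add: numeral_2_eq_2)
  hence "- (4 * of_real pi * deriv C 1) = of_real M * deriv (deriv T) 1 + 2 * of_real (M * L) * deriv T 1"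
    unfolding f1 f'1 f''1 b1 T1 DERIV_imp_deriv[OF b'] by simp
  hence "of_real (4 * pi) * (- deriv C 1) = of_real (4 * pi) *
      (of_real (real m * L * ln (2 * sin (pi * x))) + of_nat m / 2 * deriv (deriv T) 1)"
    unfolding T'1 by (simp add: M_def algebra_simps)
  hence dC: "- deriv C 1 = of_real (real m * L * ln (2 * sin (pi * x))) + of_nat m / 2 * deriv (deriv T) 1"
    by (rule mult_left_cancel[THEN iffD1, rotated]) simp
  \<comment> \<open>The summand r = m has weight 1 and accounts for the term with
    \<open>stieltjes_gamma 1 1\<close>.\<close>
  have "cos (2 * pi * real m * real k / real m) = 1"
    using m0 cos_int_2pin[of "int k"] by (simp add: mult_ac)
  hence "(\<Sum>r = 1..m - 1. stieltjes_gamma 1 (real r / real m) * complex_of_real (cos (2 * pi * real r * real k / real m)))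
      + stieltjes_gamma 1 1 = - deriv C 1"
    unfolding C_def sum_stieltjes_gamma_1[OF m0, symmetric] sum_last_stieltjes[OF m0] by simp
  hence cos_part: "(\<Sum>r = 1..m - 1. stieltjes_gamma 1 (real r / real m) * complex_of_real (cos (2 * pi * real r * real k / real m))) =
      - stieltjes_gamma 1 1 + of_real (real m * L * ln (2 * sin (pi * x))) + of_nat m / 2 * deriv (deriv T) 1"
    unfolding dC by (simp add: algebra_simps)

  \<comment> \<open>Sine part: sin(pi s/2) is 1 with derivative 0 at s = 1, so one derivative gives
    4 S'(1) on the left. On the right \<open>q 1\<close> is 1 - 2x, the origin of 2k - m.\<close>
  define q where "q = (\<lambda>s. hurwitz_regular x (1 - s) - hurwitz_regular (1 - x) (1 - s))"
  have S': "(S has_field_derivative deriv S 1) (at 1)" by (rule holomorphic_derivI[OF holS[of UNIV]]) auto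
  have "((\<lambda>s. 4 * sin (of_real (pi / 2) * s) * S s) has_field_derivative 4 * deriv S 1) (at 1)"
    using S' by (auto intro!: derivative_eq_intros simp flip: sin_of_real cos_of_real)
  moreover have "((\<lambda>s. b s * q s) has_field_derivative
      of_real (M * L) * q 1 + (- deriv (hurwitz_regular x) (1 - 1) - - deriv (hurwitz_regular (1 - x)) (1 - 1)) * b 1) (at 1)"
    unfolding q_def by (intro DERIV_mult DERIV_diff b' hurwitz_regular_reflected_deriv x(1) x'(1))
  moreover have "(\<lambda>s. 4 * sin (of_real (pi / 2) * s) * S s) = (\<lambda>s. b s * q s)"
    unfolding q_def using fe(2) by blast
  ultimately have "4 * deriv S 1 = of_real (M * L) * q 1 +
      (- deriv (hurwitz_regular x) (1 - 1) - - deriv (hurwitz_regular (1 - x)) (1 - 1)) * b 1"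
    using DERIV_unique by metis
  also have "\<dots> = of_real (M * L * (1 - 2 * x) + (ln (Gamma (1 - x)) - ln (Gamma x)) * M)"
    by (simp add: q_def R0 b1)
  \<comment> \<open>Eliminating Gamma(1 - x) doubles ln Gamma(x) and brings in the logarithm of the
    sine.\<close>
  also have "ln (Gamma (1 - x)) = ln pi - ln (sin (pi * x)) - ln (Gamma x)"
    using ln_Gamma_complement[OF x] by simp
  also have "M * L * (1 - 2 * x) + (ln pi - ln (sin (pi * x)) - ln (Gamma x) - ln (Gamma x)) * M =
      4 * (- (pi / 2 * L * (2 * real k - real m) - pi * real m / 2 * (ln pi - ln (sin (pi * x))) + real m * pi * ln (Gamma x)))"
    using m0 by (simp add: M_def x_def field_simps)
  finally have "4 * deriv S 1 = 4 * complex_of_real (- (pi / 2 * L * (2 * real k - real m) - pi * real m / 2 * (ln pi - ln (sin (pi * x)))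
      + real m * pi * ln (Gamma x)))" by (simp only: of_real_mult of_real_numeral)
  hence dS: "deriv S 1 = of_real (- (pi / 2 * L * (2 * real k - real m) - pi * real m / 2 * (ln pi - ln (sin (pi * x)))
      + real m * pi * ln (Gamma x)))" by (rule mult_left_cancel[THEN iffD1, rotated]) simp
  \<comment> \<open>Here the summand r = m has weight 0, so no Stieltjes constant remains on the
    right.\<close>
  have "sin (2 * pi * real m * real k / real m) = 0"
    using m0 sin_int_2pin[of "int k"] by (simp add: mult_ac)
  hence "(\<Sum>r = 1..m - 1. stieltjes_gamma 1 (real r / real m) * complex_of_real (sin (2 * pi * real r * real k / real m)))
      = - deriv S 1"
    unfolding S_def sum_stieltjes_gamma_1[OF m0, symmetric] sum_last_stieltjes[OF m0] by simp
  hence sin_part: "(\<Sum>r = 1..m - 1. stieltjes_gamma 1 (real r / real m) * complex_of_real (sin (2 * pi * real r * real k / real m))) =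
      complex_of_real (pi / 2 * L * (2 * real k - real m) - pi * real m / 2 * (ln pi - ln (sin (pi * x))) + real m * pi * ln (Gamma x))"
    unfolding dS by simp
  show ?thesis
    using cos_part sin_part unfolding T''1 L_def M_def arg x_def[symmetric] by (intro conjI)
qed

end
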